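(* The theory $\mathrm{RCA}_0^{\Omega}+\mathrm{STP}+\mathrm{QF\text{-}AC}^{1,1}$ proves the equivalences $$\Pi^1_1\text{-TRANS}\leftrightarrow\Sigma^0_1\text{-DET}^{*}\leftrightarrow\mathrm{U}\Sigma^0_1\text{-DET}\leftrightarrow(S^2).$$
   Context: BASE THEORY. Finite types: $0$ (natural numbers), $\sigma\to\tau$, and $\sigma^{*}$ (finite sequences of objects of type $\sigma$); $1=0\to 0$, $2=1\to 0$, $3=2\to 0$. Superscripts indicate types; tuples are coded as single objects where convenient. Equality $=_0$ is primitive; for $\tau=\tau_1\to\dots\to\tau_k\to 0$, $x=_\tau y$ means $(\forall z_1\dots z_k)(xz_1\dots z_k=_0 yz_1\dots z_k)$. $\mathrm{RCA}_0^{\omega}$ is Kohlenbach's higher-order base theory: classical arithmetic in all finite types with combinators, zero, successor, the recursor $R_0$ (primitive recursion with type $0$ values), quantifier-free induction, extensionality $x=_\rho y\to\varphi(x)=_\tau\varphi(y)$ for all $\varphi^{\rho\to\tau}$, and $\mathrm{QF\text{-}AC}^{1,0}$, where $\mathrm{QF\text{-}AC}^{\sigma,\tau}$ is $(\forall x^\sigma)(\exists y^\tau)A_0(x,y)\to(\exists F^{\sigma\to\tau})(\forall x)A_0(x,F(x))$ for quantifier-free $A_0$. $\mathrm{RCA}_0^{\Omega}$ extends $\mathrm{RCA}_0^{\omega}$ (with the types $\sigma^*$) by a predicate $\mathrm{st}$ ("is standard") for each type. A formula is internal if it does not contain $\mathrm{st}$; $(\forall^{\mathrm{st}}x)A$ is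 $(\forall x)(\mathrm{st}(x)\to A)$, $(\exists^{\mathrm{st}}x)A$ is $(\exists x)(\mathrm{st}(x)\wedge A)$; $N\in\Omega$ means $\neg\mathrm{st}(N^0)$; $A^{\mathrm{st}}$ is $A$ with all quantifiers (except bounded number quantifiers) relativised to $\mathrm{st}$. Axioms: (i) standardness respects equality, closed terms are standard, a standard functional applied to a standard object is standard, and numbers below a standard number are standard; (ii) Idealization: $(\forall^{\mathrm{st}}x^{\sigma^*})(\exists y^\tau)(\forall z\in x)\varphi(z,y)\to(\exists y)(\forall^{\mathrm{st}}z^{\sigma})\varphi(z,y)$ for internal $\varphi$; (iii) $\mathrm{HAC}_{\mathrm{int}}$: $(\forall^{\mathrm{st}}x^{\rho})(\exists^{\mathrm{st}}y^{\tau})\varphi(x,y)\to(\exists^{\mathrm{st}}\Phi^{\rho\to\tau^*})(\forall^{\mathrm{st}}x)(\exists y\in\Phi(x))\varphi(x,y)$ for internal $\varphi$; (iv) $\mathrm{PF\text{-}TP}_\forall$: $(\forall^{\mathrm{st}}x^\tau)\varphi(x)\to(\forall x^\tau)\varphi(x)$ for internal $\varphi(x)$ with no parameters other than $x$; (v) for certain functionals uniquely specified by a parameter-free internal formula $D$ (e.g. the Suslin functional in $(S^2)$), a constant $\Xi_0$ with the axiom $\mathrm{st}(\Xi_0)\wedge(\forall^{\mathrm{st}}\Xi)[D^{\mathrm{st}}(\Xi)\to \Xi_0$ and $\Xi$ agree on all standard inputs$]$; these constants do not count as parameters in (iv). NOTATION. $\overline{h}k$ is the (code of the) initial segment of $h$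 of length $k$. Sets $X^1$ are given by characteristic functions. A strategy for player 0 is a function $S_0$ from finite sequences of natural numbers of even length to $\mathbb{N}$; a strategy for player 1 is a function $S_1$ from finite sequences of odd length to $\mathbb{N}$ (both coded as type $1$ objects). $S_0\otimes S_1$ is the resulting play, i.e. the unique $h^1$ with $h(2n)=S_0(\overline{h}(2n))$ and $h(2n+1)=S_1(\overline{h}(2n+1))$ for all $n$. Let $\varphi(h^1,f^1)\equiv(\exists k^0)f(\overline{h}k)=0$. PRINCIPLES. $\mathrm{STP}$: $(\forall X^1)(\exists^{\mathrm{st}}Y^1)(\forall^{\mathrm{st}}x^0)(x\in X\leftrightarrow x\in Y)$. $(S^2)$: $(\exists S^2)(\forall f^1)[S(f)=_00\leftrightarrow(\exists g^1)(\forall x^0)(f(\overline{g}x)\neq0)]$. $\Pi^1_1\text{-TRANS}$: $(\forall^{\mathrm{st}}f^1)\big[(\forall^{\mathrm{st}}g^1)(\exists^{\mathrm{st}}x^0)f(\overline{g}x)=0\leftrightarrow(\forall g^1)(\exists x^0)f(\overline{g}x)=0\big]$. $\Sigma^0_1\text{-DET}^*$: $(\forall^{\mathrm{st}}f^1)\big[(\exists^{\mathrm{st}}S_0)(\forall S_1)\varphi(S_0\otimes S_1,f)\vee(\exists^{\mathrm{st}}S_1)(\forall S_0)\neg\varphi(S_0\otimes S_1,f)\big]$. $\mathrm{U}\Sigma^0_1\text{-DET}$: $(\exists\Phi^{1\to(1\times1)})(\forall f^1)\big[(\forall S_1)\varphi(\Phi(f)(1)\otimes S_1,f)\vee(\forall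 S_0)\neg\varphi(S_0\otimes\Phi(f)(2),f)\big]$, where $\Phi(f)(1),\Phi(f)(2)$ are the two components of $\Phi(f)$. *)

theory Defs
  imports Main
begin

text \<open>
  The theorem is a claim about formal derivability, so the language, the classical predicate
  calculus and the axioms of the base theories are all given as syntax.
\<close>

section \<open>Language\<close>

datatype ty = Nt | Fun ty ty (infixr "\<leadsto>" 60) | Seq ty

abbreviation T1 :: ty where "T1 \<equiv> Nt \<leadsto> Nt"
abbreviation T2 :: ty where "T2 \<equiv> T1 \<leadsto> Nt"

text \<open>
  \<open>Kc\<close> and \<open>Sc\<close> are the combinators, \<open>Rec\<close> is the recursor with values of type 0.  The finite
  sequence types are the usual definitional extension: \<open>Len\<close> is the length, \<open>Nth\<close> the projection,
  and \<open>Tab \<sigma> n f\<close> is the sequence f 0, ..., f (n - 1).  \<open>Xi i \<tau>\<close> are the additional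
  constants \<open>\<Xi>\<^sub>0\<close>, numbered by i.
\<close>

datatype con =
    Zero | Succ | Rec
  | Kc ty ty | Sc ty ty ty
  | Len ty | Nth ty | Tab ty
  | Xi nat ty

text \<open>A variable is a name together with a type; equal names of different types are different
  variables.\<close>

datatype tm = Var string ty | Con con | App tm tm (infixl "\<cdot>" 75)

fun ty_con :: "con \<Rightarrow> ty" where
  "ty_con Zero = Nt"
| "ty_con Succ = Nt \<leadsto> Nt"
| "ty_con Rec = Nt \<leadsto> Nt \<leadsto> (Nt \<leadsto> Nt \<leadsto> Nt) \<leadsto> Nt"
| "ty_con (Kc \<rho> \<tau>) = \<rho> \<leadsto> \<tau> \<leadsto> \<rho>"
| "ty_con (Sc \<delta> \<rho> \<tau>) = (\<delta> \<leadsto> \<rho> \<leadsto> \<tau>) \<leadsto> (\<delta> \<leadsto> \<rho>) \<leadsto> \<delta> \<leadsto> \<tau>"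
| "ty_con (Len \<sigma>) = Seq \<sigma> \<leadsto> Nt"
| "ty_con (Nth \<sigma>) = Seq \<sigma> \<leadsto> Nt \<leadsto> \<sigma>"
| "ty_con (Tab \<sigma>) = Nt \<leadsto> (Nt \<leadsto> \<sigma>) \<leadsto> Seq \<sigma>"
| "ty_con (Xi i \<tau>) = \<tau>"

text \<open>The value on ill-typed applications is irrelevant, see \<open>wft\<close>.\<close>

fun tyof :: "tm \<Rightarrow> ty" where
  "tyof (Var x \<tau>) = \<tau>"
| "tyof (Con c) = ty_con c"
| "tyof (s \<cdot> t) = (case tyof s of \<sigma> \<leadsto> \<tau> \<Rightarrow> \<tau> | _ \<Rightarrow> Nt)"

text \<open>Well-typed terms.  The parameter \<open>L\<close> is the set of additional constants that belong to the
  language.\<close>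

fun wft :: "(nat \<times> ty) set \<Rightarrow> tm \<Rightarrow> bool" where
  "wft L (Var x \<tau>) = True"
| "wft L (Con c) = (case c of Xi i \<tau> \<Rightarrow> (i, \<tau>) \<in> L | _ \<Rightarrow> True)"
| "wft L (s \<cdot> t) = (wft L s \<and> wft L t \<and> (\<exists>\<tau>. tyof s = tyof t \<leadsto> \<tau>))"

fun fvt :: "tm \<Rightarrow> (string \<times> ty) set" where
  "fvt (Var x \<tau>) = {(x, \<tau>)}"
| "fvt (Con c) = {}"
| "fvt (s \<cdot> t) = fvt s \<union> fvt t"

text \<open>\<open>Eq\<close> is the primitive equality of type 0.\<close>

datatype fm = Eq tm tm | St tm | Bot | Imp fm fm | All string ty fm

fun wff :: "(nat \<times> ty) set \<Rightarrow> fm \<Rightarrow> bool" where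
  "wff L (Eq s t) = (wft L s \<and> wft L t \<and> tyof s = Nt \<and> tyof t = Nt)"
| "wff L (St t) = wft L t"
| "wff L Bot = True"
| "wff L (Imp A B) = (wff L A \<and> wff L B)"
| "wff L (All x \<tau> A) = wff L A"

fun fv :: "fm \<Rightarrow> (string \<times> ty) set" where
  "fv (Eq s t) = fvt s \<union> fvt t"
| "fv (St t) = fvt t"
| "fv Bot = {}"
| "fv (Imp A B) = fv A \<union> fv B"
| "fv (All x \<tau> A) = fv A - {(x, \<tau>)}"

fun internal :: "fm \<Rightarrow> bool" where
  "internal (Eq s t) = True"
| "internal (St t) = False"
| "internal Bot = True"
| "internal (Imp A B) = (internal A \<and> internal B)"
| "internal (All x \<tau> A) = internal A"

text \<open>Internal quantifier-free formulas.\<close>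

fun qf :: "fm \<Rightarrow> bool" where
  "qf (Eq s t) = True"
| "qf (St t) = False"
| "qf Bot = True"
| "qf (Imp A B) = (qf A \<and> qf B)"
| "qf (All x \<tau> A) = False"

fun sbt :: "string \<times> ty \<Rightarrow> tm \<Rightarrow> tm \<Rightarrow> tm" where
  "sbt v u (Var x \<tau>) = (if (x, \<tau>) = v then u else Var x \<tau>)"
| "sbt v u (Con c) = Con c"
| "sbt v u (s \<cdot> t) = sbt v u s \<cdot> sbt v u t"

text \<open>Substitution is used only under the side condition \<open>free_for\<close>, which excludes capture.\<close>

fun sb :: "string \<times> ty \<Rightarrow> tm \<Rightarrow> fm \<Rightarrow> fm" where
  "sb v u (Eq s t) = Eq (sbt v u s) (sbt v u t)"
| "sb v u (St t) = St (sbt v u t)"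
| "sb v u Bot = Bot"
| "sb v u (Imp A B) = Imp (sb v u A) (sb v u B)"
| "sb v u (All x \<tau> A) = All x \<tau> (if (x, \<tau>) = v then A else sb v u A)"

fun free_for :: "tm \<Rightarrow> string \<times> ty \<Rightarrow> fm \<Rightarrow> bool" where
  "free_for u v (Imp A B) = (free_for u v A \<and> free_for u v B)"
| "free_for u v (All x \<tau> A) =
     (v \<notin> fv (All x \<tau> A) \<or> ((x, \<tau>) \<notin> fvt u \<and> free_for u v A))"
| "free_for u v _ = True"

definition Neg :: "fm \<Rightarrow> fm" where "Neg A = Imp A Bot"
definition Or :: "fm \<Rightarrow> fm \<Rightarrow> fm" where "Or A B = Imp (Neg A) B"
definition And :: "fm \<Rightarrow> fm \<Rightarrow> fm" where "And A B = Neg (Imp A (Neg B))"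
definition Iff :: "fm \<Rightarrow> fm \<Rightarrow> fm" where "Iff A B = And (Imp A B) (Imp B A)"
definition Ex :: "string \<Rightarrow> ty \<Rightarrow> fm \<Rightarrow> fm" where "Ex x \<tau> A = Neg (All x \<tau> (Neg A))"

definition All_st :: "string \<Rightarrow> ty \<Rightarrow> fm \<Rightarrow> fm" where
  "All_st x \<tau> A = All x \<tau> (Imp (St (Var x \<tau>)) A)"
definition Ex_st :: "string \<Rightarrow> ty \<Rightarrow> fm \<Rightarrow> fm" where
  "Ex_st x \<tau> A = Ex x \<tau> (And (St (Var x \<tau>)) A)"


section \<open>Classical many-sorted predicate calculus\<close>

text \<open>\<open>prv L T A\<close>: A is derivable from the axioms T in the language with additional constants L.
  Generalisation is unrestricted, so free variables of axioms are read as universally closed.\<close>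

inductive prv :: "(nat \<times> ty) set \<Rightarrow> fm set \<Rightarrow> fm \<Rightarrow> bool" for L T where
  ax: "A \<in> T \<Longrightarrow> prv L T A"
| imp_k: "wff L A \<Longrightarrow> wff L B \<Longrightarrow> prv L T (Imp A (Imp B A))"
| imp_s: "wff L A \<Longrightarrow> wff L B \<Longrightarrow> wff L C \<Longrightarrow>
    prv L T (Imp (Imp A (Imp B C)) (Imp (Imp A B) (Imp A C)))"
| dne: "wff L A \<Longrightarrow> prv L T (Imp (Neg (Neg A)) A)"
| all_inst: "wff L A \<Longrightarrow> wft L t \<Longrightarrow> tyof t = \<tau> \<Longrightarrow> free_for t (x, \<tau>) A \<Longrightarrow>
    prv L T (Imp (All x \<tau> A) (sb (x, \<tau>) t A))"
| all_imp: "wff L A \<Longrightarrow> wff L B \<Longrightarrow> (x, \<tau>) \<notin> fv A \<Longrightarrow>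
    prv L T (Imp (All x \<tau> (Imp A B)) (Imp A (All x \<tau> B)))"
| mp: "prv L T (Imp A B) \<Longrightarrow> prv L T A \<Longrightarrow> prv L T B"
| gen: "prv L T A \<Longrightarrow> prv L T (All x \<tau> A)"


section \<open>Some closed terms\<close>

abbreviation zero :: tm where "zero \<equiv> Con Zero"
abbreviation suc :: "tm \<Rightarrow> tm" where "suc t \<equiv> Con Succ \<cdot> t"
abbreviation recn :: "tm \<Rightarrow> tm \<Rightarrow> tm \<Rightarrow> tm" where "recn n a f \<equiv> Con Rec \<cdot> n \<cdot> a \<cdot> f"

text \<open>Bracket abstraction: \<open>lam x \<sigma> t\<close> is the combinator term for \<open>\<lambda>x\<^sup>\<sigma>. t\<close>.\<close>

fun lam :: "string \<Rightarrow> ty \<Rightarrow> tm \<Rightarrow> tm" where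
  "lam x \<sigma> (Var y \<tau>) =
     (if (y, \<tau>) = (x, \<sigma>) then Con (Sc \<sigma> (\<sigma> \<leadsto> \<sigma>) \<sigma>) \<cdot> Con (Kc \<sigma> (\<sigma> \<leadsto> \<sigma>)) \<cdot> Con (Kc \<sigma> \<sigma>)
      else Con (Kc \<tau> \<sigma>) \<cdot> Var y \<tau>)"
| "lam x \<sigma> (Con c) = Con (Kc (ty_con c) \<sigma>) \<cdot> Con c"
| "lam x \<sigma> (s \<cdot> t) = Con (Sc \<sigma> (tyof t) (tyof (s \<cdot> t))) \<cdot> lam x \<sigma> s \<cdot> lam x \<sigma> t"

text \<open>The recursor satisfies \<open>R 0 a f = a\<close> and \<open>R (n + 1) a f = f (R n a f) n\<close>; in the step
  functions below r is the previous value and n the counter.\<close>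

definition plus_c :: tm where
  "plus_c = lam ''x'' Nt (lam ''y'' Nt
     (recn (Var ''y'' Nt) (Var ''x'' Nt) (lam ''r'' Nt (lam ''n'' Nt (suc (Var ''r'' Nt))))))"
definition plus :: "tm \<Rightarrow> tm \<Rightarrow> tm" where "plus s t = plus_c \<cdot> s \<cdot> t"

definition pred_c :: tm where
  "pred_c = lam ''x'' Nt
     (recn (Var ''x'' Nt) zero (lam ''r'' Nt (lam ''n'' Nt (Var ''n'' Nt))))"

text \<open>Truncated subtraction, which makes the order of type 0 quantifier-free.\<close>

definition monus_c :: tm where
  "monus_c = lam ''x'' Nt (lam ''y'' Nt
     (recn (Var ''y'' Nt) (Var ''x'' Nt) (lam ''r'' Nt (lam ''n'' Nt (pred_c \<cdot> Var ''r'' Nt)))))"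
definition le :: "tm \<Rightarrow> tm \<Rightarrow> fm" where "le s t = Eq (monus_c \<cdot> s \<cdot> t) zero"
definition lt :: "tm \<Rightarrow> tm \<Rightarrow> fm" where "lt s t = le (suc s) t"

text \<open>Cantor pairing: \<open>tri_c \<cdot> n\<close> is 0 + 1 + ... + n, and x, y are coded by
  tri (x + y) + y.\<close>

definition tri_c :: tm where
  "tri_c = lam ''x'' Nt
     (recn (Var ''x'' Nt) zero
       (lam ''r'' Nt (lam ''n'' Nt (suc (plus (Var ''r'' Nt) (Var ''n'' Nt))))))"
definition pair_c :: tm where
  "pair_c = lam ''x'' Nt (lam ''y'' Nt
     (plus (tri_c \<cdot> plus (Var ''x'' Nt) (Var ''y'' Nt)) (Var ''y'' Nt)))"

text \<open>Codes of finite sequences of numbers: the empty sequence has code 0, and a sequence with code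
  c extended at its end by a has code \<open>1 + pair c a\<close>; every number codes exactly one sequence.
  \<open>seg h k\<close> is the code of the initial segment of h of length k.\<close>

definition seg_c :: tm where
  "seg_c = lam ''h'' T1 (lam ''k'' Nt
     (recn (Var ''k'' Nt) zero
       (lam ''r'' Nt (lam ''n'' Nt
         (suc (pair_c \<cdot> Var ''r'' Nt \<cdot> (Var ''h'' T1 \<cdot> Var ''n'' Nt)))))))"
definition seg :: "tm \<Rightarrow> tm \<Rightarrow> tm" where "seg h k = seg_c \<cdot> h \<cdot> k"

fun zero_of :: "ty \<Rightarrow> tm" where
  "zero_of Nt = zero"
| "zero_of (\<sigma> \<leadsto> \<tau>) = Con (Kc \<tau> \<sigma>) \<cdot> zero_of \<tau>"
| "zero_of (Seq \<sigma>) = Con (Tab \<sigma>) \<cdot> zero \<cdot> (Con (Kc \<sigma> Nt) \<cdot> zero_of \<sigma>)"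


section \<open>Equality of higher type, membership in sequences, relativisation\<close>

text \<open>A name longer than every variable name in the two given terms.\<close>

fun maxlen :: "tm \<Rightarrow> nat" where
  "maxlen (Var x \<tau>) = length x"
| "maxlen (Con c) = 0"
| "maxlen (s \<cdot> t) = max (maxlen s) (maxlen t)"

definition fresh :: "tm \<Rightarrow> tm \<Rightarrow> string" where
  "fresh s t = replicate (Suc (max (maxlen s) (maxlen t))) (CHR ''z'')"

definition All_lt :: "string \<Rightarrow> tm \<Rightarrow> fm \<Rightarrow> fm" where
  "All_lt x t A = All x Nt (Imp (lt (Var x Nt) t) A)"
definition Ex_lt :: "string \<Rightarrow> tm \<Rightarrow> fm \<Rightarrow> fm" where
  "Ex_lt x t A = Neg (All_lt x t (Neg A))"

text \<open>Extensional equality; sequences are equal if they have the same length and equal entries.\<close>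

fun eq :: "ty \<Rightarrow> tm \<Rightarrow> tm \<Rightarrow> fm" where
  "eq Nt s t = Eq s t"
| "eq (\<sigma> \<leadsto> \<tau>) s t =
     (let z = fresh s t in All z \<sigma> (eq \<tau> (s \<cdot> Var z \<sigma>) (t \<cdot> Var z \<sigma>)))"
| "eq (Seq \<sigma>) s t =
     And (Eq (Con (Len \<sigma>) \<cdot> s) (Con (Len \<sigma>) \<cdot> t))
       (let i = fresh s t in All_lt i (Con (Len \<sigma>) \<cdot> s)
         (eq \<sigma> (Con (Nth \<sigma>) \<cdot> s \<cdot> Var i Nt) (Con (Nth \<sigma>) \<cdot> t \<cdot> Var i Nt)))"

text \<open>\<open>elem \<sigma> z x\<close> is the membership of z (type \<open>\<sigma>\<close>) in the finite sequence x.\<close>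

definition elem :: "ty \<Rightarrow> tm \<Rightarrow> tm \<Rightarrow> fm" where
  "elem \<sigma> z x =
     (let i = fresh z x in
      Ex_lt i (Con (Len \<sigma>) \<cdot> x) (eq \<sigma> z (Con (Nth \<sigma>) \<cdot> x \<cdot> Var i Nt)))"

definition bounded_All :: "string \<Rightarrow> ty \<Rightarrow> fm \<Rightarrow> bool" where
  "bounded_All x \<tau> A \<longleftrightarrow>
     \<tau> = Nt \<and> (\<exists>t B. A = Imp (lt (Var x Nt) t) B \<and> (x, Nt) \<notin> fvt t)"

text \<open>\<open>rel A\<close> is \<open>A\<^sup>s\<^sup>t\<close>: bounded number quantifiers are left alone.  As \<open>Ex_lt\<close> is defined through
  \<open>All_lt\<close>, this covers both kinds.\<close>

fun rel :: "fm \<Rightarrow> fm" where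
  "rel (Imp A B) = Imp (rel A) (rel B)"
| "rel (All x \<tau> A) = (if bounded_All x \<tau> A then All x \<tau> (rel A) else All_st x \<tau> (rel A))"
| "rel A = A"


section \<open>The theory \<open>RCA\<^sub>0\<^sup>\<omega>\<close> (with sequence types)\<close>

inductive_set QF_AC :: "(nat \<times> ty) set \<Rightarrow> ty \<Rightarrow> ty \<Rightarrow> fm set" for L \<sigma> \<tau> where
  "wff L A \<Longrightarrow> qf A \<Longrightarrow> (x, \<sigma>) \<noteq> (y, \<tau>) \<Longrightarrow> (F, \<sigma> \<leadsto> \<tau>) \<notin> fv A \<Longrightarrow>
   Imp (All x \<sigma> (Ex y \<tau> A))
     (Ex F (\<sigma> \<leadsto> \<tau>) (All x \<sigma> (sb (y, \<tau>) (Var F (\<sigma> \<leadsto> \<tau>) \<cdot> Var x \<sigma>) A))) \<in> QF_AC L \<sigma> \<tau>"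

inductive_set RCA0_omega :: "(nat \<times> ty) set \<Rightarrow> fm set" for L where
  eq_refl: "Eq (Var ''x'' Nt) (Var ''x'' Nt) \<in> RCA0_omega L"
| eq_sym: "Imp (Eq (Var ''x'' Nt) (Var ''y'' Nt)) (Eq (Var ''y'' Nt) (Var ''x'' Nt))
    \<in> RCA0_omega L"
| eq_trans: "Imp (Eq (Var ''x'' Nt) (Var ''y'' Nt)) (Imp (Eq (Var ''y'' Nt) (Var ''z'' Nt))
    (Eq (Var ''x'' Nt) (Var ''z'' Nt))) \<in> RCA0_omega L"
| suc_not_zero: "Neg (Eq (suc (Var ''x'' Nt)) zero) \<in> RCA0_omega L"
| suc_inj: "Imp (Eq (suc (Var ''x'' Nt)) (suc (Var ''y'' Nt))) (Eq (Var ''x'' Nt) (Var ''y'' Nt))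
    \<in> RCA0_omega L"
| comb_k: "eq \<rho> (Con (Kc \<rho> \<tau>) \<cdot> Var ''x'' \<rho> \<cdot> Var ''y'' \<tau>) (Var ''x'' \<rho>) \<in> RCA0_omega L"
| comb_s: "x = Var ''x'' (\<delta> \<leadsto> \<rho> \<leadsto> \<tau>) \<Longrightarrow> y = Var ''y'' (\<delta> \<leadsto> \<rho>) \<Longrightarrow> z = Var ''z'' \<delta> \<Longrightarrow>
    eq \<tau> (Con (Sc \<delta> \<rho> \<tau>) \<cdot> x \<cdot> y \<cdot> z) (x \<cdot> z \<cdot> (y \<cdot> z)) \<in> RCA0_omega L"
| rec_zero: "y = Var ''y'' Nt \<Longrightarrow> z = Var ''z'' (Nt \<leadsto> Nt \<leadsto> Nt) \<Longrightarrow>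
    Eq (recn zero y z) y \<in> RCA0_omega L"
| rec_suc: "x = Var ''x'' Nt \<Longrightarrow> y = Var ''y'' Nt \<Longrightarrow> z = Var ''z'' (Nt \<leadsto> Nt \<leadsto> Nt) \<Longrightarrow>
    Eq (recn (suc x) y z) (z \<cdot> recn x y z \<cdot> x) \<in> RCA0_omega L"
| len_tab: "n = Var ''n'' Nt \<Longrightarrow> f = Var ''f'' (Nt \<leadsto> \<sigma>) \<Longrightarrow>
    Eq (Con (Len \<sigma>) \<cdot> (Con (Tab \<sigma>) \<cdot> n \<cdot> f)) n \<in> RCA0_omega L"
| nth_tab: "n = Var ''n'' Nt \<Longrightarrow> i = Var ''i'' Nt \<Longrightarrow> f = Var ''f'' (Nt \<leadsto> \<sigma>) \<Longrightarrow>
    Imp (lt i n) (eq \<sigma> (Con (Nth \<sigma>) \<cdot> (Con (Tab \<sigma>) \<cdot> n \<cdot> f) \<cdot> i) (f \<cdot> i)) \<in> RCA0_omega L"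
| nth_default: "i = Var ''i'' Nt \<Longrightarrow> s = Var ''s'' (Seq \<sigma>) \<Longrightarrow>
    Imp (le (Con (Len \<sigma>) \<cdot> s) i) (eq \<sigma> (Con (Nth \<sigma>) \<cdot> s \<cdot> i) (zero_of \<sigma>)) \<in> RCA0_omega L"
| qf_ind: "wff L A \<Longrightarrow> qf A \<Longrightarrow>
    Imp (sb (x, Nt) zero A) (Imp (All x Nt (Imp A (sb (x, Nt) (suc (Var x Nt)) A))) (All x Nt A))
      \<in> RCA0_omega L"
| extensionality: "f = Var ''f'' (\<rho> \<leadsto> \<tau>) \<Longrightarrow> x = Var ''x'' \<rho> \<Longrightarrow> y = Var ''y'' \<rho> \<Longrightarrow>
    Imp (eq \<rho> x y) (eq \<tau> (f \<cdot> x) (f \<cdot> y)) \<in> RCA0_omega L"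
| qf_ac_1_0: "A \<in> QF_AC L T1 Nt \<Longrightarrow> A \<in> RCA0_omega L"


section \<open>The theory \<open>RCA\<^sub>0\<^sup>\<Omega>\<close>\<close>

text \<open>The map \<open>\<D>\<close> records which additional constants \<open>Xi i \<tau>\<close> are present and by which formula
  (in the free variable \<open>\<Xi>\<^sup>\<tau>\<close>) each of them is specified.\<close>

inductive_set RCA0_Omega :: "(nat \<times> ty \<rightharpoonup> fm) \<Rightarrow> fm set" for \<D> where
  base: "A \<in> RCA0_omega (dom \<D>) \<Longrightarrow> A \<in> RCA0_Omega \<D>"
| st_eq: "x = Var ''x'' \<sigma> \<Longrightarrow> y = Var ''y'' \<sigma> \<Longrightarrow>
    Imp (And (St x) (eq \<sigma> x y)) (St y) \<in> RCA0_Omega \<D>"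
| st_closed: "wft (dom \<D>) t \<Longrightarrow> fvt t = {} \<Longrightarrow> St t \<in> RCA0_Omega \<D>"
| st_app: "f = Var ''f'' (\<sigma> \<leadsto> \<tau>) \<Longrightarrow> x = Var ''x'' \<sigma> \<Longrightarrow>
    Imp (And (St f) (St x)) (St (f \<cdot> x)) \<in> RCA0_Omega \<D>"
| st_below: "x = Var ''x'' Nt \<Longrightarrow> y = Var ''y'' Nt \<Longrightarrow>
    Imp (And (St x) (le y x)) (St y) \<in> RCA0_Omega \<D>"
| idealization: "wff (dom \<D>) A \<Longrightarrow> internal A \<Longrightarrow>
    (x, Seq \<sigma>) \<notin> fv A \<Longrightarrow> (x, Seq \<sigma>) \<noteq> (y, \<tau>) \<Longrightarrow> (z, \<sigma>) \<noteq> (y, \<tau>) \<Longrightarrow>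
    Imp (All_st x (Seq \<sigma>) (Ex y \<tau> (All z \<sigma> (Imp (elem \<sigma> (Var z \<sigma>) (Var x (Seq \<sigma>))) A))))
      (Ex y \<tau> (All_st z \<sigma> A)) \<in> RCA0_Omega \<D>"
| hac_int: "wff (dom \<D>) A \<Longrightarrow> internal A \<Longrightarrow>
    (F, \<rho> \<leadsto> Seq \<tau>) \<notin> fv A \<Longrightarrow> (x, \<rho>) \<noteq> (y, \<tau>) \<Longrightarrow>
    Imp (All_st x \<rho> (Ex_st y \<tau> A))
      (Ex_st F (\<rho> \<leadsto> Seq \<tau>) (All_st x \<rho>
        (Ex y \<tau> (And (elem \<tau> (Var y \<tau>) (Var F (\<rho> \<leadsto> Seq \<tau>) \<cdot> Var x \<rho>)) A)))) \<in> RCA0_Omega \<D>"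
| pf_tp: "wff (dom \<D>) A \<Longrightarrow> internal A \<Longrightarrow> fv A \<subseteq> {(x, \<tau>)} \<Longrightarrow>
    Imp (All_st x \<tau> A) (All x \<tau> A) \<in> RCA0_Omega \<D>"
| xi: "\<D> (i, \<tau>) = Some D \<Longrightarrow>
    And (St (Con (Xi i \<tau>)))
      (All_st ''Xi'' \<tau> (Imp (rel D) (rel (eq \<tau> (Con (Xi i \<tau>)) (Var ''Xi'' \<tau>)))))
      \<in> RCA0_Omega \<D>"

text \<open>D is a parameter-free internal formula that \<open>RCA\<^sub>0\<^sup>\<omega>\<close> proves to have at most one solution.\<close>

definition specifies :: "ty \<Rightarrow> fm \<Rightarrow> bool" where
  "specifies \<tau> D \<longleftrightarrow>
     wff {} D \<and> internal D \<and> fv D \<subseteq> {(''Xi'', \<tau>)} \<and>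
     (\<exists>y. y \<noteq> ''Xi'' \<and> free_for (Var y \<tau>) (''Xi'', \<tau>) D \<and>
       prv {} (RCA0_omega {})
         (All ''Xi'' \<tau> (All y \<tau> (Imp (And D (sb (''Xi'', \<tau>) (Var y \<tau>) D))
            (eq \<tau> (Var ''Xi'' \<tau>) (Var y \<tau>))))))"

definition suslin :: "tm \<Rightarrow> tm \<Rightarrow> fm" where
  "suslin S f =
     Iff (Eq (S \<cdot> f) zero)
       (Ex ''g'' T1 (All ''x'' Nt (Neg (Eq (f \<cdot> seg (Var ''g'' T1) (Var ''x'' Nt)) zero))))"

text \<open>The formula of \<open>(S\<^sup>2)\<close> fixes only where S vanishes.  To specify S uniquely its values are
  restricted to 0 and 1; otherwise the axiom for the constant would contradict \<open>(S\<^sup>2)\<close>.\<close>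

definition suslin_spec :: fm where
  "suslin_spec = (let S = Var ''Xi'' T2; f = Var ''f'' T1 in
     All ''f'' T1 (And (le (S \<cdot> f) (suc zero)) (suslin S f)))"

definition admissible :: "(nat \<times> ty \<rightharpoonup> fm) \<Rightarrow> bool" where
  "admissible \<D> \<longleftrightarrow>
     (\<forall>i \<tau> D. \<D> (i, \<tau>) = Some D \<longrightarrow> specifies \<tau> D) \<and>
     (\<exists>i. \<D> (i, T2) = Some suslin_spec)"


section \<open>The principles\<close>

definition char_fun :: "tm \<Rightarrow> fm" where
  "char_fun X = All ''n'' Nt (le (X \<cdot> Var ''n'' Nt) (suc zero))"
definition mem :: "tm \<Rightarrow> tm \<Rightarrow> fm" where
  "mem x X = Eq (X \<cdot> x) (suc zero)"

definition STP :: fm where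
  "STP = (let X = Var ''X'' T1; Y = Var ''Y'' T1; x = Var ''x'' Nt in
     All ''X'' T1 (Imp (char_fun X)
       (Ex_st ''Y'' T1 (And (char_fun Y) (All_st ''x'' Nt (Iff (mem x X) (mem x Y)))))))"

definition S2 :: fm where
  "S2 = Ex ''S'' T2 (All ''f'' T1 (suslin (Var ''S'' T2) (Var ''f'' T1)))"

definition Pi11_TRANS :: fm where
  "Pi11_TRANS =
     (let A = Eq (Var ''f'' T1 \<cdot> seg (Var ''g'' T1) (Var ''x'' Nt)) zero in
      All_st ''f'' T1 (Iff (All_st ''g'' T1 (Ex_st ''x'' Nt A)) (All ''g'' T1 (Ex ''x'' Nt A))))"

text \<open>\<open>phi h f\<close> is \<open>\<phi>(h, f)\<close>; the terms substituted for h and f must not contain \<open>k\<^sup>0\<close>.\<close>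

definition phi :: "tm \<Rightarrow> tm \<Rightarrow> fm" where
  "phi h f = Ex ''k'' Nt (Eq (f \<cdot> seg h (Var ''k'' Nt)) zero)"

text \<open>h is the play of the strategies S and T.  A strategy is an arbitrary object of type 1; only its
  values on codes of sequences of the appropriate parity matter.\<close>

definition is_play :: "tm \<Rightarrow> tm \<Rightarrow> tm \<Rightarrow> fm" where
  "is_play S T h = (let n = Var ''n'' Nt; e = plus n n; d = suc (plus n n) in
     All ''n'' Nt (And (Eq (h \<cdot> e) (S \<cdot> seg h e)) (Eq (h \<cdot> d) (T \<cdot> seg h d))))"

text \<open>\<open>phi_play S T f\<close> is \<open>\<phi>(S \<otimes> T, f)\<close>, with the play eliminated as a definite description
  (the play exists and is unique in the base theory).\<close>

definition phi_play :: "tm \<Rightarrow> tm \<Rightarrow> tm \<Rightarrow> fm" where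
  "phi_play S T f = Ex ''h'' T1 (And (is_play S T (Var ''h'' T1)) (phi (Var ''h'' T1) f))"

definition Sigma01_DET_star :: fm where
  "Sigma01_DET_star = (let S0 = Var ''S0'' T1; S1 = Var ''S1'' T1; f = Var ''f'' T1 in
     All_st ''f'' T1 (Or
       (Ex_st ''S0'' T1 (All ''S1'' T1 (phi_play S0 S1 f)))
       (Ex_st ''S1'' T1 (All ''S0'' T1 (Neg (phi_play S0 S1 f))))))"

text \<open>A pair of objects of type 1 is coded as an object of type \<open>0 \<rightarrow> 1\<close> with components at the
  arguments 1 and 2.\<close>

definition USigma01_DET :: fm where
  "USigma01_DET =
     (let Phi = Var ''Phi'' (T1 \<leadsto> (Nt \<leadsto> T1));
          S0 = Var ''S0'' T1; S1 = Var ''S1'' T1; f = Var ''f'' T1;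
          one = suc zero; two = suc (suc zero) in
      Ex ''Phi'' (T1 \<leadsto> (Nt \<leadsto> T1)) (All ''f'' T1 (Or
        (All ''S1'' T1 (phi_play (Phi \<cdot> f \<cdot> one) S1 f))
        (All ''S0'' T1 (Neg (phi_play S0 (Phi \<cdot> f \<cdot> two) f))))))"

definition base_theory :: "(nat \<times> ty \<rightharpoonup> fm) \<Rightarrow> fm set" where
  "base_theory \<D> = RCA0_Omega \<D> \<union> {STP} \<union> QF_AC (dom \<D>) T1 T1"

end

theory Submission
  imports Defs "HOL-Library.Countable_Set"
begin

text \<open>
  By Henkin's theorem it suffices to argue in an arbitrary countable model of the base theory, and
  there the four principles are proved in a cycle.  Given the Suslin functional, the set of positions
  from which the closed player 1 has a winning strategy is a greatest fixed point, hence decidable,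
  and player 1 wins by staying in it.  Outside of it the open player 0 always moves to a position of
  least rank; ranks are compared by a second greatest fixed point, so no recursion along ordinals is
  needed.  Transfer makes the uniform solution standard, which gives the determinacy of standard
  games.  Applied to the game in which player 1 just enumerates a function this yields
  \<open>\<Pi>\<^sup>1\<^sub>1\<close> transfer.  Transfer in turn reduces the existence of a path to the finitely many
  standard candidates provided by herbrandized choice; the resulting functional is a standard solution
  of the relativised specification of the Suslin functional.
\<close>

section \<open>Syntax and the Henkin extension\<close>

text \<open>The numbers of a model may be nonstandard, so induction, recursion and comprehension of
  HOL do not apply to them. A predicate can be used in an induction only if an object of type 1 is
  its characteristic function (\<open>decp\<close>), and a function exists in the model only if some
  object represents it (\<open>rep\<close>). This shapes every argument about models: before a set
  of positions is used, it must be shown to be decidable. The only infinitary decisions come from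
  the Suslin functional, which decides statements of the form "some g has all its initial segments
  in P" for decidable P. Greatest fixed points, the comparison of ranks and descending sequences are
  therefore each coded by a single function whose properties are tested on initial segments. A
  predicate decided in this way may occur inside the next one, which permits rank comparisons nested
  in statements about descending sequences. Number quantifiers and an unbounded search become
  available by the same device. Induction over the positions won by player 0 is obtained by
  dualising coinduction, again for decidable predicates only.\<close>

instance ty :: countable by countable_datatype
instance con :: countable by countable_datatype
instance tm :: countable by countable_datatype
instance fm :: countable by countable_datatype

lemma finite_fvt: "finite (fvt t)" by (induction t) auto
lemma finite_fv: "finite (fv A)" by (induction A) (auto simp: finite_fvt)

text \<open>Names beginning with a hash are reserved for the Henkin constants.  Bound variables never have such
  names, so terms built from these constants can be substituted without capture.\<close>

definition gd :: "string \<Rightarrow> bool" where "gd x \<longleftrightarrow> x = [] \<or> hd x \<noteq> CHR ''#''"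

lemma gd_simps [simp]: "gd []" "gd (c # cs) \<longleftrightarrow> c \<noteq> CHR ''#''" by (auto simp: gd_def)

fun gdt :: "tm \<Rightarrow> bool" where
  "gdt (Var x \<tau>) = gd x" | "gdt (Con c) = True" | "gdt (s \<cdot> t) = (gdt s \<and> gdt t)"

fun bgd :: "fm \<Rightarrow> bool" where
  "bgd (Imp A B) = (bgd A \<and> bgd B)" | "bgd (All x \<tau> A) = (gd x \<and> bgd A)" | "bgd _ = True"

fun gdf :: "fm \<Rightarrow> bool" where
  "gdf (Eq s t) = (gdt s \<and> gdt t)" | "gdf (St t) = gdt t" | "gdf Bot = True"
| "gdf (Imp A B) = (gdf A \<and> gdf B)" | "gdf (All x \<tau> A) = (gd x \<and> gdf A)"

definition bad :: "(string \<times> ty) set \<Rightarrow> bool" where "bad V \<longleftrightarrow> (\<forall>v\<in>V. \<not> gd (fst v))"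

lemma gdt_fvt: "gdt t \<Longrightarrow> v \<in> fvt t \<Longrightarrow> gd (fst v)" by (induction t) auto
lemma gdf_bgd: "gdf A \<Longrightarrow> bgd A" by (induction A) auto
lemma gdf_fv: "gdf A \<Longrightarrow> v \<in> fv A \<Longrightarrow> gd (fst v)" by (induction A) (auto dest: gdt_fvt)

lemma ex_bad: assumes "finite V" shows "\<exists>c. \<not> gd c \<and> (c, \<tau>) \<notin> V"
proof -
  let ?f = "\<lambda>n. (''#'' @ replicate n CHR ''a'', \<tau>)"
  have "inj ?f" by (auto simp: inj_def)
  then have "infinite (range ?f)" using finite_imageD by blast
  then obtain v where "v \<in> range ?f" "v \<notin> V" using assms by (meson finite_subset subsetI)
  then show ?thesis by (intro exI[of _ "fst v"]) auto
qed

lemma sbt_idle: "v \<notin> fvt t \<Longrightarrow> sbt v u t = t" by (induction t) auto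
lemma sb_idle: "v \<notin> fv A \<Longrightarrow> sb v u A = A" by (induction A) (auto simp: sbt_idle)

lemma tyof_sbt: "tyof u = snd v \<Longrightarrow> tyof (sbt v u t) = tyof t"
  by (induction t) (auto split: ty.splits)
lemma wft_sbt: "tyof u = snd v \<Longrightarrow> wft L u \<Longrightarrow> wft L t \<Longrightarrow> wft L (sbt v u t)"
  by (induction t) (auto simp: tyof_sbt)
lemma wff_sb: "tyof u = snd v \<Longrightarrow> wft L u \<Longrightarrow> wff L A \<Longrightarrow> wff L (sb v u A)"
  by (induction A) (auto simp: tyof_sbt wft_sbt)
lemma fvt_sbt: "fvt (sbt v u t) \<subseteq> fvt t - {v} \<union> fvt u" by (induction t) auto
lemma fv_sb: "fv (sb v u A) \<subseteq> fv A - {v} \<union> fvt u"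
proof (induction A)
  case (All x \<tau> A) then show ?case by (auto split: if_splits)
next
  case (Imp A B) then show ?case by auto
qed (use fvt_sbt in fastforce)+
lemma bgd_sb: "bgd (sb v u A) = bgd A" by (induction A) auto

lemma free_for_bad: "bgd A \<Longrightarrow> bad (fvt u) \<Longrightarrow> free_for u v A"
  by (induction A) (auto simp: bad_def)

text \<open>The Henkin constant is turned back into the bound variable. Every occurrence of
  \<open>c\<close> after the substitution stems from a free occurrence of \<open>x\<close>, so it
  lies outside the scope of all binders of \<open>x\<close> and no capture is possible.\<close>

lemma free_for_back:
  assumes "bgd A" "(c, \<tau>) \<notin> fv A" "\<not> gd c"
  shows "free_for (Var x \<tau>) (c, \<tau>) (sb (x, \<tau>) (Var c \<tau>) A)"
  using assms by (induction A) auto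

lemma sbt_back: "(c, \<tau>) \<notin> fvt t \<Longrightarrow> sbt (c, \<tau>) (Var x \<tau>) (sbt (x, \<tau>) (Var c \<tau>) t) = t"
  by (induction t) auto
lemma sb_back:
  assumes "bgd A" "(c, \<tau>) \<notin> fv A" "\<not> gd c"
  shows "sb (c, \<tau>) (Var x \<tau>) (sb (x, \<tau>) (Var c \<tau>) A) = A"
  using assms by (induction A) (auto simp: sbt_back sb_idle)

lemma wff_Neg [simp]: "wff L (Neg A) = wff L A" by (simp add: Neg_def)


section \<open>Derivability from hypotheses, and extension to a complete Henkin theory\<close>

locale calculus =
  fixes L :: "(nat \<times> ty) set" and T :: "fm set"
begin

text \<open>Generalisation in \<open>prv\<close> is unrestricted, so the deduction theorem fails for
  it as soon as hypotheses have free variables. Here generalisation is confined to theorems of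
  \<open>T\<close>, and hypotheses are combined by modus ponens only. Well-formedness is demanded
  because \<open>T\<close> is an arbitrary set.\<close>

inductive loc :: "fm set \<Rightarrow> fm \<Rightarrow> bool" for G where
  provable: "prv L T A \<Longrightarrow> wff L A \<Longrightarrow> loc G A"
| hyp: "A \<in> G \<Longrightarrow> wff L A \<Longrightarrow> loc G A"
| cut: "loc G (Imp A B) \<Longrightarrow> loc G A \<Longrightarrow> loc G B"

lemma loc_wff: "loc G A \<Longrightarrow> wff L A" by (induction rule: loc.induct) auto

lemma loc_empty: "loc {} A \<Longrightarrow> prv L T A"
  by (induction rule: loc.induct) (auto intro: prv.mp)

lemma loc_mono: "loc G A \<Longrightarrow> G \<subseteq> G' \<Longrightarrow> loc G' A"
  by (induction rule: loc.induct) (auto intro: loc.intros)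

lemma prv_refl: "wff L A \<Longrightarrow> prv L T (Imp A A)"
  using imp_s[of L A "Imp A A" A T] imp_k[of L A "Imp A A" T] imp_k[of L A A T]
  by (auto intro: mp)

lemma ded: assumes "loc (insert A G) B" "wff L A" shows "loc G (Imp A B)"
  using assms
proof (induction rule: loc.induct)
  case (provable B)
  then show ?case by (meson imp_k loc.provable cut wff.simps(4))
next
  case (hyp B)
  then show ?case by (metis imp_k insertE loc.hyp loc.provable cut prv_refl wff.simps(4))
next
  case (cut B C)
  then have "wff L B" "wff L C" using loc_wff by force+
  then have "loc G (Imp (Imp A (Imp B C)) (Imp (Imp A B) (Imp A C)))"
    using cut by (intro loc.provable imp_s) auto
  then show ?case using cut loc.cut by blast
qed

lemma ded_rev: "loc G (Imp A B) \<Longrightarrow> loc (insert A G) B"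
  by (metis cut hyp insertI1 loc_mono loc_wff subset_insertI wff.simps(4))

lemma loc_finite: "loc G A \<Longrightarrow> \<exists>F. finite F \<and> F \<subseteq> G \<and> loc F A"
proof (induction rule: loc.induct)
  case (provable A)
  then show ?case using loc.provable by blast
next
  case (hyp A)
  then have "loc {A} A" by (simp add: loc.hyp)
  then show ?case using hyp by blast
next
  case (cut A B)
  then obtain F F' where "finite F" "F \<subseteq> G" "loc F (Imp A B)" "finite F'" "F' \<subseteq> G" "loc F' A"
    by blast
  then have "loc (F \<union> F') (Imp A B)" "loc (F \<union> F') A" by (auto intro: loc_mono)
  then have "loc (F \<union> F') B" by (rule loc.cut)
  then show ?case using \<open>finite F\<close> \<open>finite F'\<close> \<open>F \<subseteq> G\<close> \<open>F' \<subseteq> G\<close> by (intro exI[of _ "F \<union> F'"]) auto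
qed

text \<open>The hypotheses are moved one by one to the right as premises of implications, where
  \<open>all_imp\<close> pulls the quantifier past them. This needs a finite set.\<close>

lemma loc_gen:
  assumes "finite G" "loc G A" "\<forall>B\<in>G. wff L B \<and> (x, \<tau>) \<notin> fv B"
  shows "loc G (All x \<tau> A)"
  using assms
proof (induction G arbitrary: A rule: finite_induct)
  case empty
  then have "prv L T A" "wff L A" using loc_empty loc_wff by auto
  then show ?case by (intro loc.provable gen) simp_all
next
  case (insert B G)
  have B: "wff L B" "(x, \<tau>) \<notin> fv B" using insert by auto
  have A: "wff L A" using insert loc_wff by blast
  have "loc G (Imp B A)" using ded insert by auto
  then have "loc G (All x \<tau> (Imp B A))" using insert by auto
  moreover have "loc G (Imp (All x \<tau> (Imp B A)) (Imp B (All x \<tau> A)))"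
    using B A by (intro loc.provable all_imp) auto
  ultimately show ?case using cut ded_rev by blast
qed

lemma explosion: assumes "loc G Bot" "wff L A" shows "loc G A"
proof -
  have "loc G (Neg (Neg A))" unfolding Neg_def
    using assms ded loc_mono by (metis subset_insertI wff.simps(3,4))
  moreover have "loc G (Imp (Neg (Neg A)) A)" using assms by (intro loc.provable dne) auto
  ultimately show ?thesis using cut by blast
qed

lemma raa: assumes "loc (insert (Neg A) G) Bot" "wff L A" shows "loc G A"
proof -
  have "loc G (Neg (Neg A))" using assms ded by (metis Neg_def wff_Neg)
  moreover have "loc G (Imp (Neg (Neg A)) A)" using assms by (intro loc.provable dne) auto
  ultimately show ?thesis using cut by blast
qed

text \<open>The sentences of the language with Henkin constants: the constants are free variables
  with reserved names.\<close>

definition sent :: "fm \<Rightarrow> bool" where "sent A \<longleftrightarrow> wff L A \<and> bgd A \<and> bad (fv A)"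

lemma sent_simps [simp]:
  "sent Bot" "sent (Imp A B) \<longleftrightarrow> sent A \<and> sent B" "sent (Neg A) \<longleftrightarrow> sent A"
  by (auto simp: sent_def bad_def Neg_def)

lemma sent_sb:
  assumes "sent (All x \<tau> C)" "wft L t" "tyof t = \<tau>" "bad (fvt t)"
  shows "sent (sb (x, \<tau>) t C)"
  using assms fv_sb[of "(x, \<tau>)" t C] unfolding sent_def bad_def
  by (auto simp: bgd_sb wff_sb)

text \<open>Generalise over the fresh constant, rename it back to \<open>x\<close> by
  \<open>all_inst\<close>, and generalise again. Read contrapositively, a counterexample with a new
  name can be added to a consistent theory that refutes the universal sentence.\<close>

lemma witness:
  assumes "loc G (sb (x, \<tau>) (Var c \<tau>) C)" "sent (All x \<tau> C)" "finite G" "\<forall>B\<in>G. wff L B"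
    "\<not> gd c" "(c, \<tau>) \<notin> \<Union> (fv ` G) \<union> fv C"
  shows "loc G (All x \<tau> C)"
proof -
  let ?C = "sb (x, \<tau>) (Var c \<tau>) C"
  have C: "wff L C" "bgd C" "gd x" using assms by (auto simp: sent_def)
  then have wC: "wff L ?C" by (simp add: wff_sb)
  have "loc G (All c \<tau> ?C)" using assms by (intro loc_gen) auto
  moreover have "prv L T (Imp (All c \<tau> ?C) C)"
    using all_inst[OF wC, of "Var x \<tau>" \<tau> c T] sb_back[of C c \<tau> x] free_for_back[of C c \<tau> x] C assms
    by auto
  moreover have "(x, \<tau>) \<notin> fv (All c \<tau> ?C)"
    using fv_sb[of "(x, \<tau>)" "Var c \<tau>" C] by auto
  ultimately have "prv L T (Imp (All c \<tau> ?C) (All x \<tau> C))"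
    using all_imp[of L "All c \<tau> ?C" C x \<tau> T] wC C by (auto intro: mp gen)
  then show ?thesis using \<open>loc G (All c \<tau> ?C)\<close> cut loc.provable C wC by (metis wff.simps(4,5))
qed

definition wit :: "fm set \<Rightarrow> ty \<Rightarrow> fm \<Rightarrow> string" where
  "wit G \<tau> C = (SOME c. \<not> gd c \<and> (c, \<tau>) \<notin> \<Union> (fv ` G) \<union> fv C)"

lemma wit: "finite G \<Longrightarrow> \<not> gd (wit G \<tau> C) \<and> (wit G \<tau> C, \<tau>) \<notin> \<Union> (fv ` G) \<union> fv C"
  unfolding wit_def by (rule someI_ex, rule ex_bad) (simp add: finite_fv)

fun counter :: "fm set \<Rightarrow> fm \<Rightarrow> fm set" where
  "counter G (All x \<tau> C) = insert (Neg (sb (x, \<tau>) (Var (wit G \<tau> C) \<tau>) C)) G"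
| "counter G _ = G"

text \<open>A refuted universal sentence enters together with a counterexample in the same stage;
  each set stays finite, so a name for the next counterexample is always left.\<close>

definition step :: "fm set \<Rightarrow> fm \<Rightarrow> fm set" where
  "step G B = (if \<not> sent B then G else if \<not> loc (insert B G) Bot then insert B G
     else insert (Neg B) (counter G B))"

definition fine :: "fm set \<Rightarrow> bool" where
  "fine G \<longleftrightarrow> finite G \<and> (\<forall>B\<in>G. sent B) \<and> \<not> loc G Bot"

lemma sent_wff: "sent A \<Longrightarrow> wff L A" by (simp add: sent_def)

lemma step_fine: assumes "fine G" shows "fine (step G B)"
proof (cases "sent B \<and> loc (insert B G) Bot")
  case False
  then show ?thesis using assms by (auto simp: step_def fine_def)
next
  case True
  then have nB: "loc G (Neg B)" unfolding Neg_def by (intro ded) (auto simp: sent_wff)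
  have cons: "\<not> loc (counter G B) Bot \<and> finite (counter G B) \<and> (\<forall>A\<in>counter G B. sent A)"
  proof (cases "\<exists>x \<tau> C. B = All x \<tau> C")
    case True': True
    then obtain x \<tau> C where B: "B = All x \<tau> C" by blast
    let ?c = "wit G \<tau> C"
    let ?C = "sb (x, \<tau>) (Var ?c \<tau>) C"
    have c: "\<not> gd ?c" "(?c, \<tau>) \<notin> \<Union> (fv ` G) \<union> fv C" using wit assms by (auto simp: fine_def)
    have sC: "sent ?C" using True B c by (intro sent_sb) (auto simp: bad_def)
    have "\<not> loc (insert (Neg ?C) G) Bot"
    proof
      assume "loc (insert (Neg ?C) G) Bot"
      then have "loc G ?C" using raa sC sent_wff by blast
      then have "loc G B" unfolding B using c True B assms
        by (intro witness) (auto simp: fine_def sent_wff)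
      then have "loc G Bot" using nB cut unfolding Neg_def by blast
      then show False using assms by (simp add: fine_def)
    qed
    then show ?thesis using B sC assms by (simp add: fine_def)
  next
    case False
    then have "counter G B = G" by (cases B) auto
    then show ?thesis using assms by (simp add: fine_def)
  qed
  have "loc (counter G B) (Neg B)" using nB
    by (rule loc_mono) (cases B; auto)
  then have "\<not> loc (insert (Neg B) (counter G B)) Bot"
    using cons ded[of "Neg B" "counter G B" Bot] cut True sent_wff by auto
  then show ?thesis using True cons assms by (simp add: step_def fine_def)
qed

fun chain :: "fm \<Rightarrow> nat \<Rightarrow> fm set" where
  "chain A 0 = {Neg A}"
| "chain A (Suc n) = step (chain A n) (from_nat n)"

lemma chain_step_mono: "chain A n \<subseteq> chain A (Suc n)"
proof -
  have "G \<subseteq> counter G B" for G B by (cases B) auto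
  then show ?thesis by (auto simp: step_def)
qed

lemma chain_mono: "m \<le> n \<Longrightarrow> chain A m \<subseteq> chain A n"
  using lift_Suc_mono_le[of "chain A"] chain_step_mono by blast

lemma henkin_extension:
  assumes "sent A" "\<not> loc {} A"
  obtains H where "Neg A \<in> H" "\<And>B. B \<in> H \<Longrightarrow> sent B" "\<not> loc H Bot"
    "\<And>B. sent B \<Longrightarrow> B \<in> H \<or> Neg B \<in> H"
    "\<And>x \<tau> C. sent (All x \<tau> C) \<Longrightarrow> All x \<tau> C \<notin> H \<Longrightarrow> \<exists>c. \<not> gd c \<and> Neg (sb (x, \<tau>) (Var c \<tau>) C) \<in> H"
proof
  let ?H = "\<Union>n. chain A n"
  have fine: "fine (chain A n)" for n
  proof (induction n)
    case 0
    have "\<not> loc {Neg A} Bot" using assms raa sent_wff by blast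
    then show ?case using assms by (simp add: fine_def)
  qed (simp add: step_fine)
  show "Neg A \<in> ?H" using chain.simps(1) by blast
  show "\<And>B. B \<in> ?H \<Longrightarrow> sent B" using fine by (auto simp: fine_def)
  show "\<not> loc ?H Bot"
  proof
    assume "loc ?H Bot"
    then obtain F where F: "finite F" "F \<subseteq> ?H" "loc F Bot" using loc_finite by blast
    from F(1,2) have "\<exists>n. F \<subseteq> chain A n"
    proof (induction F rule: finite_induct)
      case (insert B F)
      then obtain m n where "F \<subseteq> chain A n" "B \<in> chain A m" by auto
      then have "insert B F \<subseteq> chain A (max m n)" using chain_mono[of _ "max m n"]
        by (meson insert_subset max.cobounded1 max.cobounded2 subsetD subset_trans)
      then show ?case by blast
    qed auto
    then obtain n where "F \<subseteq> chain A n" by blast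
    then have "loc (chain A n) Bot" using F(3) loc_mono by blast
    then show False using fine[of n] by (simp add: fine_def)
  qed
  show "B \<in> ?H \<or> Neg B \<in> ?H" if "sent B" for B
  proof -
    have "B \<in> chain A (Suc (to_nat B)) \<or> Neg B \<in> chain A (Suc (to_nat B))"
      using that by (auto simp: step_def)
    then show ?thesis by blast
  qed
  show "\<exists>c. \<not> gd c \<and> Neg (sb (x, \<tau>) (Var c \<tau>) C) \<in> ?H"
    if "sent (All x \<tau> C)" "All x \<tau> C \<notin> ?H" for x \<tau> C
  proof -
    let ?B = "All x \<tau> C" and ?n = "to_nat (All x \<tau> C)"
    have "?B \<notin> chain A (Suc ?n)" using that by blast
    then have "Neg (sb (x, \<tau>) (Var (wit (chain A ?n) \<tau> C) \<tau>) C) \<in> chain A (Suc ?n)"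
      using that by (auto simp: step_def split: if_splits)
    then show ?thesis using wit fine unfolding fine_def by blast
  qed
qed

end

section \<open>Completeness\<close>

fun msbt :: "(string \<times> ty \<Rightarrow> tm) \<Rightarrow> tm \<Rightarrow> tm" where
  "msbt \<theta> (Var x \<tau>) = \<theta> (x, \<tau>)"
| "msbt \<theta> (Con c) = Con c"
| "msbt \<theta> (s \<cdot> t) = msbt \<theta> s \<cdot> msbt \<theta> t"

fun msb :: "(string \<times> ty \<Rightarrow> tm) \<Rightarrow> fm \<Rightarrow> fm" where
  "msb \<theta> (Eq s t) = Eq (msbt \<theta> s) (msbt \<theta> t)"
| "msb \<theta> (St t) = St (msbt \<theta> t)"
| "msb \<theta> Bot = Bot"
| "msb \<theta> (Imp A B) = Imp (msb \<theta> A) (msb \<theta> B)"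
| "msb \<theta> (All x \<tau> A) = All x \<tau> (msb (\<theta>((x, \<tau>) := Var x \<tau>)) A)"

lemma msbt_cong: "(\<And>v. v \<in> fvt t \<Longrightarrow> \<theta> v = \<eta> v) \<Longrightarrow> msbt \<theta> t = msbt \<eta> t"
  by (induction t) auto
lemma msbt_fresh: "v \<notin> fvt t \<Longrightarrow> msbt (\<theta>(v := u)) t = msbt \<theta> t"
  by (rule msbt_cong) auto
lemma msbt_Var: "(\<And>x \<tau>. (x, \<tau>) \<in> fvt t \<Longrightarrow> \<theta> (x, \<tau>) = Var x \<tau>) \<Longrightarrow> msbt \<theta> t = t"
  by (induction t) auto
lemma msbt_closed [simp]: "fvt t = {} \<Longrightarrow> msbt \<theta> t = t"
  by (rule msbt_Var) auto
lemma msb_Var: "(\<And>x \<tau>. (x, \<tau>) \<in> fv A \<Longrightarrow> \<theta> (x, \<tau>) = Var x \<tau>) \<Longrightarrow> msb \<theta> A = A"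
  by (induction A arbitrary: \<theta>) (auto simp: msbt_Var)

lemma sbt_msbt: "sbt v t (msbt \<theta> s) = msbt (\<lambda>w. sbt v t (\<theta> w)) s"
  by (induction s) auto

lemma sb_msb:
  assumes "\<And>w. w \<noteq> v \<Longrightarrow> v \<notin> fvt (\<theta> w)"
  shows "sb v t (msb \<theta> A) = msb (\<lambda>w. sbt v t (\<theta> w)) A"
  using assms
proof (induction A arbitrary: \<theta>)
  case (All y \<sigma> A)
  show ?case
  proof (cases "(y, \<sigma>) = v")
    case True
    have "(\<lambda>w. sbt v t (\<theta> w))((y, \<sigma>) := Var y \<sigma>) = \<theta>((y, \<sigma>) := Var y \<sigma>)"
      using True All.prems by (auto simp: sbt_idle)
    then show ?thesis using True by simp
  next
    case False
    have "(\<lambda>w. sbt v t ((\<theta>((y, \<sigma>) := Var y \<sigma>)) w)) = (\<lambda>w. sbt v t (\<theta> w))((y, \<sigma>) := Var y \<sigma>)"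
      using False by auto
    moreover have "w \<noteq> v \<Longrightarrow> v \<notin> fvt ((\<theta>((y, \<sigma>) := Var y \<sigma>)) w)" for w
      using False All.prems by auto
    ultimately show ?thesis using False All.IH[of "\<theta>((y, \<sigma>) := Var y \<sigma>)"]
      by (simp del: fun_upd_apply)
  qed
qed (auto simp: sbt_msbt)

lemma bgd_msb: "bgd A \<Longrightarrow> bgd (msb \<theta> A)" by (induction A arbitrary: \<theta>) auto

lemma fvt_lam: "fvt (lam x \<sigma> t) = fvt t - {(x, \<sigma>)}" by (induction t) auto
lemma fvt_consts [simp]:
  "fvt plus_c = {}" "fvt pred_c = {}" "fvt monus_c = {}" "fvt tri_c = {}" "fvt pair_c = {}"
  "fvt seg_c = {}" "fvt (zero_of \<tau>) = {}"
proof -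
  show *: "fvt plus_c = {}" "fvt pred_c = {}"
    by (auto simp: plus_c_def pred_c_def fvt_lam)
  show "fvt monus_c = {}" using * by (auto simp: monus_c_def fvt_lam)
  show t: "fvt tri_c = {}" using * by (auto simp: tri_c_def plus_def fvt_lam)
  show p: "fvt pair_c = {}" using * t by (auto simp: pair_c_def plus_def fvt_lam)
  show "fvt seg_c = {}" using * p by (auto simp: seg_c_def plus_def fvt_lam)
  show "fvt (zero_of \<tau>) = {}" by (induction \<tau>) auto
qed

lemma wft_tyof_lam: "wft L t \<Longrightarrow> wft L (lam x \<sigma> t) \<and> tyof (lam x \<sigma> t) = \<sigma> \<leadsto> tyof t"
  by (induction t) auto
lemmas wft_lam = wft_tyof_lam[THEN conjunct1] and tyof_lam = wft_tyof_lam[THEN conjunct2]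

lemma wft_consts [simp]:
  "wft L plus_c" "wft L pred_c" "wft L monus_c" "wft L tri_c" "wft L pair_c" "wft L seg_c"
  "wft L (zero_of \<tau>)"
  and tyof_consts [simp]:
  "tyof plus_c = Nt \<leadsto> T1" "tyof pred_c = T1" "tyof monus_c = Nt \<leadsto> T1" "tyof tri_c = T1"
  "tyof pair_c = Nt \<leadsto> T1" "tyof seg_c = T1 \<leadsto> T1" "tyof (zero_of \<tau>) = \<tau>"
proof -
  note s = wft_lam tyof_lam
  show 1: "wft L plus_c" and 2: "tyof plus_c = Nt \<leadsto> T1" for L by (auto simp: plus_c_def s[of L])
  show 3: "wft L pred_c" and 4: "tyof pred_c = T1" for L by (auto simp: pred_c_def s[of L])
  show "wft L monus_c" "tyof monus_c = Nt \<leadsto> T1" by (auto simp: monus_c_def s[of L] 3 4)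
  show 5: "wft L tri_c" and 6: "tyof tri_c = T1" for L by (auto simp: tri_c_def plus_def s[of L] 1 2)
  show 7: "wft L pair_c" and 8: "tyof pair_c = Nt \<leadsto> T1" for L
    by (auto simp: pair_c_def plus_def s[of L] 1 2 5 6)
  show "wft L seg_c" "tyof seg_c = T1 \<leadsto> T1" by (auto simp: seg_c_def s[of L] 7 8)
  show "tyof (zero_of \<tau>) = \<tau>" for \<tau> by (induction \<tau>) auto
  then show "wft L (zero_of \<tau>)" by (induction \<tau>) auto
qed

lemma maxlen_fvt: "(x, \<tau>) \<in> fvt t \<Longrightarrow> length x \<le> maxlen t" by (induction t) auto
lemma fresh_fvt [simp]: "(fresh s t, \<tau>) \<notin> fvt s" "(fresh s t, \<tau>) \<notin> fvt t"
  by (auto simp: fresh_def dest!: maxlen_fvt)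
lemma gd_fresh [simp]: "gd (fresh s t)" by (simp add: fresh_def)

lemma wff_connectives [simp]:
  "wff L (And A B) \<longleftrightarrow> wff L A \<and> wff L B" "wff L (Or A B) \<longleftrightarrow> wff L A \<and> wff L B"
  "wff L (Iff A B) \<longleftrightarrow> wff L A \<and> wff L B" "wff L (Ex x \<tau> A) \<longleftrightarrow> wff L A"
  "wff L (All_st x \<tau> A) \<longleftrightarrow> wff L A" "wff L (Ex_st x \<tau> A) \<longleftrightarrow> wff L A"
  "wff L (le s t) \<longleftrightarrow> wft L s \<and> wft L t \<and> tyof s = Nt \<and> tyof t = Nt"
  "wff L (lt s t) \<longleftrightarrow> wft L s \<and> wft L t \<and> tyof s = Nt \<and> tyof t = Nt"
  "wff L (All_lt x t A) \<longleftrightarrow> wft L t \<and> tyof t = Nt \<and> wff L A"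
  "wff L (Ex_lt x t A) \<longleftrightarrow> wft L t \<and> tyof t = Nt \<and> wff L A"
  by (auto simp: And_def Or_def Iff_def Ex_def All_st_def Ex_st_def le_def lt_def All_lt_def Ex_lt_def)

lemma gdt_closed [simp]: "fvt t = {} \<Longrightarrow> gdt t" by (induction t) auto

lemma gdf_connectives [simp]:
  "gdf (Neg A) = gdf A"
  "gdf (And A B) \<longleftrightarrow> gdf A \<and> gdf B" "gdf (Or A B) \<longleftrightarrow> gdf A \<and> gdf B"
  "gdf (Iff A B) \<longleftrightarrow> gdf A \<and> gdf B" "gdf (Ex x \<tau> A) \<longleftrightarrow> gd x \<and> gdf A"
  "gdf (All_st x \<tau> A) \<longleftrightarrow> gd x \<and> gdf A" "gdf (Ex_st x \<tau> A) \<longleftrightarrow> gd x \<and> gdf A"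
  "gdf (le s t) \<longleftrightarrow> gdt s \<and> gdt t" "gdf (lt s t) \<longleftrightarrow> gdt s \<and> gdt t"
  "gdf (All_lt x t A) \<longleftrightarrow> gd x \<and> gdt t \<and> gdf A" "gdf (Ex_lt x t A) \<longleftrightarrow> gd x \<and> gdt t \<and> gdf A"
  by (auto simp: Neg_def And_def Or_def Iff_def Ex_def All_st_def Ex_st_def le_def lt_def
      All_lt_def Ex_lt_def)

lemma wff_eq [simp]:
  "wft L s \<Longrightarrow> wft L t \<Longrightarrow> tyof s = \<tau> \<Longrightarrow> tyof t = \<tau> \<Longrightarrow> wff L (eq \<tau> s t)"
  by (induction \<tau> arbitrary: s t) (auto simp: Let_def)
lemma gdf_eq [simp]: "gdt s \<Longrightarrow> gdt t \<Longrightarrow> gdf (eq \<tau> s t)"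
  by (induction \<tau> arbitrary: s t) (auto simp: Let_def)


section \<open>Truth in the term model of a Henkin theory\<close>

locale henkin = calculus +
  fixes H :: "fm set"
  assumes H_sent: "B \<in> H \<Longrightarrow> sent B"
    and H_cons: "\<not> loc H Bot"
    and H_complete: "sent B \<Longrightarrow> B \<in> H \<or> Neg B \<in> H"
    and H_wit: "sent (All x \<tau> C) \<Longrightarrow> All x \<tau> C \<notin> H \<Longrightarrow>
      \<exists>c. \<not> gd c \<and> Neg (sb (x, \<tau>) (Var c \<tau>) C) \<in> H"
begin

lemma H_loc: "B \<in> H \<Longrightarrow> loc H B" using H_sent sent_wff hyp by blast

lemma H_closed: "loc H B \<Longrightarrow> sent B \<Longrightarrow> B \<in> H"
  using H_complete H_loc H_cons cut unfolding Neg_def by blast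

lemma H_Bot [simp]: "Bot \<notin> H" using H_cons H_loc by blast

lemma H_Imp: assumes "sent A" "sent B" shows "Imp A B \<in> H \<longleftrightarrow> (A \<in> H \<longrightarrow> B \<in> H)"
proof
  assume "Imp A B \<in> H"
  then show "A \<in> H \<longrightarrow> B \<in> H" using H_closed H_loc cut assms by blast
next
  assume *: "A \<in> H \<longrightarrow> B \<in> H"
  have "loc H (Imp A B)"
  proof (cases "A \<in> H")
    case True
    then have "loc (insert A H) B" using * H_loc loc_mono by blast
    then show ?thesis using ded assms sent_wff by blast
  next
    case False
    then have "loc H (Imp A Bot)" using H_complete assms H_loc unfolding Neg_def by blast
    then have "loc (insert A H) B" using ded_rev explosion assms sent_wff by blast
    then show ?thesis using ded assms sent_wff by blast
  qed
  then show "Imp A B \<in> H" using H_closed assms by auto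
qed

text \<open>The elements of a sort are the terms that are closed up to Henkin constants.\<close>

definition dm :: "ty \<Rightarrow> tm set" where
  "dm \<tau> = {t. wft L t \<and> bad (fvt t) \<and> tyof t = \<tau>}"

lemma H_All:
  assumes "sent (All x \<tau> C)"
  shows "All x \<tau> C \<in> H \<longleftrightarrow> (\<forall>t\<in>dm \<tau>. sb (x, \<tau>) t C \<in> H)"
proof
  assume *: "All x \<tau> C \<in> H"
  show "\<forall>t\<in>dm \<tau>. sb (x, \<tau>) t C \<in> H"
  proof
    fix t assume t: "t \<in> dm \<tau>"
    then have s: "sent (sb (x, \<tau>) t C)" using assms sent_sb by (auto simp: dm_def)
    have "prv L T (Imp (All x \<tau> C) (sb (x, \<tau>) t C))"
      using assms t by (intro all_inst free_for_bad) (auto simp: dm_def sent_def)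
    then have "loc H (Imp (All x \<tau> C) (sb (x, \<tau>) t C))"
      using sent_wff[OF assms] sent_wff[OF s] by (intro loc.provable) auto
    then show "sb (x, \<tau>) t C \<in> H" using * s H_closed H_loc cut by blast
  qed
next
  assume *: "\<forall>t\<in>dm \<tau>. sb (x, \<tau>) t C \<in> H"
  show "All x \<tau> C \<in> H"
  proof (rule ccontr)
    assume "All x \<tau> C \<notin> H"
    then obtain c where c: "\<not> gd c" "Neg (sb (x, \<tau>) (Var c \<tau>) C) \<in> H" using H_wit assms by blast
    then have "Var c \<tau> \<in> dm \<tau>" by (simp add: dm_def bad_def)
    then show False using c * H_loc cut H_cons unfolding Neg_def by blast
  qed
qed

definition env :: "(string \<times> ty \<Rightarrow> tm) \<Rightarrow> bool" where
  "env \<theta> \<longleftrightarrow> (\<forall>v. \<theta> v \<in> dm (snd v))"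

text \<open>Weaker than \<open>env\<close>, in order to survive the passage under a quantifier,
  where \<open>msb\<close> resets the bound variable to itself.\<close>

definition penv :: "(string \<times> ty \<Rightarrow> tm) \<Rightarrow> bool" where
  "penv \<theta> \<longleftrightarrow> (\<forall>x \<tau>. wft L (\<theta> (x, \<tau>)) \<and> tyof (\<theta> (x, \<tau>)) = \<tau> \<and>
     (bad (fvt (\<theta> (x, \<tau>))) \<or> \<theta> (x, \<tau>) = Var x \<tau>))"

lemma env_dm: "env \<theta> \<Longrightarrow> \<theta> v \<in> dm (snd v)" unfolding env_def by blast
lemma env_penv: "env \<theta> \<Longrightarrow> penv \<theta>" by (auto simp: env_def penv_def dm_def)
lemma env_upd [simp]: "env \<theta> \<Longrightarrow> t \<in> dm \<tau> \<Longrightarrow> env (\<theta>((x, \<tau>) := t))" by (auto simp: env_def)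
lemma penv_upd: "penv \<theta> \<Longrightarrow> penv (\<theta>((x, \<tau>) := Var x \<tau>))" by (auto simp: penv_def)

lemma tyof_msbt: "penv \<theta> \<Longrightarrow> tyof (msbt \<theta> t) = tyof t"
  by (induction t) (auto simp: penv_def split: ty.splits)
lemma wft_msbt: "penv \<theta> \<Longrightarrow> wft L t \<Longrightarrow> wft L (msbt \<theta> t)"
  by (induction t) (auto simp: tyof_msbt, auto simp: penv_def)
lemma wff_msb: "penv \<theta> \<Longrightarrow> wff L A \<Longrightarrow> wff L (msb \<theta> A)"
  by (induction A arbitrary: \<theta>) (auto simp: tyof_msbt wft_msbt penv_upd)

lemma fvt_msbt: "penv \<theta> \<Longrightarrow> v \<in> fvt (msbt \<theta> t) \<Longrightarrow>
    \<not> gd (fst v) \<or> v \<in> fvt t \<and> \<theta> v = Var (fst v) (snd v)"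
proof (induction t)
  case (Var x \<tau>)
  then have "bad (fvt (\<theta> (x, \<tau>))) \<or> \<theta> (x, \<tau>) = Var x \<tau>" by (auto simp: penv_def)
  then show ?case using Var by (auto simp: bad_def)
qed auto

lemma fv_msb: "penv \<theta> \<Longrightarrow> v \<in> fv (msb \<theta> A) \<Longrightarrow>
    \<not> gd (fst v) \<or> v \<in> fv A \<and> \<theta> v = Var (fst v) (snd v)"
proof (induction A arbitrary: \<theta>)
  case (All x \<tau> A)
  then have "v \<in> fv (msb (\<theta>((x, \<tau>) := Var x \<tau>)) A)" "v \<noteq> (x, \<tau>)" by auto
  moreover from this have "(\<theta>((x, \<tau>) := Var x \<tau>)) v = \<theta> v" by simp
  ultimately show ?case using All.IH[OF penv_upd[OF All.prems(1), of x \<tau>]]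
    by (metis Diff_iff empty_iff fv.simps(5) insert_iff)
qed (auto dest: fvt_msbt)

lemma sent_msb: assumes "env \<theta>" "wff L A" "bgd A" shows "sent (msb \<theta> A)"
proof -
  have "\<not> gd (fst v)" if "v \<in> fv (msb \<theta> A)" for v
  proof
    assume "gd (fst v)"
    moreover from this have "\<theta> v = Var (fst v) (snd v)" using fv_msb env_penv assms that by blast
    moreover have "bad (fvt (\<theta> v))" using env_dm[OF assms(1), of v] by (simp add: dm_def)
    ultimately show False by (auto simp: bad_def)
  qed
  then show ?thesis using assms env_penv by (auto simp: sent_def wff_msb bgd_msb bad_def)
qed

lemma msbt_dm: "env \<theta> \<Longrightarrow> wft L t \<Longrightarrow> msbt \<theta> t \<in> dm (tyof t)"
proof (induction t)
  case (Var x \<tau>)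
  then show ?case by (auto simp: env_def)
next
  case (App s t)
  then show ?case by (auto simp: dm_def bad_def tyof_msbt env_penv)
qed (auto simp: dm_def bad_def)

lemma sb_msb_All:
  assumes "env \<theta>" "gd x"
  shows "sb (x, \<tau>) t (msb (\<theta>((x, \<tau>) := Var x \<tau>)) A) = msb (\<theta>((x, \<tau>) := t)) A"
proof -
  have *: "(x, \<tau>) \<notin> fvt (\<theta> w)" for w
    using env_dm[OF assms(1), of w] assms(2) by (auto simp: dm_def bad_def)
  then have "(\<lambda>w. sbt (x, \<tau>) t ((\<theta>((x, \<tau>) := Var x \<tau>)) w)) = \<theta>((x, \<tau>) := t)"
    by (auto simp: sbt_idle)
  then show ?thesis using * by (subst sb_msb) auto
qed

fun tsat :: "(string \<times> ty \<Rightarrow> tm) \<Rightarrow> fm \<Rightarrow> bool" where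
  "tsat \<theta> (Eq s t) \<longleftrightarrow> Eq (msbt \<theta> s) (msbt \<theta> t) \<in> H"
| "tsat \<theta> (St t) \<longleftrightarrow> St (msbt \<theta> t) \<in> H"
| "tsat \<theta> Bot \<longleftrightarrow> False"
| "tsat \<theta> (Imp A B) \<longleftrightarrow> (tsat \<theta> A \<longrightarrow> tsat \<theta> B)"
| "tsat \<theta> (All x \<tau> A) \<longleftrightarrow> (\<forall>t\<in>dm \<tau>. tsat (\<theta>((x, \<tau>) := t)) A)"

lemma truth: "env \<theta> \<Longrightarrow> wff L A \<Longrightarrow> bgd A \<Longrightarrow> tsat \<theta> A \<longleftrightarrow> msb \<theta> A \<in> H"
proof (induction A arbitrary: \<theta>)
  case (Imp A B)
  then have "sent (msb \<theta> A)" "sent (msb \<theta> B)" by (simp_all add: sent_msb)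
  then show ?case using Imp H_Imp by simp
next
  case (All x \<tau> A)
  then have "sent (msb \<theta> (All x \<tau> A))" by (intro sent_msb) auto
  then have "msb \<theta> (All x \<tau> A) \<in> H \<longleftrightarrow> (\<forall>t\<in>dm \<tau>. msb (\<theta>((x, \<tau>) := t)) A \<in> H)"
    using H_All[of x \<tau> "msb (\<theta>((x, \<tau>) := Var x \<tau>)) A"] All.prems by (simp add: sb_msb_All)
  moreover have "tsat (\<theta>((x, \<tau>) := t)) A \<longleftrightarrow> msb (\<theta>((x, \<tau>) := t)) A \<in> H" if "t \<in> dm \<tau>" for t
    using All.prems by (intro All.IH env_upd that) auto
  ultimately show ?case by simp
qed auto

text \<open>Only sentences belong to \<open>H\<close>, while theorems may have free variables. The
  universal closure is provable, hence in \<open>H\<close> and true; stripping its quantifiers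
  returns the theorem under every environment.\<close>

lemma tsat_axiom:
  assumes "prv L T B" "wff L B" "gdf B" "env \<theta>"
  shows "tsat \<theta> B"
proof -
  obtain vs where vs: "set vs = fv B" using finite_fv finite_list by blast
  let ?cl = "\<lambda>vs. foldr (\<lambda>(x, \<tau>). All x \<tau>) vs B"
  have 1: "prv L T (?cl us) \<and> wff L (?cl us)" for us
    using assms by (induction us) (auto intro: gen)
  have 2: "bgd (?cl us)" if "set us \<subseteq> fv B" for us
    using that assms by (induction us) (auto simp: gdf_bgd dest: gdf_fv)
  have 3: "fv (?cl us) = fv B - set us" for us
    by (induction us) (simp_all add: split_beta Diff_insert[symmetric])
  have 4: "(\<forall>\<theta>. env \<theta> \<longrightarrow> tsat \<theta> (?cl us)) \<longrightarrow> (\<forall>\<theta>. env \<theta> \<longrightarrow> tsat \<theta> B)" for us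
  proof (induction us)
    case (Cons v us)
    obtain x \<tau> where v: "v = (x, \<tau>)" by (cases v)
    have "tsat \<theta> (?cl us)" if "\<forall>\<theta>. env \<theta> \<longrightarrow> tsat \<theta> (?cl (v # us))" "env \<theta>" for \<theta>
    proof -
      have "\<theta> (x, \<tau>) \<in> dm \<tau>" using that(2) by (auto simp: env_def)
      moreover have "\<forall>t\<in>dm \<tau>. tsat (\<theta>((x, \<tau>) := t)) (?cl us)" using that v by auto
      ultimately show ?thesis using fun_upd_triv by metis
    qed
    then show ?case using Cons by blast
  qed auto
  have fv0: "fv (?cl vs) = {}" using 3 vs by auto
  then have "sent (?cl vs)" using 1 2 vs by (auto simp: sent_def bad_def)
  then have "?cl vs \<in> H" using 1 loc.provable H_closed by blast
  moreover have "msb \<eta> (?cl vs) = ?cl vs" for \<eta> using fv0 by (intro msb_Var) auto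
  ultimately have "\<forall>\<theta>. env \<theta> \<longrightarrow> tsat \<theta> (?cl vs)" using truth 1 2 vs by simp
  then show ?thesis using 4 assms by blast
qed

lemma tsat_connectives [simp]:
  "tsat \<theta> (Neg A) \<longleftrightarrow> \<not> tsat \<theta> A" "tsat \<theta> (And A B) \<longleftrightarrow> tsat \<theta> A \<and> tsat \<theta> B"
  "tsat \<theta> (All_lt x t A) \<longleftrightarrow> tsat \<theta> (All x Nt (Imp (lt (Var x Nt) t) A))"
  "tsat \<theta> (lt s t) \<longleftrightarrow> Eq (monus_c \<cdot> suc (msbt \<theta> s) \<cdot> msbt \<theta> t) zero \<in> H"
  by (auto simp: Neg_def And_def All_lt_def lt_def le_def)

text \<open>The meaning of \<open>eq\<close> in the term model, freed from environments and from the
  fresh variable names, so that its congruence properties can be proved by induction on the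
  type.\<close>

fun sim :: "ty \<Rightarrow> tm \<Rightarrow> tm \<Rightarrow> bool" where
  "sim Nt s t \<longleftrightarrow> Eq s t \<in> H"
| "sim (\<sigma> \<leadsto> \<tau>) s t \<longleftrightarrow> (\<forall>u\<in>dm \<sigma>. sim \<tau> (s \<cdot> u) (t \<cdot> u))"
| "sim (Seq \<sigma>) s t \<longleftrightarrow> Eq (Con (Len \<sigma>) \<cdot> s) (Con (Len \<sigma>) \<cdot> t) \<in> H \<and>
     (\<forall>u\<in>dm Nt. Eq (monus_c \<cdot> suc u \<cdot> (Con (Len \<sigma>) \<cdot> s)) zero \<in> H \<longrightarrow>
        sim \<sigma> (Con (Nth \<sigma>) \<cdot> s \<cdot> u) (Con (Nth \<sigma>) \<cdot> t \<cdot> u))"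

lemma tsat_eq: "tsat \<theta> (eq \<tau> s t) \<longleftrightarrow> sim \<tau> (msbt \<theta> s) (msbt \<theta> t)"
  by (induction \<tau> arbitrary: \<theta> s t) (auto simp: Let_def msbt_fresh)

end


section \<open>The quotient of the term model by extensional equality\<close>

locale base_henkin = henkin "dom \<D>" "base_theory \<D>" H for \<D> H
begin

lemma axiom:
  assumes "B \<in> RCA0_omega (dom \<D>)" "wff (dom \<D>) B" "gdf B" "env \<theta>"
  shows "tsat \<theta> B"
  using assms by (intro tsat_axiom) (auto simp: base_theory_def intro: ax RCA0_Omega.base)

definition \<theta>0 :: "string \<times> ty \<Rightarrow> tm" where "\<theta>0 v = zero_of (snd v)"

lemma env_\<theta>0 [simp]: "env \<theta>0" by (auto simp: env_def \<theta>0_def dm_def bad_def)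

lemma dm_App [intro]: "f \<in> dm (\<sigma> \<leadsto> \<tau>) \<Longrightarrow> t \<in> dm \<sigma> \<Longrightarrow> f \<cdot> t \<in> dm \<tau>"
  by (auto simp: dm_def bad_def)
lemma dm_closed [intro]: "wft (dom \<D>) t \<Longrightarrow> fvt t = {} \<Longrightarrow> tyof t = \<tau> \<Longrightarrow> t \<in> dm \<tau>"
  by (auto simp: dm_def bad_def)

abbreviation E :: "tm \<Rightarrow> tm \<Rightarrow> bool" where "E s t \<equiv> Eq s t \<in> H"

lemma E_refl: "s \<in> dm Nt \<Longrightarrow> E s s"
  using axiom[OF eq_refl, of "\<theta>0((''x'', Nt) := s)"] by simp
lemma E_sym: "s \<in> dm Nt \<Longrightarrow> t \<in> dm Nt \<Longrightarrow> E s t \<Longrightarrow> E t s"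
  using axiom[OF eq_sym, of "\<theta>0((''x'', Nt) := s, (''y'', Nt) := t)"] by simp
lemma E_trans: "s \<in> dm Nt \<Longrightarrow> t \<in> dm Nt \<Longrightarrow> u \<in> dm Nt \<Longrightarrow> E s t \<Longrightarrow> E t u \<Longrightarrow> E s u"
  using axiom[OF eq_trans, of "\<theta>0((''x'', Nt) := s, (''y'', Nt) := t, (''z'', Nt) := u)"] by simp
lemma E_suc_zero: "s \<in> dm Nt \<Longrightarrow> \<not> E (suc s) zero"
  using axiom[OF suc_not_zero, of "\<theta>0((''x'', Nt) := s)"] by simp
lemma E_suc_inj: "s \<in> dm Nt \<Longrightarrow> t \<in> dm Nt \<Longrightarrow> E (suc s) (suc t) \<Longrightarrow> E s t"
  using axiom[OF suc_inj, of "\<theta>0((''x'', Nt) := s, (''y'', Nt) := t)"] by simp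

lemma sim_ext:
  "f \<in> dm (\<sigma> \<leadsto> \<tau>) \<Longrightarrow> s \<in> dm \<sigma> \<Longrightarrow> t \<in> dm \<sigma> \<Longrightarrow> sim \<sigma> s t \<Longrightarrow> sim \<tau> (f \<cdot> s) (f \<cdot> t)"
  using axiom[OF extensionality[OF refl refl refl, of \<sigma> \<tau>],
      where \<theta> = "\<theta>0((''f'', \<sigma> \<leadsto> \<tau>) := f, (''x'', \<sigma>) := s, (''y'', \<sigma>) := t)"]
  by (simp add: tsat_eq)

lemma sim_refl: "s \<in> dm \<tau> \<Longrightarrow> sim \<tau> s s"
proof (induction \<tau> arbitrary: s)
  case (Seq \<sigma>)
  have "Con (Len \<sigma>) \<cdot> s \<in> dm Nt" using Seq.prems by (auto simp: dm_def bad_def)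
  moreover have "Con (Nth \<sigma>) \<cdot> s \<cdot> u \<in> dm \<sigma>" if "u \<in> dm Nt" for u
    using Seq.prems that by (auto simp: dm_def bad_def)
  ultimately show ?case using Seq E_refl by auto
qed (auto simp: E_refl)

lemma Len_dm: "s \<in> dm (Seq \<sigma>) \<Longrightarrow> Con (Len \<sigma>) \<cdot> s \<in> dm Nt" by (auto simp: dm_def bad_def)
lemma Nth_dm: "s \<in> dm (Seq \<sigma>) \<Longrightarrow> u \<in> dm Nt \<Longrightarrow> Con (Nth \<sigma>) \<cdot> s \<cdot> u \<in> dm \<sigma>"
  by (auto simp: dm_def bad_def)

text \<open>The bound on the index in \<open>sim\<close> for sequences refers to the left sequence
  only. Symmetry and transitivity have to exchange it for the equal length of the other
  sequence.\<close>

lemma lt_E: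
  assumes "u \<in> dm Nt" "m \<in> dm Nt" "n \<in> dm Nt" "E m n" "E (monus_c \<cdot> suc u \<cdot> m) zero"
  shows "E (monus_c \<cdot> suc u \<cdot> n) zero"
proof -
  have f: "monus_c \<cdot> suc u \<in> dm (Nt \<leadsto> Nt)" using assms by (auto simp: dm_def bad_def)
  have z: "zero \<in> dm Nt" by (auto simp: dm_def bad_def)
  have "E (monus_c \<cdot> suc u \<cdot> m) (monus_c \<cdot> suc u \<cdot> n)" using sim_ext[OF f, of m n] assms by simp
  then show ?thesis using E_trans E_sym f z assms by (meson dm_App)
qed

lemma sim_sym: "s \<in> dm \<tau> \<Longrightarrow> t \<in> dm \<tau> \<Longrightarrow> sim \<tau> s t \<Longrightarrow> sim \<tau> t s"
proof (induction \<tau> arbitrary: s t)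
  case (Seq \<sigma>)
  then have "E (Con (Len \<sigma>) \<cdot> t) (Con (Len \<sigma>) \<cdot> s)" using Len_dm E_sym by simp
  then show ?case using Seq Len_dm Nth_dm lt_E by (metis sim.simps(3))
next
  case (Fun \<sigma> \<tau>)
  have "sim \<tau> (t \<cdot> v) (s \<cdot> v)" if "v \<in> dm \<sigma>" for v
    using Fun.IH(2)[of "s \<cdot> v" "t \<cdot> v"] Fun.prems that by auto
  then show ?case by simp
qed (auto intro: E_sym)

lemma sim_trans:
  "s \<in> dm \<tau> \<Longrightarrow> t \<in> dm \<tau> \<Longrightarrow> u \<in> dm \<tau> \<Longrightarrow> sim \<tau> s t \<Longrightarrow> sim \<tau> t u \<Longrightarrow> sim \<tau> s u"
proof (induction \<tau> arbitrary: s t u)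
  case (Seq \<sigma>)
  have 1: "E (Con (Len \<sigma>) \<cdot> s) (Con (Len \<sigma>) \<cdot> t)" "E (Con (Len \<sigma>) \<cdot> t) (Con (Len \<sigma>) \<cdot> u)"
    using Seq.prems by auto
  have 2: "E (Con (Len \<sigma>) \<cdot> s) (Con (Len \<sigma>) \<cdot> u)"
    using 1 Seq.prems Len_dm E_trans by blast
  have "sim \<sigma> (Con (Nth \<sigma>) \<cdot> s \<cdot> i) (Con (Nth \<sigma>) \<cdot> u \<cdot> i)"
    if i: "i \<in> dm Nt" "E (monus_c \<cdot> suc i \<cdot> (Con (Len \<sigma>) \<cdot> s)) zero" for i
  proof -
    have "E (monus_c \<cdot> suc i \<cdot> (Con (Len \<sigma>) \<cdot> t)) zero"
      using lt_E i 1 Seq.prems Len_dm by blast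
    then have "sim \<sigma> (Con (Nth \<sigma>) \<cdot> s \<cdot> i) (Con (Nth \<sigma>) \<cdot> t \<cdot> i)"
      "sim \<sigma> (Con (Nth \<sigma>) \<cdot> t \<cdot> i) (Con (Nth \<sigma>) \<cdot> u \<cdot> i)"
      using Seq.prems(4,5) i by auto
    then show ?thesis using Seq.IH Nth_dm i(1) Seq.prems(1-3) by blast
  qed
  then show ?case using 2 by simp
next
  case (Fun \<sigma> \<tau>)
  have "sim \<tau> (s \<cdot> v) (u \<cdot> v)" if "v \<in> dm \<sigma>" for v
    using Fun.IH(2)[of "s \<cdot> v" "t \<cdot> v" "u \<cdot> v"] Fun.prems that by auto
  then show ?case by simp
qed (auto intro: E_trans)

lemma sim_App:
  assumes "f \<in> dm (\<sigma> \<leadsto> \<tau>)" "g \<in> dm (\<sigma> \<leadsto> \<tau>)" "s \<in> dm \<sigma>" "t \<in> dm \<sigma>"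
    "sim (\<sigma> \<leadsto> \<tau>) f g" "sim \<sigma> s t"
  shows "sim \<tau> (f \<cdot> s) (g \<cdot> t)"
  using assms sim_ext[of f \<sigma> \<tau> s t] sim_trans[of "f \<cdot> s" \<tau> "f \<cdot> t" "g \<cdot> t"] by auto

lemma sim_St:
  assumes "s \<in> dm \<sigma>" "t \<in> dm \<sigma>" "sim \<sigma> s t" "St s \<in> H" shows "St t \<in> H"
proof -
  let ?B = "Imp (And (St (Var ''x'' \<sigma>)) (eq \<sigma> (Var ''x'' \<sigma>) (Var ''y'' \<sigma>))) (St (Var ''y'' \<sigma>))"
  have "tsat (\<theta>0((''x'', \<sigma>) := s, (''y'', \<sigma>) := t)) ?B"
    using assms by (intro tsat_axiom ax) (auto simp: base_theory_def intro: st_eq)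
  then show ?thesis using assms by (simp add: tsat_eq)
qed

fun num :: "nat \<Rightarrow> tm" where "num 0 = zero" | "num (Suc n) = suc (num n)"

lemma num_closed [simp]: "wft L (num n)" "fvt (num n) = {}" "tyof (num n) = Nt"
proof -
  show "tyof (num n) = Nt" for n by (induction n) auto
  then show "wft L (num n)" by (induction n) auto
  show "fvt (num n) = {}" by (induction n) auto
qed

lemma num_dm [simp]: "num n \<in> dm Nt" by auto

lemma E_num: "E (num m) (num n) \<Longrightarrow> m = n"
proof (induction m arbitrary: n)
  case 0
  have "\<not> E zero (suc (num k))" for k
    using E_suc_zero[of "num k"] E_sym[of "num 0" "num (Suc k)"] num_dm[of 0] num_dm[of "Suc k"] by auto
  then show ?case using 0 by (cases n) auto
next
  case (Suc m)
  then show ?case using E_suc_zero[of "num m"] E_suc_inj[of "num m"] by (cases n) auto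
qed

text \<open>All sorts are countably infinite, so that every carrier can be taken to be the full type of natural
  numbers and no relativisation to carriers is needed.\<close>

lemma infinitely_many: "\<exists>f :: nat \<Rightarrow> tm. \<forall>m n. f n \<in> dm \<tau> \<and> (sim \<tau> (f m) (f n) \<longrightarrow> m = n)"
proof (induction \<tau>)
  case Nt
  show ?case by (rule exI[of _ num]) (auto simp: E_num dm_closed)
next
  case (Fun \<sigma> \<tau>)
  obtain f :: "nat \<Rightarrow> tm" where f': "\<forall>m n. f n \<in> dm \<tau> \<and> (sim \<tau> (f m) (f n) \<longrightarrow> m = n)"
    using Fun.IH(2) by (rule exE)
  have f: "\<And>n. f n \<in> dm \<tau>" "\<And>m n. sim \<tau> (f m) (f n) \<Longrightarrow> m = n" using f' by simp_all
  let ?g = "\<lambda>n. Con (Kc \<tau> \<sigma>) \<cdot> f n"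
  have z: "zero_of \<sigma> \<in> dm \<sigma>" by auto
  have g: "?g n \<in> dm (\<sigma> \<leadsto> \<tau>)" for n using f(1)[of n] by (auto simp: dm_def bad_def)
  have k: "sim \<tau> (?g n \<cdot> zero_of \<sigma>) (f n)" for n
    using axiom[OF comb_k[of \<tau> \<sigma>], of "\<theta>0((''x'', \<tau>) := f n, (''y'', \<sigma>) := zero_of \<sigma>)"] f z
    by (cases "\<sigma> = \<tau>") (auto simp: tsat_eq)
  have "m = n" if "sim (\<sigma> \<leadsto> \<tau>) (?g m) (?g n)" for m n
  proof -
    have "sim \<tau> (?g m \<cdot> zero_of \<sigma>) (?g n \<cdot> zero_of \<sigma>)" using that z by auto
    then have "sim \<tau> (f m) (f n)"
      using k[of m] k[of n] f(1) g z sim_trans sim_sym by (meson dm_App)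
    then show ?thesis using f by blast
  qed
  then show ?case using g by (intro exI[of _ ?g]) blast
next
  case (Seq \<sigma>)
  let ?f = "Con (Kc \<sigma> Nt) \<cdot> zero_of \<sigma>"
  let ?g = "\<lambda>n. Con (Tab \<sigma>) \<cdot> num n \<cdot> ?f"
  have g: "?g n \<in> dm (Seq \<sigma>)" for n by (auto simp: dm_def bad_def)
  have k: "E (Con (Len \<sigma>) \<cdot> ?g n) (num n)" for n
    using axiom[OF len_tab[OF refl refl, of \<sigma>], of "\<theta>0((''n'', Nt) := num n, (''f'', Nt \<leadsto> \<sigma>) := ?f)"]
    by (simp add: dm_closed)
  have "m = n" if "sim (Seq \<sigma>) (?g m) (?g n)" for m n
  proof -
    have "E (Con (Len \<sigma>) \<cdot> ?g m) (Con (Len \<sigma>) \<cdot> ?g n)" using that by auto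
    moreover have "num i \<in> dm Nt" for i by auto
    ultimately have "E (num m) (num n)"
      using k[of m] k[of n] Len_dm[OF g] E_trans E_sym by meson
    then show ?thesis using E_num by blast
  qed
  then show ?case using g by (intro exI[of _ ?g]) blast
qed

definition cls :: "ty \<Rightarrow> tm \<Rightarrow> tm set" where "cls \<tau> t = {u \<in> dm \<tau>. sim \<tau> t u}"
text \<open>A numbering of the classes of extensionally equal terms. Since each sort has infinitely
  many classes, it is onto, and so every natural number denotes an object of every sort.\<close>

definition q :: "ty \<Rightarrow> tm \<Rightarrow> nat" where "q \<tau> t = to_nat_on (cls \<tau> ` dm \<tau>) (cls \<tau> t)"
definition r :: "ty \<Rightarrow> nat \<Rightarrow> tm" where "r \<tau> n = (SOME t. t \<in> dm \<tau> \<and> q \<tau> t = n)"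

lemma cls_eq: assumes "s \<in> dm \<tau>" "t \<in> dm \<tau>" shows "cls \<tau> s = cls \<tau> t \<longleftrightarrow> sim \<tau> s t"
proof
  assume "cls \<tau> s = cls \<tau> t"
  then show "sim \<tau> s t" using assms sim_refl[of t \<tau>] by (auto simp: cls_def)
next
  assume "sim \<tau> s t"
  then show "cls \<tau> s = cls \<tau> t" unfolding cls_def using assms sim_trans sim_sym by blast
qed

lemma q_eq: assumes "s \<in> dm \<tau>" "t \<in> dm \<tau>" shows "q \<tau> s = q \<tau> t \<longleftrightarrow> sim \<tau> s t"
proof -
  have "countable (cls \<tau> ` dm \<tau>)" by simp
  then show ?thesis using assms cls_eq unfolding q_def by simp
qed

lemma q_surj: "\<exists>t\<in>dm \<tau>. q \<tau> t = n"
proof -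
  obtain f :: "nat \<Rightarrow> tm" where f': "\<forall>m n. f n \<in> dm \<tau> \<and> (sim \<tau> (f m) (f n) \<longrightarrow> m = n)"
    using infinitely_many by (rule exE)
  have f: "\<And>n. f n \<in> dm \<tau>" "\<And>m n. sim \<tau> (f m) (f n) \<Longrightarrow> m = n" using f' by simp_all
  have "inj (\<lambda>n. cls \<tau> (f n))" using f cls_eq by (auto simp: inj_def)
  then have "infinite (range (\<lambda>n. cls \<tau> (f n)))" using finite_imageD by blast
  then have "infinite (cls \<tau> ` dm \<tau>)" using f finite_subset[of "range (\<lambda>n. cls \<tau> (f n))"] by blast
  then have "bij_betw (to_nat_on (cls \<tau> ` dm \<tau>)) (cls \<tau> ` dm \<tau>) UNIV"
    by (intro to_nat_on_infinite) auto
  then have "n \<in> to_nat_on (cls \<tau> ` dm \<tau>) ` cls \<tau> ` dm \<tau>" by (simp only: bij_betw_def UNIV_I)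
  then show ?thesis by (auto simp: q_def)
qed

lemma r: "r \<tau> n \<in> dm \<tau>" "q \<tau> (r \<tau> n) = n"
  using someI_ex[of "\<lambda>t. t \<in> dm \<tau> \<and> q \<tau> t = n"] q_surj unfolding r_def by blast+

end


section \<open>Abstract models and the completeness theorem\<close>

locale signature =
  fixes ap :: "ty \<Rightarrow> ty \<Rightarrow> 'u \<Rightarrow> 'u \<Rightarrow> 'u" and ci :: "con \<Rightarrow> 'u" and std :: "ty \<Rightarrow> 'u \<Rightarrow> bool"
begin

text \<open>One carrier serves all sorts, and the same element denotes different objects in
  different sorts; this is why \<open>ap\<close> and \<open>std\<close> receive types.\<close>

fun eval :: "(string \<times> ty \<Rightarrow> 'u) \<Rightarrow> tm \<Rightarrow> 'u" where
  "eval e (Var x \<tau>) = e (x, \<tau>)"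
| "eval e (Con c) = ci c"
| "eval e (s \<cdot> t) = ap (tyof t) (tyof (s \<cdot> t)) (eval e s) (eval e t)"

fun sat :: "(string \<times> ty \<Rightarrow> 'u) \<Rightarrow> fm \<Rightarrow> bool" where
  "sat e (Eq s t) \<longleftrightarrow> eval e s = eval e t"
| "sat e (St t) \<longleftrightarrow> std (tyof t) (eval e t)"
| "sat e Bot \<longleftrightarrow> False"
| "sat e (Imp A B) \<longleftrightarrow> (sat e A \<longrightarrow> sat e B)"
| "sat e (All x \<tau> A) \<longleftrightarrow> (\<forall>a. sat (e((x, \<tau>) := a)) A)"

end

text \<open>The axioms are restricted to what \<open>tsat_axiom\<close> can deliver, namely
  well-formed formulas without reserved names. By \<open>sat_eq\<close>, extensional equality of
  every type is identity in the model.\<close>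

locale model = signature ap ci std
  for ap :: "ty \<Rightarrow> ty \<Rightarrow> 'u \<Rightarrow> 'u \<Rightarrow> 'u" and ci :: "con \<Rightarrow> 'u" and std :: "ty \<Rightarrow> 'u \<Rightarrow> bool" +
  fixes \<D> :: "nat \<times> ty \<rightharpoonup> fm"
  assumes sat_axiom: "A \<in> base_theory \<D> \<Longrightarrow> wff (dom \<D>) A \<Longrightarrow> gdf A \<Longrightarrow> sat e A"
    and sat_eq: "wft (dom \<D>) s \<Longrightarrow> wft (dom \<D>) t \<Longrightarrow> tyof s = \<tau> \<Longrightarrow> tyof t = \<tau> \<Longrightarrow>
      sat e (eq \<tau> s t) \<longleftrightarrow> eval e s = eval e t"

context base_henkin
begin

sublocale S: signature "\<lambda>\<sigma> \<tau> a b. q \<tau> (r (\<sigma> \<leadsto> \<tau>) a \<cdot> r \<sigma> b)" "\<lambda>c. q (ty_con c) (Con c)"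
  "\<lambda>\<tau> a. St (r \<tau> a) \<in> H" .

definition rel_env :: "(string \<times> ty \<Rightarrow> nat) \<Rightarrow> (string \<times> ty \<Rightarrow> tm) \<Rightarrow> bool" where
  "rel_env e \<theta> \<longleftrightarrow> env \<theta> \<and> (\<forall>x \<tau>. q \<tau> (\<theta> (x, \<tau>)) = e (x, \<tau>))"

lemma eval_q: "rel_env e \<theta> \<Longrightarrow> wft (dom \<D>) t \<Longrightarrow> S.eval e t = q (tyof t) (msbt \<theta> t)"
proof (induction t)
  case (App s t)
  then obtain \<tau> where \<tau>: "tyof s = tyof t \<leadsto> \<tau>" by auto
  let ?s = "msbt \<theta> s" and ?t = "msbt \<theta> t"
  have dm: "?s \<in> dm (tyof t \<leadsto> \<tau>)" "?t \<in> dm (tyof t)"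
    using App.prems msbt_dm[of \<theta> s] msbt_dm[of \<theta> t] \<tau> by (auto simp: rel_env_def)
  have "sim (tyof t \<leadsto> \<tau>) (r (tyof t \<leadsto> \<tau>) (q (tyof t \<leadsto> \<tau>) ?s)) ?s"
    "sim (tyof t) (r (tyof t) (q (tyof t) ?t)) ?t" using dm r q_eq by metis+
  then have "q \<tau> (r (tyof t \<leadsto> \<tau>) (q (tyof t \<leadsto> \<tau>) ?s) \<cdot> r (tyof t) (q (tyof t) ?t)) = q \<tau> (?s \<cdot> ?t)"
    using dm r sim_App q_eq by (meson dm_App)
  then show ?case using App \<tau> by simp
qed (auto simp: rel_env_def)

lemma sat_tsat: "rel_env e \<theta> \<Longrightarrow> wff (dom \<D>) A \<Longrightarrow> S.sat e A \<longleftrightarrow> tsat \<theta> A"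
proof (induction A arbitrary: e \<theta>)
  case (Eq s t)
  then have "msbt \<theta> s \<in> dm Nt" "msbt \<theta> t \<in> dm Nt"
    using msbt_dm[of \<theta> s] msbt_dm[of \<theta> t] by (auto simp: rel_env_def)
  then show ?case using Eq eval_q[of e \<theta>] q_eq[of "msbt \<theta> s" Nt "msbt \<theta> t"] by simp
next
  case (St t)
  have t: "msbt \<theta> t \<in> dm (tyof t)" using St msbt_dm by (auto simp: rel_env_def)
  then have "sim (tyof t) (msbt \<theta> t) (r (tyof t) (q (tyof t) (msbt \<theta> t)))" using r q_eq by metis
  then show ?case using St t r eval_q sim_St sim_sym by (simp, blast)
next
  case (All x \<tau> A)
  have up: "rel_env (e((x, \<tau>) := q \<tau> t)) (\<theta>((x, \<tau>) := t))" if "t \<in> dm \<tau>" for t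
    using All.prems that by (auto simp: rel_env_def)
  have IH: "S.sat (e((x, \<tau>) := q \<tau> t)) A \<longleftrightarrow> tsat (\<theta>((x, \<tau>) := t)) A" if "t \<in> dm \<tau>" for t
    by (rule All.IH[OF up[OF that]]) (use All.prems in simp)
  show ?case
  proof
    assume "S.sat e (All x \<tau> A)"
    then show "tsat \<theta> (All x \<tau> A)" using IH by simp
  next
    assume "tsat \<theta> (All x \<tau> A)"
    then have "tsat (\<theta>((x, \<tau>) := r \<tau> a)) A" for a using r by simp
    then have "S.sat (e((x, \<tau>) := a)) A" for a using IH[OF r(1), of a] r(2)[of \<tau> a] by simp
    then show "S.sat e (All x \<tau> A)" by simp
  qed
qed auto

lemma rel_env_ex: "\<exists>\<theta>. rel_env e \<theta> \<and> env \<theta>"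
  using r by (intro exI[of _ "\<lambda>(x, \<tau>). r \<tau> (e (x, \<tau>))"]) (auto simp: rel_env_def env_def)

sublocale S: model "\<lambda>\<sigma> \<tau> a b. q \<tau> (r (\<sigma> \<leadsto> \<tau>) a \<cdot> r \<sigma> b)" "\<lambda>c. q (ty_con c) (Con c)"
  "\<lambda>\<tau> a. St (r \<tau> a) \<in> H" \<D>
proof
  show "S.sat e A" if "A \<in> base_theory \<D>" "wff (dom \<D>) A" "gdf A" for A e
  proof -
    obtain \<theta> where \<theta>: "rel_env e \<theta>" "env \<theta>" using rel_env_ex[of e] by blast
    show ?thesis using that sat_tsat[OF \<theta>(1), of A] tsat_axiom[OF ax \<open>wff (dom \<D>) A\<close> _ \<theta>(2)] by simp
  qed
  show "S.sat e (eq \<tau> s t) \<longleftrightarrow> S.eval e s = S.eval e t"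
    if "wft (dom \<D>) s" "wft (dom \<D>) t" "tyof s = \<tau>" "tyof t = \<tau>" for s t \<tau> e
  proof -
    obtain \<theta> where \<theta>: "rel_env e \<theta>" "env \<theta>" using rel_env_ex[of e] by blast
    then have "msbt \<theta> s \<in> dm \<tau>" "msbt \<theta> t \<in> dm \<tau>"
      using msbt_dm[of \<theta> s] msbt_dm[of \<theta> t] that by simp_all
    then show ?thesis using that sat_tsat[OF \<theta>(1), of "eq \<tau> s t"] eval_q[OF \<theta>(1)] q_eq tsat_eq
      by simp
  qed
qed

end

text \<open>If \<open>A\<close> were underivable, some Henkin theory would contain
  \<open>Neg A\<close>, and the quotient of its term model, carried by the natural numbers, would be
  a model in which \<open>A\<close> fails.\<close>

theorem completeness:
  assumes "wff (dom \<D>) A" "gdf A" "fv A = {}"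
    and models: "\<And>ap ci std e. model ap ci std \<D> \<Longrightarrow> signature.sat ap ci std (e :: _ \<Rightarrow> nat) A"
  shows "prv (dom \<D>) (base_theory \<D>) A"
proof (rule ccontr)
  interpret calculus "dom \<D>" "base_theory \<D>" .
  assume "\<not> prv (dom \<D>) (base_theory \<D>) A"
  then have "\<not> loc {} A" using loc_empty by blast
  moreover have "sent A" using assms by (simp add: sent_def gdf_bgd bad_def)
  ultimately obtain H where H: "Neg A \<in> H" "\<And>B. B \<in> H \<Longrightarrow> sent B" "\<not> loc H Bot"
    "\<And>B. sent B \<Longrightarrow> B \<in> H \<or> Neg B \<in> H"
    "\<And>x \<tau> C. sent (All x \<tau> C) \<Longrightarrow> All x \<tau> C \<notin> H \<Longrightarrow> \<exists>c. \<not> gd c \<and> Neg (sb (x, \<tau>) (Var c \<tau>) C) \<in> H"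
    using henkin_extension by blast
  interpret base_henkin \<D> H using H by unfold_locales
  have "S.sat (\<lambda>_. 0) A" using models S.model_axioms by blast
  obtain \<theta> where \<theta>: "rel_env (\<lambda>_. 0) \<theta>" "env \<theta>"
    using rel_env_ex[of "\<lambda>_. 0"] by blast
  have "tsat \<theta> A" using \<open>S.sat (\<lambda>_. 0) A\<close> sat_tsat[OF \<theta>(1)] assms(1) by simp
  moreover have "msb \<theta> A = A" using assms(3) by (intro msb_Var) auto
  ultimately have "A \<in> H" using truth[OF \<theta>(2) assms(1)] gdf_bgd[OF assms(2)] by simp
  then have "loc H A" "loc H (Imp A Bot)" using H_loc H(1) unfolding Neg_def by blast+
  then show False using cut H_cons by blast
qed

section \<open>Operations in a model\<close>

named_theorems rep_intros

context model
begin

lemma sat_connectives [simp]: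
  "sat e (Neg A) \<longleftrightarrow> \<not> sat e A" "sat e (And A B) \<longleftrightarrow> sat e A \<and> sat e B"
  "sat e (Or A B) \<longleftrightarrow> sat e A \<or> sat e B" "sat e (Iff A B) \<longleftrightarrow> (sat e A \<longleftrightarrow> sat e B)"
  "sat e (Ex x \<tau> A) \<longleftrightarrow> (\<exists>a. sat (e((x, \<tau>) := a)) A)"
  "sat e (All_st x \<tau> A) \<longleftrightarrow> (\<forall>a. std \<tau> a \<longrightarrow> sat (e((x, \<tau>) := a)) A)"
  "sat e (Ex_st x \<tau> A) \<longleftrightarrow> (\<exists>a. std \<tau> a \<and> sat (e((x, \<tau>) := a)) A)"
  by (auto simp: Neg_def And_def Or_def Iff_def Ex_def All_st_def Ex_st_def)

lemma eval_cong: "(\<And>v. v \<in> fvt t \<Longrightarrow> e v = e' v) \<Longrightarrow> eval e t = eval e' t"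
  by (induction t) auto
lemma sat_cong: "(\<And>v. v \<in> fv A \<Longrightarrow> e v = e' v) \<Longrightarrow> sat e A = sat e' A"
proof (induction A arbitrary: e e')
  case (Eq s t)
  have "eval e s = eval e' s" by (rule eval_cong) (use Eq.prems in auto)
  moreover have "eval e t = eval e' t" by (rule eval_cong) (use Eq.prems in auto)
  ultimately show ?case by simp
next
  case (St t)
  have "eval e t = eval e' t" by (rule eval_cong) (use St.prems in auto)
  then show ?case by simp
next
  case (Imp A B)
  have "sat e A = sat e' A" by (rule Imp.IH(1)) (use Imp.prems in auto)
  moreover have "sat e B = sat e' B" by (rule Imp.IH(2)) (use Imp.prems in auto)
  ultimately show ?case by simp
next
  case (All x \<tau> A)
  have "sat (e((x, \<tau>) := a)) A = sat (e'((x, \<tau>) := a)) A" for a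
    by (rule All.IH) (use All.prems in auto)
  then show ?case by simp
qed simp

definition e0 :: "string \<times> ty \<Rightarrow> 'u" where "e0 = (\<lambda>_. undefined)"

lemma eval_closed: "fvt t = {} \<Longrightarrow> eval e t = eval e0 t" by (rule eval_cong) auto

lemma eval_upd_fresh: "v \<notin> fvt t \<Longrightarrow> eval (e(v := a)) t = eval e t"
  by (rule eval_cong) auto

lemma axiom: "B \<in> RCA0_omega (dom \<D>) \<Longrightarrow> wff (dom \<D>) B \<Longrightarrow> gdf B \<Longrightarrow> sat e B"
  by (rule sat_axiom) (auto simp: base_theory_def RCA0_Omega.base)
lemma axiom_st: "B \<in> RCA0_Omega \<D> \<Longrightarrow> wff (dom \<D>) B \<Longrightarrow> gdf B \<Longrightarrow> sat e B"
  by (rule sat_axiom) (auto simp: base_theory_def)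

lemma K: "ap \<tau> \<rho> (ap \<rho> (\<tau> \<leadsto> \<rho>) (ci (Kc \<rho> \<tau>)) a) b = a"
proof -
  let ?e = "e0((''x'', \<rho>) := a, (''y'', \<tau>) := b)"
  have "sat ?e (eq \<rho> (Con (Kc \<rho> \<tau>) \<cdot> Var ''x'' \<rho> \<cdot> Var ''y'' \<tau>) (Var ''x'' \<rho>))"
    by (intro axiom comb_k) auto
  then show ?thesis by (subst (asm) sat_eq) auto
qed

lemma S:
  "ap \<delta> \<tau> (ap (\<delta> \<leadsto> \<rho>) (\<delta> \<leadsto> \<tau>)
     (ap (\<delta> \<leadsto> \<rho> \<leadsto> \<tau>) ((\<delta> \<leadsto> \<rho>) \<leadsto> \<delta> \<leadsto> \<tau>) (ci (Sc \<delta> \<rho> \<tau>)) a) b) c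
   = ap \<rho> \<tau> (ap \<delta> (\<rho> \<leadsto> \<tau>) a c) (ap \<delta> \<rho> b c)"
proof -
  let ?e = "e0((''x'', \<delta> \<leadsto> \<rho> \<leadsto> \<tau>) := a, (''y'', \<delta> \<leadsto> \<rho>) := b, (''z'', \<delta>) := c)"
  let ?x = "Var ''x'' (\<delta> \<leadsto> \<rho> \<leadsto> \<tau>)" and ?y = "Var ''y'' (\<delta> \<leadsto> \<rho>)" and ?z = "Var ''z'' \<delta>"
  have "sat ?e (eq \<tau> (Con (Sc \<delta> \<rho> \<tau>) \<cdot> ?x \<cdot> ?y \<cdot> ?z) (?x \<cdot> ?z \<cdot> (?y \<cdot> ?z)))"
    by (intro axiom comb_s) auto
  then show ?thesis by (subst (asm) sat_eq) auto
qed

text \<open>The formula \<open>eq\<close> at a function type unfolds to equality of all values, and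
  \<open>sat_eq\<close> replaces it by identity on both sides.\<close>

lemma ext: assumes "\<And>a. ap \<sigma> \<tau> f a = ap \<sigma> \<tau> g a" shows "f = g"
proof -
  let ?e = "e0((''x'', \<sigma> \<leadsto> \<tau>) := f, (''y'', \<sigma> \<leadsto> \<tau>) := g)"
  let ?x = "Var ''x'' (\<sigma> \<leadsto> \<tau>)" and ?y = "Var ''y'' (\<sigma> \<leadsto> \<tau>)"
  let ?z = "fresh ?x ?y"
  have z: "?z \<noteq> ''x''" "?z \<noteq> ''y''" by (simp_all add: fresh_def)
  have "sat ?e (eq (\<sigma> \<leadsto> \<tau>) ?x ?y) \<longleftrightarrow>
    (\<forall>a. sat (?e((?z, \<sigma>) := a)) (eq \<tau> (?x \<cdot> Var ?z \<sigma>) (?y \<cdot> Var ?z \<sigma>)))"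
    by (simp add: Let_def)
  also have "\<dots>" using assms z by (subst sat_eq) auto
  finally show ?thesis by (subst (asm) sat_eq) auto
qed

lemma std_closed: "wft (dom \<D>) t \<Longrightarrow> fvt t = {} \<Longrightarrow> std (tyof t) (eval e t)"
  using axiom_st[OF st_closed, of t e] by simp

lemma std_ap [intro]: "std (\<sigma> \<leadsto> \<tau>) f \<Longrightarrow> std \<sigma> a \<Longrightarrow> std \<tau> (ap \<sigma> \<tau> f a)"
  using axiom_st[OF st_app[OF refl refl, of \<sigma> \<tau>], of "e0((''f'', \<sigma> \<leadsto> \<tau>) := f, (''x'', \<sigma>) := a)"]
  by simp

lemma std_ci: "(\<And>i \<tau>. c \<noteq> Xi i \<tau>) \<Longrightarrow> std (ty_con c) (ci c)"
  using std_closed[of "Con c" e0] by (auto split: con.splits)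

lemma std_con [simp]:
  "std Nt (ci Zero)" "std T1 (ci Succ)" "std (Nt \<leadsto> Nt \<leadsto> (Nt \<leadsto> Nt \<leadsto> Nt) \<leadsto> Nt) (ci Rec)"
  "std (\<rho> \<leadsto> \<tau> \<leadsto> \<rho>) (ci (Kc \<rho> \<tau>))"
  "std ((\<delta> \<leadsto> \<rho> \<leadsto> \<tau>) \<leadsto> (\<delta> \<leadsto> \<rho>) \<leadsto> \<delta> \<leadsto> \<tau>) (ci (Sc \<delta> \<rho> \<tau>))"
  "std (Seq \<sigma> \<leadsto> Nt) (ci (Len \<sigma>))" "std (Seq \<sigma> \<leadsto> Nt \<leadsto> \<sigma>) (ci (Nth \<sigma>))"
  using std_ci[of Zero] std_ci[of Succ] std_ci[of Rec] std_ci[of "Kc \<rho> \<tau>"] std_ci[of "Sc \<delta> \<rho> \<tau>"]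
    std_ci[of "Len \<sigma>"] std_ci[of "Nth \<sigma>"]
  by auto


subsection \<open>Representable operations\<close>

text \<open>The arguments of a representable operation form a list whose head is the innermost bound
  variable.  With the flag b the representing object is required to be standard.\<close>

fun cty :: "ty list \<Rightarrow> ty \<Rightarrow> ty" where
  "cty [] \<tau> = \<tau>" | "cty (\<sigma> # \<Gamma>) \<tau> = cty \<Gamma> (\<sigma> \<leadsto> \<tau>)"

fun apl :: "ty list \<Rightarrow> ty \<Rightarrow> 'u \<Rightarrow> 'u list \<Rightarrow> 'u" where
  "apl [] \<tau> g xs = g" | "apl (\<sigma> # \<Gamma>) \<tau> g xs = ap \<sigma> \<tau> (apl \<Gamma> (\<sigma> \<leadsto> \<tau>) g (tl xs)) (hd xs)"

definition rep :: "bool \<Rightarrow> ty list \<Rightarrow> ty \<Rightarrow> ('u list \<Rightarrow> 'u) \<Rightarrow> bool" where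
  "rep b \<Gamma> \<tau> F \<longleftrightarrow> (\<exists>g. (b \<longrightarrow> std (cty \<Gamma> \<tau>) g) \<and> (\<forall>xs. apl \<Gamma> \<tau> g xs = F xs))"

lemma rep_Cons:
  assumes "rep b \<Gamma> (\<sigma> \<leadsto> \<tau>) G" "\<And>xs. ap \<sigma> \<tau> (G (tl xs)) (hd xs) = F xs"
  shows "rep b (\<sigma> # \<Gamma>) \<tau> F"
proof -
  obtain g where "b \<longrightarrow> std (cty \<Gamma> (\<sigma> \<leadsto> \<tau>)) g" "\<And>xs. apl \<Gamma> (\<sigma> \<leadsto> \<tau>) g xs = G xs"
    using assms(1) unfolding rep_def by blast
  then show ?thesis using assms(2) unfolding rep_def by (intro exI[of _ g]) simp
qed

lemma rep_const: "(b \<Longrightarrow> std \<tau> c) \<Longrightarrow> rep b \<Gamma> \<tau> (\<lambda>_. c)"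
proof (induction \<Gamma> arbitrary: \<tau> c)
  case Nil
  then show ?case by (auto simp: rep_def)
next
  case (Cons \<sigma> \<Gamma>)
  then have "rep b \<Gamma> (\<sigma> \<leadsto> \<tau>) (\<lambda>_. ap \<tau> (\<sigma> \<leadsto> \<tau>) (ci (Kc \<tau> \<sigma>)) c)"
    by (intro Cons.IH std_ap std_con)
  then show ?case by (rule rep_Cons) (rule K)
qed

text \<open>Combinatory completeness inside the model: constants, the innermost variable and
  application are handled by \<open>K\<close>, by \<open>S K K\<close> and by \<open>S\<close>. Both
  combinators are standard, so the flag is preserved.\<close>

lemma rep_app [rep_intros]:
  "rep b \<Gamma> (\<sigma> \<leadsto> \<tau>) F \<Longrightarrow> rep b \<Gamma> \<sigma> G \<Longrightarrow> rep b \<Gamma> \<tau> (\<lambda>xs. ap \<sigma> \<tau> (F xs) (G xs))"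
proof (induction \<Gamma> arbitrary: F G \<sigma> \<tau>)
  case Nil
  then show ?case by (auto simp: rep_def)
next
  case (Cons \<rho> \<Gamma>)
  then obtain g h where g: "b \<longrightarrow> std (cty (\<rho> # \<Gamma>) (\<sigma> \<leadsto> \<tau>)) g" "\<And>xs. apl (\<rho> # \<Gamma>) (\<sigma> \<leadsto> \<tau>) g xs = F xs"
    and h: "b \<longrightarrow> std (cty (\<rho> # \<Gamma>) \<sigma>) h" "\<And>xs. apl (\<rho> # \<Gamma>) \<sigma> h xs = G xs"
    unfolding rep_def by blast
  have "rep b \<Gamma> (\<rho> \<leadsto> \<sigma> \<leadsto> \<tau>) (apl \<Gamma> (\<rho> \<leadsto> \<sigma> \<leadsto> \<tau>) g)" "rep b \<Gamma> (\<rho> \<leadsto> \<sigma>) (apl \<Gamma> (\<rho> \<leadsto> \<sigma>) h)"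
    using g h unfolding rep_def by auto
  then have "rep b \<Gamma> (\<rho> \<leadsto> \<tau>) (\<lambda>xs. ap (\<rho> \<leadsto> \<sigma>) (\<rho> \<leadsto> \<tau>)
     (ap (\<rho> \<leadsto> \<sigma> \<leadsto> \<tau>) ((\<rho> \<leadsto> \<sigma>) \<leadsto> \<rho> \<leadsto> \<tau>) (ci (Sc \<rho> \<sigma> \<tau>)) (apl \<Gamma> (\<rho> \<leadsto> \<sigma> \<leadsto> \<tau>) g xs))
     (apl \<Gamma> (\<rho> \<leadsto> \<sigma>) h xs))"
    by (intro Cons.IH rep_const std_con)
  then obtain k where k: "b \<longrightarrow> std (cty \<Gamma> (\<rho> \<leadsto> \<tau>)) k" "\<And>xs. apl \<Gamma> (\<rho> \<leadsto> \<tau>) k xs =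
     ap (\<rho> \<leadsto> \<sigma>) (\<rho> \<leadsto> \<tau>)
     (ap (\<rho> \<leadsto> \<sigma> \<leadsto> \<tau>) ((\<rho> \<leadsto> \<sigma>) \<leadsto> \<rho> \<leadsto> \<tau>) (ci (Sc \<rho> \<sigma> \<tau>)) (apl \<Gamma> (\<rho> \<leadsto> \<sigma> \<leadsto> \<tau>) g xs))
     (apl \<Gamma> (\<rho> \<leadsto> \<sigma>) h xs)" unfolding rep_def by blast
  then have "apl (\<rho> # \<Gamma>) \<tau> k xs = ap \<sigma> \<tau> (F xs) (G xs)" for xs
    by (simp add: S g(2)[symmetric] h(2)[symmetric])
  then show ?case using k(1) unfolding rep_def by auto
qed

lemma rep_hd: "rep b (\<sigma> # \<Gamma>) \<sigma> hd"
proof -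
  have "rep b \<Gamma> (\<sigma> \<leadsto> \<sigma>) (\<lambda>xs. ap (\<sigma> \<leadsto> \<sigma> \<leadsto> \<sigma>) (\<sigma> \<leadsto> \<sigma>) (ap (\<sigma> \<leadsto> (\<sigma> \<leadsto> \<sigma>) \<leadsto> \<sigma>) ((\<sigma> \<leadsto> (\<sigma> \<leadsto> \<sigma>)) \<leadsto> \<sigma> \<leadsto> \<sigma>)
    (ci (Sc \<sigma> (\<sigma> \<leadsto> \<sigma>) \<sigma>)) (ci (Kc \<sigma> (\<sigma> \<leadsto> \<sigma>)))) (ci (Kc \<sigma> \<sigma>)))"
    by (intro rep_const std_ap std_con)
  then show ?thesis by (rule rep_Cons) (simp add: S K)
qed

lemma rep_tl: assumes "rep b \<Gamma> \<tau> F" shows "rep b (\<sigma> # \<Gamma>) \<tau> (\<lambda>xs. F (tl xs))"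
proof -
  have "rep b \<Gamma> (\<sigma> \<leadsto> \<tau>) (\<lambda>xs. ap \<tau> (\<sigma> \<leadsto> \<tau>) (ci (Kc \<tau> \<sigma>)) (F xs))"
    using assms by (intro rep_app rep_const std_con)
  then show ?thesis by (rule rep_Cons) (rule K)
qed

lemmas rep_vars = rep_hd rep_tl[OF rep_hd] rep_tl[OF rep_tl[OF rep_hd]]
  rep_tl[OF rep_tl[OF rep_tl[OF rep_hd]]] rep_tl[OF rep_tl[OF rep_tl[OF rep_tl[OF rep_hd]]]]
  rep_tl[OF rep_tl[OF rep_tl[OF rep_tl[OF rep_tl[OF rep_hd]]]]]
  rep_tl[OF rep_tl[OF rep_tl[OF rep_tl[OF rep_tl[OF rep_tl[OF rep_hd]]]]]]
declare rep_vars [rep_intros]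

text \<open>The object representing \<open>F\<close>, unique by \<open>ext\<close>. It has a meaning
  only if \<open>F\<close> is representable, so each computation with it passes through
  \<open>beta\<close> and a representability goal.\<close>

definition Lam :: "ty \<Rightarrow> ty \<Rightarrow> ('u \<Rightarrow> 'u) \<Rightarrow> 'u" where
  "Lam \<sigma> \<tau> F = (THE g. \<forall>a. ap \<sigma> \<tau> g a = F a)"

lemma Lam_eqI: "(\<And>a. ap \<sigma> \<tau> g a = F a) \<Longrightarrow> Lam \<sigma> \<tau> F = g"
  unfolding Lam_def by (rule the_equality) (simp, rule ext[of \<sigma> \<tau>], simp)

lemma beta: assumes "rep b [\<sigma>] \<tau> (\<lambda>xs. F (hd xs))" shows "ap \<sigma> \<tau> (Lam \<sigma> \<tau> F) a = F a"
proof -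
  obtain g where "\<And>xs. ap \<sigma> \<tau> g (hd xs) = F (hd xs)" using assms unfolding rep_def by auto
  then have "ap \<sigma> \<tau> g a = F a" for a by (metis list.sel(1))
  then show ?thesis using Lam_eqI[of \<sigma> \<tau> g F] by simp
qed

lemma rep_Lam [rep_intros]:
  assumes "rep b (\<sigma> # \<Gamma>) \<tau> (\<lambda>xs. F (tl xs) (hd xs))"
  shows "rep b \<Gamma> (\<sigma> \<leadsto> \<tau>) (\<lambda>xs. Lam \<sigma> \<tau> (\<lambda>a. F xs a))"
proof -
  obtain g where g: "b \<longrightarrow> std (cty \<Gamma> (\<sigma> \<leadsto> \<tau>)) g"
    "\<And>xs. ap \<sigma> \<tau> (apl \<Gamma> (\<sigma> \<leadsto> \<tau>) g (tl xs)) (hd xs) = F (tl xs) (hd xs)"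
    using assms unfolding rep_def by auto
  have "apl \<Gamma> (\<sigma> \<leadsto> \<tau>) g xs = Lam \<sigma> \<tau> (\<lambda>a. F xs a)" for xs
    using g(2)[of "_ # xs"] by (intro Lam_eqI[symmetric]) simp
  then show ?thesis using g(1) unfolding rep_def by (intro exI[of _ g]) simp
qed

lemma rep_std: "rep True [] \<tau> (\<lambda>xs. c) \<Longrightarrow> std \<tau> c" by (auto simp: rep_def)

lemma rep_hdD: "rep b [\<sigma>] \<tau> (\<lambda>xs. F (hd xs)) \<Longrightarrow> \<exists>g. \<forall>a. ap \<sigma> \<tau> g a = F a"
  using beta by blast

lemma rep_False_hdI: "(\<And>a. ap \<sigma> \<tau> g a = F a) \<Longrightarrow> rep False [\<sigma>] \<tau> (\<lambda>xs. F (hd xs))"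
  unfolding rep_def by auto

text \<open>The flag drops to \<open>False\<close> because the object put in for the outer variable
  need not be standard.\<close>

lemma rep_fix_last:
  assumes "rep b [\<sigma>, \<rho>] \<tau> (\<lambda>xs. F (hd (tl xs)) (hd xs))"
  shows "rep False [\<sigma>] \<tau> (\<lambda>xs. F a (hd xs))"
proof -
  obtain g where "\<And>xs. ap \<sigma> \<tau> (ap \<rho> (\<sigma> \<leadsto> \<tau>) g (hd (tl xs))) (hd xs) = F (hd (tl xs)) (hd xs)"
    using assms unfolding rep_def by auto
  from this[of "[_, a]"] show ?thesis by (intro rep_False_hdI[of _ _ "ap \<rho> (\<sigma> \<leadsto> \<tau>) g a"]) simp
qed

lemma eval_lam: "wft L t \<Longrightarrow> ap \<sigma> (tyof t) (eval e (lam x \<sigma> t)) a = eval (e((x, \<sigma>) := a)) t"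
proof (induction t)
  case (App s t)
  then obtain \<tau> where \<tau>: "tyof s = tyof t \<leadsto> \<tau>" by auto
  have "wft L s" "wft L t" using App by auto
  then show ?case using App \<tau> tyof_lam by (simp add: S)
qed (auto simp: K S)


subsection \<open>Natural numbers\<close>

abbreviation zr ("\<zero>") where "\<zero> \<equiv> ci Zero"
abbreviation sc where "sc a \<equiv> ap Nt Nt (ci Succ) a"
abbreviation one ("\<one>") where "\<one> \<equiv> sc \<zero>"
abbreviation rc where "rc n a f \<equiv> ap (Nt \<leadsto> Nt \<leadsto> Nt) Nt (ap Nt ((Nt \<leadsto> Nt \<leadsto> Nt) \<leadsto> Nt)
   (ap Nt (Nt \<leadsto> (Nt \<leadsto> Nt \<leadsto> Nt) \<leadsto> Nt) (ci Rec) n) a) f"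

lemma sc_zero [simp]: "sc a \<noteq> \<zero>" "\<zero> \<noteq> sc a"
  using axiom[OF suc_not_zero, of "e0((''x'', Nt) := a)"] by auto
lemma sc_inj [simp]: "sc a = sc b \<longleftrightarrow> a = b"
  using axiom[OF suc_inj, of "e0((''x'', Nt) := a, (''y'', Nt) := b)"] by auto

lemma rc_zero [simp]: "rc \<zero> a f = a"
  using axiom[OF rec_zero[OF refl refl], of "e0((''y'', Nt) := a, (''z'', Nt \<leadsto> Nt \<leadsto> Nt) := f)"]
  by simp
lemma rc_sc [simp]: "rc (sc n) a f = ap Nt Nt (ap Nt (Nt \<leadsto> Nt) f (rc n a f)) n"
  using axiom[OF rec_suc[OF refl refl refl],
    of "e0((''x'', Nt) := n, (''y'', Nt) := a, (''z'', Nt \<leadsto> Nt \<leadsto> Nt) := f)"]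
  by simp

definition rcf :: "'u \<Rightarrow> 'u \<Rightarrow> ('u \<Rightarrow> 'u \<Rightarrow> 'u) \<Rightarrow> 'u" where
  "rcf n a F = rc n a (Lam Nt (Nt \<leadsto> Nt) (\<lambda>r. Lam Nt Nt (\<lambda>m. F r m)))"

lemma rep_rcf [rep_intros]:
  assumes "rep b \<Gamma> Nt N" "rep b \<Gamma> Nt A" "rep b (Nt # Nt # \<Gamma>) Nt (\<lambda>xs. F (tl (tl xs)) (hd (tl xs)) (hd xs))"
  shows "rep b \<Gamma> Nt (\<lambda>xs. rcf (N xs) (A xs) (\<lambda>r m. F xs r m))"
  unfolding rcf_def by (intro rep_intros rep_const std_con assms)

lemma rcf_zero [simp]: "rcf \<zero> a F = a" by (simp add: rcf_def)

lemma rcf_sc: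
  assumes "rep b [Nt, Nt] Nt (\<lambda>xs. F (hd (tl xs)) (hd xs))"
  shows "rcf (sc n) a F = F (rcf n a F) n"
  unfolding rcf_def rc_sc
  by (subst beta[of b], intro rep_intros assms, subst beta[OF rep_fix_last[OF assms]], rule refl)

end

context model
begin

lemma eval_lam': "wft (dom \<D>) t \<Longrightarrow> tyof t = \<tau> \<Longrightarrow>
    ap \<sigma> \<tau> (eval e (lam x \<sigma> t)) a = eval (e((x, \<sigma>) := a)) t"
  using eval_lam by blast

definition "PLUS = eval e0 plus_c"
definition "PRED = eval e0 pred_c"
definition "MONUS = eval e0 monus_c"
definition "TRI = eval e0 tri_c"
definition "PAIR = eval e0 pair_c"
definition "SEG = eval e0 seg_c"

lemma eval_consts [simp]:
  "eval e plus_c = PLUS" "eval e pred_c = PRED" "eval e monus_c = MONUS" "eval e tri_c = TRI"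
  "eval e pair_c = PAIR" "eval e seg_c = SEG"
  unfolding PLUS_def PRED_def MONUS_def TRI_def PAIR_def SEG_def by (rule eval_closed, simp)+

lemma std_consts [simp]:
  "std (Nt \<leadsto> T1) PLUS" "std T1 PRED" "std (Nt \<leadsto> T1) MONUS" "std T1 TRI"
  "std (Nt \<leadsto> T1) PAIR" "std (T1 \<leadsto> T1) SEG"
  using std_closed[of plus_c] std_closed[of pred_c] std_closed[of monus_c] std_closed[of tri_c]
    std_closed[of pair_c] std_closed[of seg_c] by simp_all

abbreviation app1 (infixl "\<bullet>" 75) where "f \<bullet> n \<equiv> ap Nt Nt f n"
abbreviation app2 (infixl "\<star>" 75) where "F \<star> f \<equiv> ap T1 Nt F f"
abbreviation pd where "pd a \<equiv> PRED \<bullet> a"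
abbreviation padd (infixl "\<oplus>" 65) where "a \<oplus> b \<equiv> ap Nt T1 PLUS a \<bullet> b"
abbreviation pminus (infixl "\<ominus>" 65) where "a \<ominus> b \<equiv> ap Nt T1 MONUS a \<bullet> b"
abbreviation tri where "tri a \<equiv> TRI \<bullet> a"
abbreviation pr where "pr a b \<equiv> ap Nt T1 PAIR a \<bullet> b"
abbreviation sg where "sg h k \<equiv> ap T1 T1 SEG h \<bullet> k"
abbreviation leq (infix "\<preceq>" 50) where "a \<preceq> b \<equiv> a \<ominus> b = \<zero>"
abbreviation less (infix "\<prec>" 50) where "a \<prec> b \<equiv> sc a \<preceq> b"

lemmas lamsimps = eval_lam' tyof_lam[of "dom \<D>"] wft_lam

lemma pd_simps [simp]: "pd \<zero> = \<zero>" "pd (sc n) = n"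
  unfolding PRED_def pred_c_def by (simp_all add: lamsimps eval_upd_fresh fvt_lam del: lam.simps)
lemma padd_simps [simp]: "a \<oplus> \<zero> = a" "a \<oplus> sc b = sc (a \<oplus> b)"
  unfolding PLUS_def plus_c_def by (simp_all add: lamsimps eval_upd_fresh fvt_lam del: lam.simps)
lemma pminus_zero [simp]: "a \<ominus> \<zero> = a" and pminus_sc: "a \<ominus> sc b = pd (a \<ominus> b)"
  unfolding MONUS_def monus_c_def by (simp_all add: lamsimps eval_upd_fresh fvt_lam del: lam.simps)
lemma tri_simps [simp]: "tri \<zero> = \<zero>" "tri (sc n) = sc (tri n \<oplus> n)"
  unfolding TRI_def tri_c_def plus_def by (simp_all add: lamsimps eval_upd_fresh fvt_lam del: lam.simps)
lemma pr_eq: "pr a b = tri (a \<oplus> b) \<oplus> b"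
  unfolding PAIR_def pair_c_def plus_def by (simp add: lamsimps del: lam.simps)
lemma sg_simps [simp]: "sg h \<zero> = \<zero>" "sg h (sc k) = sc (pr (sg h k) (h \<bullet> k))"
  unfolding SEG_def seg_c_def by (simp_all add: lamsimps eval_upd_fresh fvt_lam del: lam.simps)

text \<open>\<open>PF-TP\<close> for \<open>Neg A\<close>, read contrapositively: what exists at all
  has a standard instance, provided that \<open>A\<close> has no further parameters.\<close>

lemma transfer:
  assumes "wff (dom \<D>) A" "internal A" "gdf A" "gd x" "fv A \<subseteq> {(x, \<tau>)}"
    and "sat (e((x, \<tau>) := a)) A"
  shows "\<exists>a. std \<tau> a \<and> sat (e0((x, \<tau>) := a)) A"
proof -
  have "sat e0 (Imp (All_st x \<tau> (Neg A)) (All x \<tau> (Neg A)))"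
    using assms by (intro axiom_st pf_tp) (auto simp: Neg_def)
  moreover have "sat (e0((x, \<tau>) := a)) A = sat (e((x, \<tau>) := a)) A"
    by (rule sat_cong) (use assms in auto)
  ultimately show ?thesis using assms by auto
qed

section \<open>Decidable predicates and quantifier-free induction\<close>

definition decp :: "bool \<Rightarrow> ty list \<Rightarrow> ('u list \<Rightarrow> bool) \<Rightarrow> bool" where
  "decp b \<Gamma> P \<longleftrightarrow> rep b \<Gamma> Nt (\<lambda>xs. if P xs then \<zero> else \<one>)"

lemma rep_if [rep_intros]:
  assumes "decp b \<Gamma> P" "rep b \<Gamma> Nt F" "rep b \<Gamma> Nt G"
  shows "rep b \<Gamma> Nt (\<lambda>xs. if P xs then F xs else G xs)"
proof -
  have "rcf \<one> a (\<lambda>r m. c) = c" for a c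
    using rcf_sc[of False "\<lambda>r m. c" \<zero> a] by (simp add: rep_const)
  then have "(if P xs then F xs else G xs) = rcf (if P xs then \<zero> else \<one>) (F xs) (\<lambda>r m. G xs)" for xs
    by simp
  moreover have "rep b \<Gamma> Nt (\<lambda>xs. rcf (if P xs then \<zero> else \<one>) (F xs) (\<lambda>r m. G xs))"
    using assms unfolding decp_def by (intro rep_rcf rep_tl)
  ultimately show ?thesis by simp
qed

lemma std_one [simp]: "std Nt \<one>" by (intro std_ap std_con)

lemma decp_not [rep_intros]: assumes "decp b \<Gamma> P" shows "decp b \<Gamma> (\<lambda>xs. \<not> P xs)"
proof -
  have "rep b \<Gamma> Nt (\<lambda>xs. if P xs then \<one> else \<zero>)"
    using assms by (intro rep_if rep_const) simp_all
  moreover have "(if \<not> P xs then \<zero> else \<one>) = (if P xs then \<one> else \<zero>)" for xs by simp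
  ultimately show ?thesis unfolding decp_def by simp
qed

lemma decp_conj [rep_intros]:
  assumes "decp b \<Gamma> P" "decp b \<Gamma> Q" shows "decp b \<Gamma> (\<lambda>xs. P xs \<and> Q xs)"
proof -
  have "rep b \<Gamma> Nt (\<lambda>xs. if P xs then if Q xs then \<zero> else \<one> else \<one>)"
    using assms by (intro rep_if rep_const) simp_all
  moreover have "(if P xs \<and> Q xs then \<zero> else \<one>) = (if P xs then if Q xs then \<zero> else \<one> else \<one>)" for xs
    by simp
  ultimately show ?thesis unfolding decp_def by simp
qed

lemma decp_disj [rep_intros]:
  assumes "decp b \<Gamma> P" "decp b \<Gamma> Q" shows "decp b \<Gamma> (\<lambda>xs. P xs \<or> Q xs)"
  using decp_not[OF decp_conj[OF decp_not[OF assms(1)] decp_not[OF assms(2)]]] by simp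

lemma decp_imp [rep_intros]:
  assumes "decp b \<Gamma> P" "decp b \<Gamma> Q" shows "decp b \<Gamma> (\<lambda>xs. P xs \<longrightarrow> Q xs)"
  using decp_not[OF decp_conj[OF assms(1) decp_not[OF assms(2)]]] by simp

text \<open>Induction needs decidable predicates, so equality has to be decided before any
  arithmetic has been proved. Choice is available for arguments of type 1 only; hence the two
  numbers are packed into a function with the values \<open>a\<close> at 0 and \<open>b\<close> at
  1, and choice supplies a functional comparing these values. The specification of the resulting
  object has no parameters, so \<open>transfer\<close> provides a standard one, as needed for the
  flag in \<open>decp_eq\<close>.\<close>

lemma equality_decidable:
  "\<exists>d. std (Nt \<leadsto> T1) d \<and> (\<forall>a b. ap Nt T1 d a \<bullet> b = (if a = b then \<zero> else \<one>))"
proof -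
  let ?f = "Var ''f'' T1" and ?y = "Var ''y'' Nt"
  let ?E = "Eq (?f \<cdot> zero) (?f \<cdot> suc zero)"
  let ?A = "And (Imp ?E (Eq ?y zero)) (Imp (Neg ?E) (Eq ?y (suc zero)))"
  have "sat e0 (Imp (All ''f'' T1 (Ex ''y'' Nt ?A))
     (Ex ''F'' T2 (All ''f'' T1 (sb (''y'', Nt) (Var ''F'' T2 \<cdot> Var ''f'' T1) ?A))))"
    by (intro axiom qf_ac_1_0 QF_AC.intros) (auto simp: And_def Neg_def Ex_def)
  then obtain F where "\<forall>f. (f \<bullet> \<zero> = f \<bullet> \<one> \<longrightarrow> F \<star> f = \<zero>) \<and> (f \<bullet> \<zero> = f \<bullet> \<one> \<or> F \<star> f = \<one>)"
    by (auto simp: And_def Neg_def)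
  then have F: "F \<star> f = (if f \<bullet> \<zero> = f \<bullet> \<one> then \<zero> else \<one>)" for f by auto
  define u where "u a b = Lam Nt Nt (\<lambda>i. rcf i a (\<lambda>r m. b))" for a b
  have "u a b \<bullet> i = rcf i a (\<lambda>r m. b)" for a b i
    unfolding u_def by (subst beta[of False]) ((intro rep_intros rep_const; simp), simp)
  then have u: "u a b \<bullet> \<zero> = a" "u a b \<bullet> \<one> = b" for a b
    using rcf_sc[of False "\<lambda>r m. b" \<zero> a] by (simp_all add: rep_const)
  have r: "rep False [Nt, Nt] Nt (\<lambda>xs. F \<star> u (hd (tl xs)) (hd xs))"
    unfolding u_def by (intro rep_intros rep_const; simp)
  define d where "d = Lam Nt T1 (\<lambda>a. Lam Nt Nt (\<lambda>b. F \<star> u a b))"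
  have "ap Nt T1 d a = Lam Nt Nt (\<lambda>b. F \<star> u a b)" for a
    unfolding d_def by (subst beta[of False]) (rule rep_Lam, rule r, rule refl)
  then have "ap Nt T1 d a \<bullet> b = F \<star> u a b" for a b
    using beta[OF rep_fix_last[OF r]] by simp
  then have d: "ap Nt T1 d a \<bullet> b = (if a = b then \<zero> else \<one>)" for a b
    using F u by simp
  let ?a = "Var ''a'' Nt" and ?b = "Var ''b'' Nt" and ?d = "Var ''d'' (Nt \<leadsto> T1)"
  have "\<exists>d. std (Nt \<leadsto> T1) d \<and> sat (e0((''d'', Nt \<leadsto> T1) := d))
    (All ''a'' Nt (All ''b'' Nt (And (Imp (Eq ?a ?b) (Eq (?d \<cdot> ?a \<cdot> ?b) zero))
       (Imp (Neg (Eq ?a ?b)) (Eq (?d \<cdot> ?a \<cdot> ?b) (suc zero))))))"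
    by (rule transfer[where e = e0 and a = d]) (auto simp: d And_def Neg_def)
  then show ?thesis by (auto split: if_splits)
qed

lemma decp_eq [rep_intros]:
  assumes "rep b \<Gamma> Nt F" "rep b \<Gamma> Nt G" shows "decp b \<Gamma> (\<lambda>xs. F xs = G xs)"
proof -
  obtain d where d: "std (Nt \<leadsto> T1) d" "\<And>a b. ap Nt T1 d a \<bullet> b = (if a = b then \<zero> else \<one>)"
    using equality_decidable by blast
  have "rep b \<Gamma> Nt (\<lambda>xs. ap Nt T1 d (F xs) \<bullet> G xs)"
    using d assms by (intro rep_app rep_const)
  then show ?thesis unfolding decp_def using d by simp
qed

text \<open>The axiom is applied to the equation \<open>g n = 0\<close> for the characteristic
  function \<open>g\<close> of the predicate. Inductions over the possibly nonstandard numbers of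
  the model go through this lemma.\<close>

lemma ind:
  assumes "decp False [Nt] (\<lambda>xs. P (hd xs))" "P \<zero>" "\<And>n. P n \<Longrightarrow> P (sc n)"
  shows "P n"
proof -
  obtain g where g: "\<And>n. g \<bullet> n = (if P n then \<zero> else \<one>)"
    using assms(1) rep_hdD[of False Nt Nt "\<lambda>n. if P n then \<zero> else \<one>"] unfolding decp_def by auto
  let ?A = "Eq (Var ''g'' T1 \<cdot> Var ''x'' Nt) zero"
  have "sat (e0((''g'', T1) := g)) (Imp (sb (''x'', Nt) zero ?A)
     (Imp (All ''x'' Nt (Imp ?A (sb (''x'', Nt) (suc (Var ''x'' Nt)) ?A))) (All ''x'' Nt ?A)))"
    by (intro axiom qf_ind) auto
  then have *: "g \<bullet> \<zero> = \<zero> \<Longrightarrow> \<forall>n. g \<bullet> n = \<zero> \<longrightarrow> g \<bullet> (sc n) = \<zero> \<Longrightarrow> g \<bullet> n = \<zero>" for n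
    by simp
  have P: "g \<bullet> n = \<zero> \<longleftrightarrow> P n" for n using g by simp
  show ?thesis using *[of n] assms(2,3) unfolding P by blast
qed

lemma qf_ac_1_0:
  assumes "decp False [Nt, T1] (\<lambda>xs. P (hd (tl xs)) (hd xs))" "\<And>f. \<exists>x. P f x"
  shows "\<exists>F. \<forall>f. P f (F \<star> f)"
proof -
  obtain G where "\<And>xs. ap T1 T1 G (hd (tl xs)) \<bullet> hd xs = (if P (hd (tl xs)) (hd xs) then \<zero> else \<one>)"
    using assms(1) unfolding decp_def rep_def by auto
  from this[of "[_, _]"] have G: "ap T1 T1 G f \<bullet> x = (if P f x then \<zero> else \<one>)" for f x by simp
  let ?A = "Eq (Var ''G'' (T1 \<leadsto> T1) \<cdot> Var ''f'' T1 \<cdot> Var ''y'' Nt) zero"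
  have "sat (e0((''G'', T1 \<leadsto> T1) := G)) (Imp (All ''f'' T1 (Ex ''y'' Nt ?A))
     (Ex ''F'' T2 (All ''f'' T1 (sb (''y'', Nt) (Var ''F'' T2 \<cdot> Var ''f'' T1) ?A))))"
    by (intro axiom RCA0_omega.qf_ac_1_0 QF_AC.intros) (auto simp: Ex_def Neg_def)
  then have *: "\<forall>f. \<exists>x. ap T1 T1 G f \<bullet> x = \<zero> \<Longrightarrow> \<exists>F. \<forall>f. ap T1 T1 G f \<bullet> (F \<star> f) = \<zero>"
    by simp
  have "ap T1 T1 G f \<bullet> x = \<zero> \<longleftrightarrow> P f x" for f x using G by simp
  then show ?thesis using * assms(2) by simp
qed


subsection \<open>Addition and order\<close>

lemma nat_cases: "n = \<zero> \<or> n = sc (pd n)"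
  by (rule ind[of "\<lambda>n. n = \<zero> \<or> n = sc (pd n)"], (intro rep_intros rep_const; simp), simp_all)

lemma nat_cases': obtains "n = \<zero>" | m where "n = sc m" using nat_cases by blast

lemma zero_padd [simp]: "\<zero> \<oplus> a = a"
  by (rule ind[of "\<lambda>a. \<zero> \<oplus> a = a"], (intro rep_intros rep_const; simp), simp_all)
lemma sc_padd [simp]: "sc a \<oplus> b = sc (a \<oplus> b)"
  by (rule ind[of "\<lambda>b. sc a \<oplus> b = sc (a \<oplus> b)"], (intro rep_intros rep_const; simp), simp_all)
lemma padd_comm: "a \<oplus> b = b \<oplus> a"
  by (rule ind[of "\<lambda>b. a \<oplus> b = b \<oplus> a"], (intro rep_intros rep_const; simp), simp_all)
lemma padd_assoc: "a \<oplus> b \<oplus> c = a \<oplus> (b \<oplus> c)"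
  by (rule ind[of "\<lambda>c. a \<oplus> b \<oplus> c = a \<oplus> (b \<oplus> c)"], (intro rep_intros rep_const; simp), simp_all)
lemma padd_cancel [simp]: "a \<oplus> c = b \<oplus> c \<longleftrightarrow> a = b"
proof -
  have "a \<oplus> c = b \<oplus> c \<longrightarrow> a = b"
    by (rule ind[of "\<lambda>c. a \<oplus> c = b \<oplus> c \<longrightarrow> a = b"], (intro rep_intros rep_const; simp), simp_all)
  then show ?thesis by blast
qed
lemma padd_cancel_left [simp]: "c \<oplus> a = c \<oplus> b \<longleftrightarrow> a = b"
  by (simp add: padd_comm[of c])

lemma zero_pminus [simp]: "\<zero> \<ominus> b = \<zero>"
  by (rule ind[of "\<lambda>b. \<zero> \<ominus> b = \<zero>"], (intro rep_intros rep_const; simp), simp_all add: pminus_sc)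
lemma sc_pminus_sc: "sc a \<ominus> sc b = a \<ominus> b"
  by (rule ind[of "\<lambda>b. sc a \<ominus> sc b = a \<ominus> b"], (intro rep_intros rep_const; simp), simp_all add: pminus_sc)
lemma pd_pminus: "pd a \<ominus> b = pd (a \<ominus> b)"
  by (rule ind[of "\<lambda>b. pd a \<ominus> b = pd (a \<ominus> b)"], (intro rep_intros rep_const; simp), simp_all add: pminus_sc)
lemma pminus_same [simp]: "a \<ominus> a = \<zero>"
  by (rule ind[of "\<lambda>a. a \<ominus> a = \<zero>"], (intro rep_intros rep_const; simp), simp,
      simp only: sc_pminus_sc)
lemma padd_pminus [simp]: "a \<oplus> b \<ominus> b = a"
  by (rule ind[of "\<lambda>b. a \<oplus> b \<ominus> b = a"], (intro rep_intros rep_const; simp), simp,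
      simp only: padd_simps sc_pminus_sc)
lemma padd_pminus' [simp]: "b \<oplus> a \<ominus> b = a" using padd_pminus[of a b] by (simp only: padd_comm)
lemma leq_padd [simp]: "a \<preceq> a \<oplus> c"
proof -
  have "a \<preceq> c \<oplus> a"
    by (rule ind[of "\<lambda>a. a \<preceq> c \<oplus> a"], (intro rep_intros rep_const; simp), simp,
        simp only: padd_simps sc_pminus_sc)
  then show ?thesis by (simp only: padd_comm)
qed
lemma leq_padd' [simp]: "a \<preceq> c \<oplus> a" using leq_padd[of a c] by (simp only: padd_comm)

text \<open>The order is vanishing truncated subtraction. The induction on \<open>a\<close> carries
  the explicit witness \<open>b \<ominus> a\<close>, since a predicate with an unbounded existential
  quantifier would not be known to be decidable at this point.\<close>

lemma leq_iff: "a \<preceq> b \<longleftrightarrow> (\<exists>c. b = a \<oplus> c)"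
proof
  have step: "sc n \<preceq> b \<longrightarrow> b = sc n \<oplus> (b \<ominus> sc n)" if "n \<preceq> b \<longrightarrow> b = n \<oplus> (b \<ominus> n)" for n
  proof
    assume *: "sc n \<preceq> b"
    then have "n \<preceq> b" using pd_pminus[of "sc n" b] by simp
    then have b: "b = n \<oplus> (b \<ominus> n)" using that by blast
    have "b \<ominus> n \<noteq> \<zero>"
    proof
      assume "b \<ominus> n = \<zero>"
      then have "b = n" using b by simp
      then show False using * padd_pminus[of "\<one>" n] by simp
    qed
    then have "b \<ominus> n = sc (pd (b \<ominus> n))" using nat_cases by blast
    then have "n \<oplus> (b \<ominus> n) = sc n \<oplus> pd (b \<ominus> n)" by (metis padd_simps(2) sc_padd)
    then show "b = sc n \<oplus> (b \<ominus> sc n)" using b by (simp add: pminus_sc)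
  qed
  have "a \<preceq> b \<longrightarrow> b = a \<oplus> (b \<ominus> a)"
    by (rule ind[of "\<lambda>a. a \<preceq> b \<longrightarrow> b = a \<oplus> (b \<ominus> a)"], (intro rep_intros rep_const; simp), simp,
        rule step)
  then show "a \<preceq> b \<Longrightarrow> \<exists>c. b = a \<oplus> c" by blast
qed auto

lemma leq_trans: assumes "a \<preceq> b" "b \<preceq> c" shows "a \<preceq> c"
proof -
  obtain x y where "b = a \<oplus> x" "c = b \<oplus> y" using assms leq_iff by blast
  then have "c = a \<oplus> (x \<oplus> y)" by (simp only: padd_assoc)
  then show ?thesis using leq_iff by blast
qed
lemma padd_eq_self: "a \<oplus> c = a \<longleftrightarrow> c = \<zero>" using padd_cancel_left[of a c \<zero>] by simp
lemma less_irrefl: "\<not> a \<prec> a"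
proof
  assume "a \<prec> a"
  then obtain c where "a = sc a \<oplus> c" using leq_iff by blast
  then have "a \<oplus> sc c = a" by simp
  then show False by (simp only: padd_eq_self sc_zero)
qed
lemma leq_less: "a \<preceq> b \<longleftrightarrow> a = b \<or> a \<prec> b"
proof
  assume "a \<preceq> b"
  then obtain c where c: "b = a \<oplus> c" using leq_iff by blast
  show "a = b \<or> a \<prec> b"
  proof (cases c rule: nat_cases')
    case 1
    then show ?thesis using c by simp
  next
    case (2 m)
    then have "b = sc a \<oplus> m" using c by simp
    then show ?thesis using leq_iff by blast
  qed
next
  assume "a = b \<or> a \<prec> b"
  moreover have "a \<preceq> sc a" using leq_padd'[of a \<one>] by simp
  ultimately show "a \<preceq> b" using leq_trans[of a "sc a" b] by auto
qed
lemma less_sc: "a \<prec> sc b \<longleftrightarrow> a \<prec> b \<or> a = b"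
  unfolding sc_pminus_sc using leq_less by blast
lemma leq_antisym: "a \<preceq> b \<Longrightarrow> b \<preceq> a \<Longrightarrow> a = b"
  using leq_less less_irrefl leq_trans by blast
lemma not_less_zero [simp]: "\<not> a \<prec> \<zero>" using leq_iff[of "sc a" \<zero>] by auto
lemma leq_sc: "a \<preceq> b \<Longrightarrow> a \<preceq> sc b"
  using leq_trans[of a b "sc b"] leq_padd'[of b \<one>] by simp

lemma decp_fun:
  assumes "decp b (\<sigma> # \<Gamma>) (\<lambda>xs. P (tl xs) (hd xs))"
  obtains p where "rep b \<Gamma> (\<sigma> \<leadsto> Nt) p" "\<And>xs m. ap \<sigma> Nt (p xs) m = (if P xs m then \<zero> else \<one>)"
proof -
  obtain g where g: "b \<longrightarrow> std (cty \<Gamma> (\<sigma> \<leadsto> Nt)) g"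
    "\<And>xs. ap \<sigma> Nt (apl \<Gamma> (\<sigma> \<leadsto> Nt) g (tl xs)) (hd xs) = (if P (tl xs) (hd xs) then \<zero> else \<one>)"
    using assms unfolding decp_def rep_def by auto
  show ?thesis
  proof
    show "rep b \<Gamma> (\<sigma> \<leadsto> Nt) (apl \<Gamma> (\<sigma> \<leadsto> Nt) g)" using g(1) unfolding rep_def by blast
    show "ap \<sigma> Nt (apl \<Gamma> (\<sigma> \<leadsto> Nt) g xs) m = (if P xs m then \<zero> else \<one>)" for xs m
      using g(2)[of "m # xs"] by simp
  qed
qed

definition bnd where "bnd p n = rcf n \<zero> (\<lambda>r m. if p \<bullet> m = \<zero> then r else \<one>)"

lemma rep_bnd [rep_intros]: "rep b \<Gamma> T1 F \<Longrightarrow> rep b \<Gamma> Nt N \<Longrightarrow> rep b \<Gamma> Nt (\<lambda>xs. bnd (F xs) (N xs))"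
  unfolding bnd_def by (intro rep_intros rep_tl; (assumption | (rule rep_const, simp)))

lemma bnd: "bnd p n = (if \<forall>i. i \<prec> n \<longrightarrow> p \<bullet> i = \<zero> then \<zero> else \<one>)"
proof -
  have sc: "bnd p (sc n) = (if p \<bullet> n = \<zero> then bnd p n else \<one>)" for n
    unfolding bnd_def by (rule rcf_sc[of False]) (intro rep_intros rep_const; simp)
  have z: "bnd p \<zero> = \<zero>" by (simp add: bnd_def)
  have 1: "bnd p n = \<zero> \<or> bnd p n = \<one>"
    by (rule ind[of "\<lambda>n. bnd p n = \<zero> \<or> bnd p n = \<one>"], (intro rep_intros rep_const; simp),
        simp add: z, auto simp: sc)
  have 2: "bnd p n = \<zero> \<longrightarrow> i \<prec> n \<longrightarrow> p \<bullet> i = \<zero>" for i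
    by (rule ind[of "\<lambda>n. bnd p n = \<zero> \<longrightarrow> i \<prec> n \<longrightarrow> p \<bullet> i = \<zero>"],
        (intro rep_intros rep_const; simp), simp, auto simp: sc less_sc split: if_splits)
  have 3: "m \<preceq> n \<longrightarrow> bnd p m = \<zero>" if *: "\<forall>i. i \<prec> n \<longrightarrow> p \<bullet> i = \<zero>" for m
  proof (rule ind[of "\<lambda>m. m \<preceq> n \<longrightarrow> bnd p m = \<zero>"], (intro rep_intros rep_const; simp))
    fix m assume "m \<preceq> n \<longrightarrow> bnd p m = \<zero>"
    then show "sc m \<preceq> n \<longrightarrow> bnd p (sc m) = \<zero>" using * leq_less[of m n] by (auto simp: sc)
  qed (simp add: z)
  show ?thesis
  proof (cases "\<forall>i. i \<prec> n \<longrightarrow> p \<bullet> i = \<zero>")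
    case True
    then show ?thesis using 3[of n] by simp
  next
    case False
    then show ?thesis using 1 2 by auto
  qed
qed

lemma decp_ball [rep_intros]:
  assumes "rep b \<Gamma> Nt N" "decp b (Nt # \<Gamma>) (\<lambda>xs. P (tl xs) (hd xs))"
  shows "decp b \<Gamma> (\<lambda>xs. \<forall>i. i \<prec> N xs \<longrightarrow> P xs i)"
proof -
  obtain p where p: "rep b \<Gamma> T1 p" "\<And>xs m. p xs \<bullet> m = (if P xs m then \<zero> else \<one>)"
    by (rule decp_fun[OF assms(2)], rule that)
  then have "rep b \<Gamma> Nt (\<lambda>xs. bnd (p xs) (N xs))" using assms by (intro rep_intros)
  moreover have "bnd (p xs) (N xs) = (if \<forall>i. i \<prec> N xs \<longrightarrow> P xs i then \<zero> else \<one>)" for xs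
    unfolding bnd p(2) by auto
  ultimately show ?thesis unfolding decp_def by simp
qed

lemma decp_bex [rep_intros]:
  assumes "rep b \<Gamma> Nt N" "decp b (Nt # \<Gamma>) (\<lambda>xs. P (tl xs) (hd xs))"
  shows "decp b \<Gamma> (\<lambda>xs. \<exists>i. i \<prec> N xs \<and> P xs i)"
  using decp_not[OF decp_ball[OF assms(1) decp_not[OF assms(2)]]] by simp

end

context model
begin

subsection \<open>Cantor pairing and codes of sequences\<close>

text \<open>\<open>wd z\<close> is the index of the diagonal on which z lies.\<close>

definition wd where "wd z = rcf z \<zero> (\<lambda>r m. if sc m = tri (sc r) then sc r else r)"

lemma rep_wd [rep_intros]: "rep b \<Gamma> Nt F \<Longrightarrow> rep b \<Gamma> Nt (\<lambda>xs. wd (F xs))"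
  unfolding wd_def by (intro rep_intros; (assumption | (rule rep_const, simp)))

lemma wd_zero [simp]: "wd \<zero> = \<zero>" by (simp add: wd_def)
lemma wd_sc: "wd (sc z) = (if sc z = tri (sc (wd z)) then sc (wd z) else wd z)"
  unfolding wd_def by (rule rcf_sc[of False]) (intro rep_intros rep_const; simp)

text \<open>The counter increases at triangular numbers only, and \<open>tri (sc n)\<close> is the
  successor of \<open>tri n \<oplus> n\<close>, the last point of diagonal \<open>n\<close>. One
  induction runs along a diagonal, the other passes from each diagonal to the next.\<close>

lemma wd_tri_padd: "y \<preceq> n \<Longrightarrow> wd (tri n \<oplus> y) = n"
proof -
  have row: "y \<preceq> n \<longrightarrow> wd (tri n \<oplus> y) = n" if "wd (tri n) = n" for n y
  proof (rule ind[of "\<lambda>y. y \<preceq> n \<longrightarrow> wd (tri n \<oplus> y) = n"], (intro rep_intros rep_const; simp))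
    fix y assume IH: "y \<preceq> n \<longrightarrow> wd (tri n \<oplus> y) = n"
    show "sc y \<preceq> n \<longrightarrow> wd (tri n \<oplus> sc y) = n"
    proof
      assume "sc y \<preceq> n"
      then have "wd (tri n \<oplus> y) = n" "y \<noteq> n" using IH leq_less[of y n] less_irrefl by auto
      then show "wd (tri n \<oplus> sc y) = n" by (simp add: wd_sc)
    qed
  qed (simp add: that)
  have "wd (tri n) = n" for n
  proof (rule ind[of "\<lambda>n. wd (tri n) = n"], (intro rep_intros rep_const; simp))
    fix n assume "wd (tri n) = n"
    then have "wd (tri n \<oplus> n) = n" using row by simp
    then show "wd (tri (sc n)) = sc n" by (simp add: wd_sc)
  qed simp
  then show "y \<preceq> n \<Longrightarrow> wd (tri n \<oplus> y) = n" using row by blast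
qed

text \<open>Together with \<open>fs\<close> the inverse of the pairing: second and first
  component.\<close>

definition sn where "sn z = z \<ominus> tri (wd z)"
definition fs where "fs z = wd z \<ominus> sn z"

lemma rep_sn [rep_intros]: "rep b \<Gamma> Nt F \<Longrightarrow> rep b \<Gamma> Nt (\<lambda>xs. sn (F xs))"
  unfolding sn_def by (intro rep_intros; (assumption | (rule rep_const, simp)))
lemma rep_fs [rep_intros]: "rep b \<Gamma> Nt F \<Longrightarrow> rep b \<Gamma> Nt (\<lambda>xs. fs (F xs))"
  unfolding fs_def by (intro rep_intros; (assumption | (rule rep_const, simp)))

lemma sn_pr [simp]: "sn (pr a b) = b" and fs_pr [simp]: "fs (pr a b) = a"
proof -
  have "wd (pr a b) = a \<oplus> b" unfolding pr_eq by (rule wd_tri_padd) simp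
  then show "sn (pr a b) = b" "fs (pr a b) = a"
    unfolding fs_def sn_def by (simp_all add: pr_eq)
qed
lemma fs_zero [simp]: "fs \<zero> = \<zero>" by (simp add: fs_def sn_def)

lemma leq_pr: "a \<oplus> b \<preceq> pr a b"
proof -
  have "n \<preceq> tri n" for n
  proof (rule ind[of "\<lambda>n. n \<preceq> tri n"], (intro rep_intros rep_const; simp))
    fix n assume "n \<preceq> tri n"
    have "n \<preceq> tri n \<oplus> n" by simp
    then show "sc n \<preceq> tri (sc n)" by (simp only: tri_simps sc_pminus_sc)
  qed simp
  from leq_trans[OF this leq_padd] show ?thesis by (simp only: pr_eq)
qed

abbreviation snoc where "snoc s a \<equiv> sc (pr s a)"
definition ini where "ini s = fs (pd s)"
definition lst where "lst s = sn (pd s)"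
definition it where "it s n = rcf n s (\<lambda>r m. ini r)"
definition cnt where "cnt s n = rcf n \<zero> (\<lambda>r m. if it s m = \<zero> then r else sc r)"
text \<open>The length as the number of nonempty codes among \<open>s\<close>, \<open>ini s\<close>,
  \<open>ini (ini s)\<close> and so on. Since a code is at least as large as its length,
  \<open>s\<close> steps are enough.\<close>

definition ln where "ln s = cnt s s"
definition nth where "nth s i = lst (it s (ln s \<ominus> sc i))"

lemma rep_ini [rep_intros]: "rep b \<Gamma> Nt F \<Longrightarrow> rep b \<Gamma> Nt (\<lambda>xs. ini (F xs))"
  unfolding ini_def by (intro rep_intros; (assumption | (rule rep_const, simp)))
lemma rep_lst [rep_intros]: "rep b \<Gamma> Nt F \<Longrightarrow> rep b \<Gamma> Nt (\<lambda>xs. lst (F xs))"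
  unfolding lst_def by (intro rep_intros; (assumption | (rule rep_const, simp)))
lemma rep_it [rep_intros]:
  "rep b \<Gamma> Nt F \<Longrightarrow> rep b \<Gamma> Nt N \<Longrightarrow> rep b \<Gamma> Nt (\<lambda>xs. it (F xs) (N xs))"
  unfolding it_def by (intro rep_intros rep_tl; (assumption | (rule rep_const, simp)))
lemma rep_cnt [rep_intros]:
  "rep b \<Gamma> Nt F \<Longrightarrow> rep b \<Gamma> Nt N \<Longrightarrow> rep b \<Gamma> Nt (\<lambda>xs. cnt (F xs) (N xs))"
  unfolding cnt_def
  by (intro rep_rcf rep_if decp_eq rep_it rep_app rep_vars; (assumption | (rule rep_tl, rule rep_tl, assumption) | (rule rep_const, simp)))
lemma rep_ln [rep_intros]: "rep b \<Gamma> Nt F \<Longrightarrow> rep b \<Gamma> Nt (\<lambda>xs. ln (F xs))"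
  unfolding ln_def by (intro rep_intros)
lemma rep_nth [rep_intros]:
  "rep b \<Gamma> Nt F \<Longrightarrow> rep b \<Gamma> Nt N \<Longrightarrow> rep b \<Gamma> Nt (\<lambda>xs. nth (F xs) (N xs))"
  unfolding nth_def by (intro rep_intros; (assumption | (rule rep_const, simp)))

lemma ini_zero [simp]: "ini \<zero> = \<zero>" and ini_snoc [simp]: "ini (snoc s a) = s"
  and lst_snoc [simp]: "lst (snoc s a) = a"
  by (simp_all add: ini_def lst_def)

lemma it_zero [simp]: "it s \<zero> = s" by (simp add: it_def)
lemma it_sc: "it s (sc n) = ini (it s n)"
  unfolding it_def by (rule rcf_sc[of False]) (intro rep_intros rep_const; simp)
lemma cnt_zero [simp]: "cnt s \<zero> = \<zero>" by (simp add: cnt_def)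
lemma cnt_sc: "cnt s (sc n) = (if it s n = \<zero> then cnt s n else sc (cnt s n))"
  unfolding cnt_def by (rule rcf_sc[of False]) (intro rep_intros rep_const; simp)

lemma ini_sg: "ini (sg h k) = sg h (pd k)"
  by (cases k rule: nat_cases') simp_all

lemma it_sg: "it (sg h k) m = sg h (k \<ominus> m)"
  by (rule ind[of "\<lambda>m. it (sg h k) m = sg h (k \<ominus> m)"], (intro rep_intros rep_const; simp), simp,
      simp add: it_sc ini_sg pminus_sc)

lemma sg_eq_zero: "sg h k = \<zero> \<longleftrightarrow> k = \<zero>"
  by (cases k rule: nat_cases') simp_all

lemma leq_sg: "k \<preceq> sg h k"
proof (rule ind[of "\<lambda>k. k \<preceq> sg h k"], (intro rep_intros rep_const; simp))
  fix n assume "n \<preceq> sg h n"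
  then have "n \<preceq> pr (sg h n) (h \<bullet> n)" using leq_trans leq_pr leq_padd by blast
  then show "sc n \<preceq> sg h (sc n)" by (simp only: sg_simps sc_pminus_sc)
qed simp

lemma sc_neq [simp]: "sc n \<noteq> n" "n \<noteq> sc n"
  using less_irrefl[of n] pminus_same[of n] by (metis pminus_same)+

lemma ln_sg [simp]: "ln (sg h k) = k"
proof -
  have "cnt (sg h k) n = (if k \<preceq> n then k else n)" for n
  proof (rule ind[of "\<lambda>n. cnt (sg h k) n = (if k \<preceq> n then k else n)"], (intro rep_intros rep_const; simp))
    show "cnt (sg h k) \<zero> = (if k \<preceq> \<zero> then k else \<zero>)" by auto
    fix n assume "cnt (sg h k) n = (if k \<preceq> n then k else n)"
    then show "cnt (sg h k) (sc n) = (if k \<preceq> sc n then k else sc n)"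
      using leq_less[of k "sc n"] leq_less[of k n] less_sc[of k n]
      by (auto simp: cnt_sc it_sg sg_eq_zero)
  qed
  then show ?thesis using leq_sg by (simp add: ln_def)
qed

lemma nth_sg: assumes "i \<prec> k" shows "nth (sg h k) i = h \<bullet> i"
proof -
  obtain c where c: "k = sc i \<oplus> c" using assms leq_iff by blast
  have "k \<ominus> sc i = c" using padd_pminus'[of "sc i" c] by (simp only: c)
  then have "k \<ominus> (k \<ominus> sc i) = sc i" using padd_pminus[of "sc i" c] by (simp only: c)
  then show ?thesis by (simp add: nth_def it_sg)
qed

lemma sg_cong: assumes "\<And>i. i \<prec> k \<Longrightarrow> g \<bullet> i = h \<bullet> i" shows "sg g k = sg h k"
proof -
  have "j \<preceq> k \<longrightarrow> sg g j = sg h j" for j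
  proof (rule ind[of "\<lambda>j. j \<preceq> k \<longrightarrow> sg g j = sg h j"], (intro rep_intros rep_const; simp))
    fix j assume "j \<preceq> k \<longrightarrow> sg g j = sg h j"
    then show "sc j \<preceq> k \<longrightarrow> sg g (sc j) = sg h (sc j)" using assms[of j] leq_less[of j k] by auto
  qed simp
  then show ?thesis by simp
qed

definition odd where "odd n \<longleftrightarrow> rcf n \<zero> (\<lambda>r m. if r = \<zero> then \<one> else \<zero>) \<noteq> \<zero>"
definition half where "half n = rcf n \<zero> (\<lambda>r m. if odd m then sc r else r)"

lemma rep_odd [rep_intros]: "rep b \<Gamma> Nt F \<Longrightarrow> decp b \<Gamma> (\<lambda>xs. odd (F xs))"
  unfolding odd_def by (intro rep_intros; (assumption | (rule rep_const, simp)))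
lemma rep_half [rep_intros]: "rep b \<Gamma> Nt F \<Longrightarrow> rep b \<Gamma> Nt (\<lambda>xs. half (F xs))"
  unfolding half_def by (intro rep_intros; (assumption | (rule rep_const, simp)))

lemma odd_zero [simp]: "\<not> odd \<zero>" by (simp add: odd_def)
lemma odd_sc [simp]: "odd (sc n) \<longleftrightarrow> \<not> odd n"
  unfolding odd_def by (subst rcf_sc[of False], (intro rep_intros rep_const; simp), simp)
lemma half_zero [simp]: "half \<zero> = \<zero>" by (simp add: half_def)
lemma half_sc: "half (sc n) = (if odd n then sc (half n) else half n)"
  unfolding half_def by (rule rcf_sc[of False]) (intro rep_intros rep_const; simp)

lemma odd_double [simp]: "\<not> odd (n \<oplus> n)"
  by (rule ind[of "\<lambda>n. \<not> odd (n \<oplus> n)"], (intro rep_intros rep_const; simp), simp_all)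
lemma half_double [simp]: "half (n \<oplus> n) = n"
  by (rule ind[of "\<lambda>n. half (n \<oplus> n) = n"], (intro rep_intros rep_const; simp), simp_all add: half_sc)
lemma half_sc_double [simp]: "half (sc (n \<oplus> n)) = n" by (simp add: half_sc)
lemma even_odd_cases: "n = (if odd n then sc (half n \<oplus> half n) else half n \<oplus> half n)"
  by (rule ind[of "\<lambda>n. n = (if odd n then sc (half n \<oplus> half n) else half n \<oplus> half n)"],
      (intro rep_intros rep_const; simp), simp, simp add: half_sc split: if_splits)

end

section \<open>The equivalences in a model\<close>

text \<open>The matrix of the existential statement, isolated because its only free variable is the
  functional, which makes it eligible for \<open>transfer\<close>.\<close>

definition UDET_matrix :: fm where
  "UDET_matrix =
     (let Phi = Var ''Phi'' (T1 \<leadsto> (Nt \<leadsto> T1));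
          S0 = Var ''S0'' T1; S1 = Var ''S1'' T1; f = Var ''f'' T1;
          one = suc zero; two = suc (suc zero) in
      All ''f'' T1 (Or
        (All ''S1'' T1 (phi_play (Phi \<cdot> f \<cdot> one) S1 f))
        (All ''S0'' T1 (Neg (phi_play S0 (Phi \<cdot> f \<cdot> two) f)))))"

lemma USigma01_DET_matrix: "USigma01_DET = Ex ''Phi'' (T1 \<leadsto> (Nt \<leadsto> T1)) UDET_matrix"
  by (simp add: USigma01_DET_def UDET_matrix_def Let_def)

context model
begin

section \<open>The principles as statements about a model, and the existence of plays\<close>

definition play where
  "play S T h \<longleftrightarrow> (\<forall>n. h \<bullet> (n \<oplus> n) = S \<bullet> sg h (n \<oplus> n) \<and> h \<bullet> sc (n \<oplus> n) = T \<bullet> sg h (sc (n \<oplus> n)))"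
definition wins where "wins S T f \<longleftrightarrow> (\<exists>h. play S T h \<and> (\<exists>k. f \<bullet> sg h k = \<zero>))"
definition path where "path f \<longleftrightarrow> (\<exists>g. \<forall>x. f \<bullet> sg g x \<noteq> \<zero>)"

lemma sat_S2: "sat e S2 \<longleftrightarrow> (\<exists>S. \<forall>f. S \<star> f = \<zero> \<longleftrightarrow> path f)"
  by (simp add: S2_def suslin_def seg_def path_def)

lemma sat_Pi11: "sat e Pi11_TRANS \<longleftrightarrow> (\<forall>f. std T1 f \<longrightarrow>
    ((\<forall>g. std T1 g \<longrightarrow> (\<exists>x. std Nt x \<and> f \<bullet> sg g x = \<zero>)) \<longleftrightarrow> \<not> path f))"
  by (simp add: Pi11_TRANS_def seg_def path_def Let_def)

lemma sat_DET_star: "sat e Sigma01_DET_star \<longleftrightarrow> (\<forall>f. std T1 f \<longrightarrow>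
    (\<exists>S. std T1 S \<and> (\<forall>T. wins S T f)) \<or> (\<exists>T. std T1 T \<and> (\<forall>S. \<not> wins S T f)))"
  by (simp add: Sigma01_DET_star_def phi_play_def is_play_def phi_def wins_def play_def seg_def plus_def
      Let_def)

abbreviation (input) strategy where "strategy \<Phi> f i \<equiv> ap Nt T1 (ap T1 (Nt \<leadsto> T1) \<Phi> f) i"

lemma sat_UDET_matrix: "sat e UDET_matrix \<longleftrightarrow> (let \<Phi> = e (''Phi'', T1 \<leadsto> (Nt \<leadsto> T1)) in \<forall>f.
    (\<forall>T. wins (strategy \<Phi> f \<one>) T f) \<or> (\<forall>S. \<not> wins S (strategy \<Phi> f (sc \<one>)) f))"
  by (simp add: UDET_matrix_def phi_play_def is_play_def phi_def wins_def play_def seg_def plus_def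
      Let_def)

lemma sat_UDET: "sat e USigma01_DET \<longleftrightarrow> (\<exists>\<Phi>. \<forall>f.
    (\<forall>T. wins (strategy \<Phi> f \<one>) T f) \<or> (\<forall>S. \<not> wins S (strategy \<Phi> f (sc \<one>)) f))"
  by (simp add: USigma01_DET_matrix sat_UDET_matrix)

text \<open>The recursor has values of type 0 only, so the recursion runs over codes of positions,
  and \<open>outcome\<close> reads the moves off from them.\<close>

definition pos where "pos S T n = rcf n \<zero> (\<lambda>r m. snoc r (if odd m then T \<bullet> r else S \<bullet> r))"
definition outcome where
  "outcome S T = Lam Nt Nt (\<lambda>n. if odd n then T \<bullet> pos S T n else S \<bullet> pos S T n)"

lemma rep_pos [rep_intros]:
  "rep b \<Gamma> T1 F \<Longrightarrow> rep b \<Gamma> T1 G \<Longrightarrow> rep b \<Gamma> Nt N \<Longrightarrow> rep b \<Gamma> Nt (\<lambda>xs. pos (F xs) (G xs) (N xs))"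
  unfolding pos_def
  by (intro rep_intros; (assumption | (rule rep_tl, rule rep_tl, assumption) | (rule rep_const, simp)))
lemma rep_outcome [rep_intros]:
  "rep b \<Gamma> T1 F \<Longrightarrow> rep b \<Gamma> T1 G \<Longrightarrow> rep b \<Gamma> T1 (\<lambda>xs. outcome (F xs) (G xs))"
  unfolding outcome_def
  by (intro rep_intros; (assumption | (rule rep_tl, assumption) | (rule rep_const, simp)))

lemma play_outcome: "play S T (outcome S T)"
proof -
  have o: "outcome S T \<bullet> n = (if odd n then T \<bullet> pos S T n else S \<bullet> pos S T n)" for n
    unfolding outcome_def by (rule beta[of False]) (intro rep_intros rep_const; simp)
  have p: "pos S T (sc n) = snoc (pos S T n) (if odd n then T \<bullet> pos S T n else S \<bullet> pos S T n)" for n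
    unfolding pos_def by (rule rcf_sc[of False]) (intro rep_intros rep_const; simp)
  have "sg (outcome S T) n = pos S T n" for n
    by (rule ind[of "\<lambda>n. sg (outcome S T) n = pos S T n"], (intro rep_intros rep_const; simp),
        simp add: pos_def, simp add: p o)
  then show ?thesis unfolding play_def by (simp add: o p)
qed


subsection \<open>From uniform determinacy to determinacy of standard games\<close>

lemma UDET_imp_DET_star: assumes "sat e USigma01_DET" shows "sat e Sigma01_DET_star"
proof -
  let ?\<tau> = "T1 \<leadsto> (Nt \<leadsto> T1)"
  have "wff (dom \<D>) UDET_matrix" "internal UDET_matrix" "gdf UDET_matrix"
    "fv UDET_matrix \<subseteq> {(''Phi'', ?\<tau>)}"
    by (auto simp: UDET_matrix_def Let_def phi_play_def is_play_def phi_def seg_def plus_def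
        And_def Or_def Neg_def Ex_def)
  moreover obtain a where "sat (e((''Phi'', ?\<tau>) := a)) UDET_matrix"
    using assms by (auto simp: USigma01_DET_matrix)
  ultimately obtain \<Phi> where \<Phi>: "std ?\<tau> \<Phi>" "sat (e0((''Phi'', ?\<tau>) := \<Phi>)) UDET_matrix"
    using transfer[of UDET_matrix "''Phi''" ?\<tau> e a] by auto
  have "std Nt \<one>" "std Nt (sc \<one>)" by (auto intro!: std_ap std_con)
  then have "std T1 (strategy \<Phi> f \<one>)" "std T1 (strategy \<Phi> f (sc \<one>))" if "std T1 f" for f
    using \<Phi>(1) that by (auto intro!: std_ap)
  moreover have "(\<forall>T. wins (strategy \<Phi> f \<one>) T f) \<or> (\<forall>S. \<not> wins S (strategy \<Phi> f (sc \<one>)) f)" for f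
    using \<Phi>(2) unfolding sat_UDET_matrix Let_def by simp
  ultimately show ?thesis unfolding sat_DET_star by blast
qed


subsection \<open>From determinacy of standard games to transfer\<close>

text \<open>A standard winning strategy of player 0 opens with a standard zero of \<open>h\<close>.
  Player 1 has no winning strategy, because the possibly nonstandard \<open>x\<close> is also a
  legal opening.\<close>

lemma DET_star_imp_Pi01:
  assumes det: "sat e Sigma01_DET_star" and h: "std T1 h" and x: "h \<bullet> x = \<zero>"
  shows "\<exists>x. std Nt x \<and> h \<bullet> x = \<zero>"
proof -
  \<comment> \<open>the game in which player 0 has to open with a zero of h\<close>
  define f where "f = Lam Nt Nt (\<lambda>s. if ln s = \<one> then h \<bullet> lst s else \<one>)"
  have f: "f \<bullet> s = (if ln s = \<one> then h \<bullet> lst s else \<one>)" for s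
    unfolding f_def by (rule beta[of False]) (intro rep_intros rep_const; simp)
  have "std T1 f" unfolding f_def by (rule rep_std) (intro rep_intros rep_const; simp add: h)
  have key: "(\<exists>k. f \<bullet> sg p k = \<zero>) \<longleftrightarrow> h \<bullet> (S \<bullet> \<zero>) = \<zero>" if "play S T p" for S T p
  proof -
    have "p \<bullet> \<zero> = S \<bullet> \<zero>" using that[unfolded play_def, rule_format, of \<zero>] by simp
    then have "sg p \<one> = snoc \<zero> (S \<bullet> \<zero>)" by simp
    then have "f \<bullet> sg p k = (if k = \<one> then h \<bullet> (S \<bullet> \<zero>) else \<one>)" for k
      by (simp add: f del: sg_simps)
    then show ?thesis by simp
  qed
  have w: "wins S T f \<longleftrightarrow> h \<bullet> (S \<bullet> \<zero>) = \<zero>" for S T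
    unfolding wins_def using key play_outcome by blast
  define c where "c = Lam Nt Nt (\<lambda>_. x)"
  have c: "c \<bullet> \<zero> = x" unfolding c_def by (rule beta[of False]) (rule rep_const, simp)
  have "(\<exists>S. std T1 S \<and> (\<forall>T. wins S T f)) \<or> (\<exists>T. std T1 T \<and> (\<forall>S. \<not> wins S T f))"
    using det \<open>std T1 f\<close> unfolding sat_DET_star by simp
  then consider S where "std T1 S" "h \<bullet> (S \<bullet> \<zero>) = \<zero>" | "\<forall>S. h \<bullet> (S \<bullet> \<zero>) \<noteq> \<zero>"
    unfolding w by auto
  then show ?thesis
  proof cases
    case 1
    then have "std Nt (S \<bullet> \<zero>)" by (intro std_ap std_con)
    then show ?thesis using 1 by blast
  next
    case 2
    then have "h \<bullet> (c \<bullet> \<zero>) \<noteq> \<zero>" by blast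
    then show ?thesis using c x by simp
  qed
qed

definition odds where "odds h = Lam Nt Nt (\<lambda>i. h \<bullet> sc (i \<oplus> i))"
lemma rep_odds [rep_intros]: "rep b \<Gamma> T1 F \<Longrightarrow> rep b \<Gamma> T1 (\<lambda>xs. odds (F xs))"
  unfolding odds_def
  by (intro rep_intros; (assumption | (rule rep_tl, assumption) | (rule rep_const, simp)))
lemma odds: "odds h \<bullet> i = h \<bullet> sc (i \<oplus> i)"
  unfolding odds_def by (rule beta[of False]) (intro rep_intros rep_const; simp)

lemma double_less: assumes "i \<prec> m" shows "sc (i \<oplus> i) \<prec> m \<oplus> m"
proof -
  obtain c where "m = sc i \<oplus> c" using assms leq_iff by blast
  then have "m \<oplus> m = (sc i \<oplus> c) \<oplus> (sc i \<oplus> c)" by simp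
  also have "\<dots> = sc (sc (i \<oplus> i)) \<oplus> (c \<oplus> c)"
    by (simp, metis padd_assoc padd_comm)
  finally show ?thesis using leq_iff by blast
qed

lemma DET_star_imp_Pi11: assumes det: "sat e Sigma01_DET_star" shows "sat e Pi11_TRANS"
  unfolding sat_Pi11
proof (intro allI impI iffI)
  fix f assume f: "std T1 f"
  \<comment> \<open>the game in which player 1 enumerates g, and player 0 wins if g runs into a zero of f; the number m
    of tested moves of g is the first component of the length, to be sure that m ranges over everything\<close>
  define u where "u = Lam Nt Nt (\<lambda>s. if fs (ln s) \<oplus> fs (ln s) \<preceq> ln s
    then f \<bullet> sg (Lam Nt Nt (\<lambda>i. nth s (sc (i \<oplus> i)))) (fs (ln s)) else \<one>)"
  have u: "u \<bullet> s = (if fs (ln s) \<oplus> fs (ln s) \<preceq> ln s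
    then f \<bullet> sg (Lam Nt Nt (\<lambda>i. nth s (sc (i \<oplus> i)))) (fs (ln s)) else \<one>)" for s
    unfolding u_def by (rule beta[of False]) (intro rep_intros rep_const; simp)
  have "std T1 u" unfolding u_def by (rule rep_std) (intro rep_intros rep_const; simp add: f)
  have lam: "Lam Nt Nt (\<lambda>i. nth s (sc (i \<oplus> i))) \<bullet> i = nth s (sc (i \<oplus> i))" for s i
    by (rule beta[of False]) (intro rep_intros rep_const; simp)
  have u_sg: "u \<bullet> sg p k = (if fs k \<oplus> fs k \<preceq> k then f \<bullet> sg (odds p) (fs k) else \<one>)" for p k
  proof -
    have "sg (Lam Nt Nt (\<lambda>i. nth (sg p k) (sc (i \<oplus> i)))) (fs k) = sg (odds p) (fs k)"
      if "fs k \<oplus> fs k \<preceq> k"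
    proof (rule sg_cong)
      fix i assume "i \<prec> fs k"
      then have "sc (i \<oplus> i) \<prec> k" using double_less leq_trans that by blast
      then show "Lam Nt Nt (\<lambda>i. nth (sg p k) (sc (i \<oplus> i))) \<bullet> i = odds p \<bullet> i"
        by (simp only: lam odds nth_sg)
    qed
    then show ?thesis by (simp add: u)
  qed
  have key: "(\<exists>k. u \<bullet> sg p k = \<zero>) \<longleftrightarrow> (\<exists>m. f \<bullet> sg (odds p) m = \<zero>)" for p
  proof
    assume "\<exists>m. f \<bullet> sg (odds p) m = \<zero>"
    then obtain m where m: "f \<bullet> sg (odds p) m = \<zero>" by blast
    \<comment> \<open>The number \<open>pr m (m \<oplus> m)\<close> is a length with first component
      \<open>m\<close> that leaves room for \<open>m\<close> moves of player 1.\<close>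
    have "m \<oplus> m \<preceq> pr m (m \<oplus> m)" using leq_trans leq_pr leq_padd' by blast
    then have "u \<bullet> sg p (pr m (m \<oplus> m)) = \<zero>" using m by (simp add: u_sg)
    then show "\<exists>k. u \<bullet> sg p k = \<zero>" by blast
  next
    assume "\<exists>k. u \<bullet> sg p k = \<zero>"
    then show "\<exists>m. f \<bullet> sg (odds p) m = \<zero>" unfolding u_sg by (metis sc_zero(1))
  qed
  {
    assume *: "\<forall>g. std T1 g \<longrightarrow> (\<exists>x. std Nt x \<and> f \<bullet> sg g x = \<zero>)"
    have "(\<exists>S. std T1 S \<and> (\<forall>T. wins S T u)) \<or> (\<exists>T. std T1 T \<and> (\<forall>S. \<not> wins S T u))"
      using det \<open>std T1 u\<close> unfolding sat_DET_star by simp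
    then consider S where "\<forall>T. wins S T u" | T where "std T1 T" "\<forall>S. \<not> wins S T u"
      by auto
    then show "\<not> path f"
    proof cases
      case 1
      show ?thesis unfolding path_def
      proof
        assume "\<exists>g. \<forall>x. f \<bullet> sg g x \<noteq> \<zero>"
        then obtain g where g: "\<And>x. f \<bullet> sg g x \<noteq> \<zero>" by blast
        \<comment> \<open>Player 1 ignores the opponent and lists \<open>g\<close>: at a position of
          length \<open>2n + 1\<close>, \<open>half\<close> of the length is
          \<open>n\<close>.\<close>
        define T where "T = Lam Nt Nt (\<lambda>s. g \<bullet> half (ln s))"
        have T: "T \<bullet> s = g \<bullet> half (ln s)" for s
          unfolding T_def by (rule beta[of False]) (intro rep_intros rep_const; simp)
        obtain p where p: "play S T p" "\<exists>k. u \<bullet> sg p k = \<zero>" using 1 unfolding wins_def by blast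
        have "p \<bullet> sc (n \<oplus> n) = g \<bullet> n" for n
          using p(1)[unfolded play_def, rule_format, of n] T by (simp del: sg_simps)
        then have "odds p \<bullet> n = g \<bullet> n" for n by (simp only: odds)
        then have "odds p = g" by (rule ext)
        then show False using p(2) g unfolding key by blast
      qed
    next
      case 2
      \<comment> \<open>Any standard strategy would do. Against the standard \<open>T\<close> it
        produces a standard play, so the assumption \<open>*\<close> applies to the function formed
        by the odd moves.\<close>
      define S where "S = Lam Nt Nt (\<lambda>_. \<zero>)"
      have "std T1 S" unfolding S_def by (rule rep_std) (intro rep_intros rep_const; simp)
      then have "std T1 (odds (outcome S T))"
        using 2 by (intro rep_std) (intro rep_intros rep_const; simp)
      then obtain x where "f \<bullet> sg (odds (outcome S T)) x = \<zero>" using * by blast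
      then have "wins S T u" unfolding wins_def using play_outcome key by blast
      then show ?thesis using 2 by blast
    qed
  next
    fix g assume "\<not> path f" and g: "std T1 g"
    \<comment> \<open>In this direction a zero along \<open>g\<close> exists already; it only has to
      be made standard.\<close>
    define h where "h = Lam Nt Nt (\<lambda>x. f \<bullet> sg g x)"
    have h: "h \<bullet> x = f \<bullet> sg g x" for x
      unfolding h_def by (rule beta[of False]) (intro rep_intros rep_const; simp)
    have "std T1 h" unfolding h_def by (rule rep_std) (intro rep_intros rep_const; simp add: f g)
    obtain x where "h \<bullet> x = \<zero>" using \<open>\<not> path f\<close> h unfolding path_def by auto
    then show "\<exists>x. std Nt x \<and> f \<bullet> sg g x = \<zero>"
      using DET_star_imp_Pi01[OF det \<open>std T1 h\<close>] h by auto
  }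
qed

end

context model
begin

subsection \<open>From transfer to the Suslin functional\<close>

abbreviation len where "len \<sigma> x \<equiv> ap (Seq \<sigma>) Nt (ci (Len \<sigma>)) x"
abbreviation entry where "entry \<sigma> x i \<equiv> ap Nt \<sigma> (ap (Seq \<sigma>) (Nt \<leadsto> \<sigma>) (ci (Nth \<sigma>)) x) i"

lemma sat_elem:
  assumes "wft (dom \<D>) z" "wft (dom \<D>) x" "tyof z = \<sigma>" "tyof x = Seq \<sigma>"
  shows "sat e (elem \<sigma> z x) \<longleftrightarrow>
    (\<exists>i. i \<prec> len \<sigma> (eval e x) \<and> eval e z = entry \<sigma> (eval e x) i)"
  using assms
  by (simp add: elem_def Let_def Ex_lt_def All_lt_def lt_def le_def sat_eq eval_upd_fresh)

lemma std_less: assumes "std Nt n" "i \<prec> n" shows "std Nt i"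
proof -
  have "i \<preceq> n" using assms(2) leq_less by blast
  moreover have "sat (e0((''x'', Nt) := n, (''y'', Nt) := i))
    (Imp (And (St (Var ''x'' Nt)) (le (Var ''y'' Nt) (Var ''x'' Nt))) (St (Var ''y'' Nt)))"
    by (intro axiom_st st_below) auto
  ultimately show ?thesis using assms(1) by (simp add: le_def)
qed

lemma herbrandized_choice:
  assumes A: "wff (dom \<D>) A" "internal A" "gdf A" "(''F'', \<rho> \<leadsto> Seq \<tau>) \<notin> fv A"
    and P: "\<And>x y. sat (e0((''u'', \<rho>) := x, (''v'', \<tau>) := y)) A \<longleftrightarrow> P x y"
    and ex: "\<And>x. std \<rho> x \<Longrightarrow> \<exists>y. std \<tau> y \<and> P x y"
  shows "\<exists>F. std (\<rho> \<leadsto> Seq \<tau>) F \<and> (\<forall>x. std \<rho> x \<longrightarrow>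
    (\<exists>i. i \<prec> len \<tau> (ap \<rho> (Seq \<tau>) F x) \<and> P x (entry \<tau> (ap \<rho> (Seq \<tau>) F x) i)))"
proof -
  let ?F = "Var ''F'' (\<rho> \<leadsto> Seq \<tau>)" and ?u = "Var ''u'' \<rho>" and ?v = "Var ''v'' \<tau>"
  have "sat e0 (Imp (All_st ''u'' \<rho> (Ex_st ''v'' \<tau> A)) (Ex_st ''F'' (\<rho> \<leadsto> Seq \<tau>)
     (All_st ''u'' \<rho> (Ex ''v'' \<tau> (And (elem \<tau> ?v (?F \<cdot> ?u)) A)))))"
    using A by (intro axiom_st hac_int) (auto simp: elem_def Let_def)
  moreover have "sat e0 (All_st ''u'' \<rho> (Ex_st ''v'' \<tau> A))" using ex by (simp add: P)
  ultimately have "\<exists>F. std (\<rho> \<leadsto> Seq \<tau>) F \<and> (\<forall>x. std \<rho> x \<longrightarrow>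
    (\<exists>y. (\<exists>i. i \<prec> len \<tau> (ap \<rho> (Seq \<tau>) F x) \<and> y = entry \<tau> (ap \<rho> (Seq \<tau>) F x) i) \<and>
      sat (e0((''F'', \<rho> \<leadsto> Seq \<tau>) := F, (''u'', \<rho>) := x, (''v'', \<tau>) := y)) A))"
    by (simp add: sat_elem)
  then obtain F where F: "std (\<rho> \<leadsto> Seq \<tau>) F" and *: "\<And>x. std \<rho> x \<Longrightarrow>
    \<exists>y. (\<exists>i. i \<prec> len \<tau> (ap \<rho> (Seq \<tau>) F x) \<and> y = entry \<tau> (ap \<rho> (Seq \<tau>) F x) i) \<and>
      sat (e0((''F'', \<rho> \<leadsto> Seq \<tau>) := F, (''u'', \<rho>) := x, (''v'', \<tau>) := y)) A"
    by blast
  have "\<exists>i. i \<prec> len \<tau> (ap \<rho> (Seq \<tau>) F x) \<and> P x (entry \<tau> (ap \<rho> (Seq \<tau>) F x) i)" if x: "std \<rho> x" for x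
  proof -
    obtain i where i: "i \<prec> len \<tau> (ap \<rho> (Seq \<tau>) F x)"
      "sat (e0((''F'', \<rho> \<leadsto> Seq \<tau>) := F, (''u'', \<rho>) := x,
         (''v'', \<tau>) := entry \<tau> (ap \<rho> (Seq \<tau>) F x) i)) A" using *[OF x] by blast
    have "sat (e0((''u'', \<rho>) := x, (''v'', \<tau>) := entry \<tau> (ap \<rho> (Seq \<tau>) F x) i)) A"
      using i(2) by (subst sat_cong[of A]) (use A(4) in auto)
    then show ?thesis using i(1) P by blast
  qed
  then show ?thesis using F by blast
qed

text \<open>Let \<open>f\<close> apply \<open>h\<close> to the length of a sequence. If
  \<open>h\<close> has a zero, then \<open>f\<close> has a zero along every function, and transfer
  makes it standard along some standard function; the successor is an arbitrary choice of
  one.\<close>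

lemma Pi11_imp_Pi01:
  assumes "sat e Pi11_TRANS" "std T1 h" "h \<bullet> x = \<zero>"
  shows "\<exists>x. std Nt x \<and> h \<bullet> x = \<zero>"
proof -
  define f where "f = Lam Nt Nt (\<lambda>s. h \<bullet> ln s)"
  have f: "f \<bullet> s = h \<bullet> ln s" for s
    unfolding f_def by (rule beta[of False]) (intro rep_intros rep_const; simp)
  have "std T1 f" unfolding f_def by (rule rep_std) (intro rep_intros rep_const; simp add: assms)
  moreover have "\<not> path f" using assms(3) by (auto simp: path_def f)
  moreover have "std T1 (ci Succ)" by simp
  ultimately show ?thesis using assms(1) f ln_sg unfolding sat_Pi11 by metis
qed

lemma Pi11_imp_S2:
  assumes trans: "sat e Pi11_TRANS" and D: "\<D> (i, T2) = Some suslin_spec"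
  shows "sat e S2"
proof -
  let ?u = "Var ''u'' T1"
  let ?A = "Imp (Ex ''y'' Nt (Eq (?u \<cdot> Var ''y'' Nt) zero)) (Eq (?u \<cdot> Var ''v'' Nt) zero)"
  let ?P = "\<lambda>h x. (\<exists>y. h \<bullet> y = \<zero>) \<longrightarrow> h \<bullet> x = \<zero>"
  have ex: "\<exists>x. std Nt x \<and> ?P h x" if "std T1 h" for h
    using that Pi11_imp_Pi01[OF trans, of h] exI[of "std Nt", OF std_con(1)]
    by (cases "\<exists>y. h \<bullet> y = \<zero>") auto
  \<comment> \<open>The implication in \<open>?P\<close> makes the premise of choice hold for every
    standard \<open>h\<close>: without a zero, any standard number is acceptable.\<close>
  have "\<exists>M. std (T1 \<leadsto> Seq Nt) M \<and> (\<forall>h. std T1 h \<longrightarrow>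
    (\<exists>i. i \<prec> len Nt (ap T1 (Seq Nt) M h) \<and> ?P h (entry Nt (ap T1 (Seq Nt) M h) i)))"
    by (rule herbrandized_choice[of ?A T1 Nt ?P, OF _ _ _ _ _ ex]) (auto simp: Ex_def Neg_def)
  then obtain M where M: "std (T1 \<leadsto> Seq Nt) M" and M': "\<And>h. std T1 h \<Longrightarrow>
    \<exists>i. i \<prec> len Nt (ap T1 (Seq Nt) M h) \<and> ?P h (entry Nt (ap T1 (Seq Nt) M h) i)"
    by blast
  let ?A = "Imp (Ex ''g'' T1 (All ''x'' Nt (Neg (Eq (?u \<cdot> seg (Var ''g'' T1) (Var ''x'' Nt)) zero))))
     (All ''x'' Nt (Neg (Eq (?u \<cdot> seg (Var ''v'' T1) (Var ''x'' Nt)) zero)))"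
  \<comment> \<open>Transfer gives a standard \<open>g\<close> along which \<open>f\<close> has no
    standard zero. Numerical transfer then excludes nonstandard zeros as well.\<close>
  have path_std: "\<exists>g. std T1 g \<and> (\<forall>x. f \<bullet> sg g x \<noteq> \<zero>)" if f: "std T1 f" and "path f" for f
  proof -
    have "\<not> (\<forall>g. std T1 g \<longrightarrow> (\<exists>x. std Nt x \<and> f \<bullet> sg g x = \<zero>))"
      using trans that unfolding sat_Pi11 by simp
    then obtain g where g: "std T1 g" "\<And>x. std Nt x \<Longrightarrow> f \<bullet> sg g x \<noteq> \<zero>" by blast
    define h where "h = Lam Nt Nt (\<lambda>x. f \<bullet> sg g x)"
    have h: "h \<bullet> x = f \<bullet> sg g x" for x
      unfolding h_def by (rule beta[of False]) (intro rep_intros rep_const; simp)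
    have "std T1 h" unfolding h_def by (rule rep_std) (intro rep_intros rep_const; simp add: f g)
    then show ?thesis using Pi11_imp_Pi01[OF trans, of h] g h by auto
  qed
  let ?Q = "\<lambda>f g. path f \<longrightarrow> (\<forall>x. f \<bullet> sg g x \<noteq> \<zero>)"
  have ex: "\<exists>g. std T1 g \<and> ?Q f g" if "std T1 f" for f
    using that path_std exI[of "std T1", OF std_con(2)] by (cases "path f") auto
  have "\<exists>G. std (T1 \<leadsto> Seq T1) G \<and> (\<forall>f. std T1 f \<longrightarrow>
    (\<exists>i. i \<prec> len T1 (ap T1 (Seq T1) G f) \<and> ?Q f (entry T1 (ap T1 (Seq T1) G f) i)))"
    by (rule herbrandized_choice[of ?A T1 T1 ?Q, OF _ _ _ _ _ ex])
      (auto simp: Ex_def Neg_def seg_def path_def)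
  then obtain G where G: "std (T1 \<leadsto> Seq T1) G" and G': "\<And>f. std T1 f \<Longrightarrow>
    \<exists>i. i \<prec> len T1 (ap T1 (Seq T1) G f) \<and> ?Q f (entry T1 (ap T1 (Seq T1) G f) i)"
    by blast
  \<comment> \<open>Choice lists finitely many candidates without telling which one is right.
    Testing all of them is a bounded quantification: \<open>z\<close> tests the candidates for a
    zero, and \<open>p\<close> tests the candidates for a path by applying \<open>z\<close> along
    each. This gives a functional defined from the standard \<open>M\<close> and
    \<open>G\<close>.\<close>
  define z where "z h \<longleftrightarrow> (\<exists>j. j \<prec> len Nt (ap T1 (Seq Nt) M h) \<and> h \<bullet> entry Nt (ap T1 (Seq Nt) M h) j = \<zero>)" for h
  define c where "c f i = Lam Nt Nt (\<lambda>x. f \<bullet> sg (entry T1 (ap T1 (Seq T1) G f) i) x)" for f i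
  define p where "p f \<longleftrightarrow> (\<exists>i. i \<prec> len T1 (ap T1 (Seq T1) G f) \<and> \<not> z (c f i))" for f
  define \<Xi> where "\<Xi> = Lam T1 Nt (\<lambda>f. if p f then \<zero> else \<one>)"
  have z: "z h \<longleftrightarrow> (\<exists>y. h \<bullet> y = \<zero>)" if "std T1 h" for h
    using M'[OF that] unfolding z_def by blast
  have c: "c f i \<bullet> x = f \<bullet> sg (entry T1 (ap T1 (Seq T1) G f) i) x" for f i x
    unfolding c_def by (rule beta[of False]) (intro rep_intros rep_const; simp)
  \<comment> \<open>The test \<open>z\<close> is known to be correct for standard arguments only. An
    index below the standard length is standard, and so is the function belonging to it.\<close>
  have c_std: "std T1 (c f i)" if f: "std T1 f" and i: "i \<prec> len T1 (ap T1 (Seq T1) G f)" for f i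
  proof -
    have "std Nt (len T1 (ap T1 (Seq T1) G f))" using G f by (intro std_ap std_con)
    then have "std Nt i" using std_less i by blast
    then show ?thesis unfolding c_def
      by (intro rep_std) (intro rep_intros rep_const; simp add: f G)
  qed
  have p: "p f \<longleftrightarrow> path f" if "std T1 f" for f
  proof -
    have "p f \<longleftrightarrow> (\<exists>i. i \<prec> len T1 (ap T1 (Seq T1) G f) \<and> (\<forall>x. c f i \<bullet> x \<noteq> \<zero>))"
      unfolding p_def using z c_std[OF that] by blast
    then show ?thesis using G'[OF that] unfolding c path_def by blast
  qed
  have rep_p: "rep True [T1] Nt (\<lambda>xs. if p (hd xs) then \<zero> else \<one>)"
    unfolding p_def z_def c_def by (intro rep_intros rep_const; simp add: M G)
  have \<Xi>: "\<Xi> \<star> f = (if p f then \<zero> else \<one>)" for f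
    unfolding \<Xi>_def by (rule beta[OF rep_p])
  have "std T2 \<Xi>" unfolding \<Xi>_def by (rule rep_std, rule rep_Lam, simp add: rep_p)
  \<comment> \<open>The specification relativised to standard objects speaks of standard paths and
    standard lengths; this connects it with \<open>path\<close>.\<close>
  have path_rel: "path f \<longleftrightarrow> (\<exists>g. std T1 g \<and> (\<forall>x. std Nt x \<longrightarrow> f \<bullet> sg g x \<noteq> \<zero>))" if "std T1 f" for f
  proof -
    have "(\<forall>g. std T1 g \<longrightarrow> (\<exists>x. std Nt x \<and> f \<bullet> sg g x = \<zero>)) \<longleftrightarrow> \<not> path f"
      using trans that unfolding sat_Pi11 by simp
    then show ?thesis by blast
  qed
  let ?X = "Con (Xi i T2)"
  let ?B = "And (St ?X) (All_st ''Xi'' T2 (Imp (rel suslin_spec) (rel (eq T2 ?X (Var ''Xi'' T2)))))"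
  have rel_spec: "rel suslin_spec = All_st ''f'' T1 (And (le (Var ''Xi'' T2 \<cdot> Var ''f'' T1) (suc zero))
     (Iff (Eq (Var ''Xi'' T2 \<cdot> Var ''f'' T1) zero) (Neg (All_st ''g'' T1 (Neg (All_st ''x'' Nt
        (Neg (Eq (Var ''f'' T1 \<cdot> seg (Var ''g'' T1) (Var ''x'' Nt)) zero))))))))"
    by (simp add: suslin_spec_def suslin_def Let_def And_def Iff_def Neg_def Ex_def Ex_st_def All_st_def
        bounded_All_def le_def lt_def)
  let ?z = "fresh ?X (Var ''Xi'' T2)"
  have rel_eq: "rel (eq T2 ?X (Var ''Xi'' T2)) = All_st ?z T1 (Eq (?X \<cdot> Var ?z T1) (Var ''Xi'' T2 \<cdot> Var ?z T1))"
    by (simp add: Let_def bounded_All_def All_st_def)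
  have zX: "?z \<noteq> ''Xi''" by (simp add: fresh_def)
  have "sat e0 ?B"
  proof (rule axiom_st)
    show "?B \<in> RCA0_Omega \<D>" using D by (rule xi)
    show "wff (dom \<D>) ?B" "gdf ?B" unfolding rel_spec rel_eq using D by (auto simp: seg_def)
  qed
  then have "sat (e0((''Xi'', T2) := \<Xi>)) (rel suslin_spec) \<Longrightarrow>
      sat (e0((''Xi'', T2) := \<Xi>)) (rel (eq T2 ?X (Var ''Xi'' T2)))"
    using \<open>std T2 \<Xi>\<close> by simp
  moreover have "sat (e0((''Xi'', T2) := \<Xi>)) (rel suslin_spec)"
    unfolding rel_spec using path_rel p \<Xi> by (simp add: seg_def le_def sc_pminus_sc)
  ultimately have X: "\<And>f. std T1 f \<Longrightarrow> ci (Xi i T2) \<star> f = \<Xi> \<star> f"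
    unfolding rel_eq using zX by simp
  \<comment> \<open>The object \<open>\<Xi>\<close> would be a parameter and block transfer, whereas
    the constant is not one. It agrees with \<open>\<Xi>\<close> on standard arguments, hence
    satisfies the Suslin equivalence there, and by transfer everywhere.\<close>
  let ?C = "suslin ?X (Var ''f'' T1)"
  have "sat e0 (Imp (All_st ''f'' T1 ?C) (All ''f'' T1 ?C))"
    using D by (intro axiom_st pf_tp)
      (auto simp: suslin_def seg_def Iff_def And_def Neg_def Ex_def)
  moreover have "sat (e0((''f'', T1) := f)) ?C \<longleftrightarrow> (ci (Xi i T2) \<star> f = \<zero> \<longleftrightarrow> path f)" for f
    by (simp add: suslin_def seg_def path_def)
  ultimately have "\<forall>f. ci (Xi i T2) \<star> f = \<zero> \<longleftrightarrow> path f"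
    using X \<Xi> p by simp
  then show ?thesis unfolding sat_S2 by blast
qed

end

context model
begin

subsection \<open>Lengths of arbitrary codes\<close>

lemma pminus_leq: "a \<ominus> b \<preceq> a"
proof (rule ind[of "\<lambda>b. a \<ominus> b \<preceq> a"], (intro rep_intros rep_const; simp))
  fix n assume "a \<ominus> n \<preceq> a"
  moreover have "pd x \<preceq> x" for x
  proof (cases x rule: nat_cases')
    case (2 m)
    have "m \<preceq> sc m" using leq_sc[of m m] by simp
    then show ?thesis by (simp only: 2 pd_simps)
  qed simp
  ultimately show "a \<ominus> sc n \<preceq> a" unfolding pminus_sc using leq_trans by blast
qed simp

lemma fs_leq: "fs z \<preceq> z"
proof -
  have "wd z \<preceq> z"
  proof (rule ind[of "\<lambda>z. wd z \<preceq> z"], (intro rep_intros rep_const; simp))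
    fix z assume "wd z \<preceq> z"
    then show "wd (sc z) \<preceq> sc z" using leq_sc[of "wd z" z] by (simp add: wd_sc sc_pminus_sc)
  qed simp
  then show ?thesis using pminus_leq leq_trans unfolding fs_def by blast
qed

lemma pd_mono: assumes "a \<preceq> b" shows "pd a \<preceq> pd b"
proof (cases b rule: nat_cases')
  case 1
  then show ?thesis using assms leq_antisym[of a \<zero>] by simp
next
  case (2 m)
  then show ?thesis using assms by (cases a rule: nat_cases') (simp_all add: sc_pminus_sc)
qed

lemma ini_leq: "ini s \<preceq> pd s" by (simp add: ini_def fs_leq)

lemma it_leq: "it s n \<preceq> s \<ominus> n"
proof (rule ind[of "\<lambda>n. it s n \<preceq> s \<ominus> n"], (intro rep_intros rep_const; simp))
  fix n assume "it s n \<preceq> s \<ominus> n"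
  then show "it s (sc n) \<preceq> s \<ominus> sc n"
    unfolding it_sc pminus_sc using pd_mono ini_leq leq_trans by blast
qed simp

lemma it_large: assumes "s \<preceq> n" shows "it s n = \<zero>"
  using it_leq[of s n] assms by simp

lemma it_snoc: "it (snoc s a) (sc n) = it s n"
  by (rule ind[of "\<lambda>n. it (snoc s a) (sc n) = it s n"], (intro rep_intros rep_const; simp))
    (simp_all add: it_sc)

lemma cnt_snoc: "cnt (snoc s a) (sc n) = sc (cnt s n)"
  by (rule ind[of "\<lambda>n. cnt (snoc s a) (sc n) = sc (cnt s n)"], (intro rep_intros rep_const; simp),
      simp add: cnt_sc, subst cnt_sc, simp add: it_snoc cnt_sc)

text \<open>The count for the longer sequence makes \<open>pr s a\<close> steps below the top
  instead of \<open>s\<close>. The surplus steps meet only empty codes and add nothing.\<close>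

lemma ln_snoc [simp]: "ln (snoc s a) = sc (ln s)"
proof -
  obtain d where d: "pr s a = s \<oplus> d"
    using leq_pr[of s a] leq_padd[of s a] leq_trans leq_iff by blast
  have "cnt s (s \<oplus> d) = cnt s s"
    by (rule ind[of "\<lambda>d. cnt s (s \<oplus> d) = cnt s s"], (intro rep_intros rep_const; simp), simp,
        simp add: cnt_sc it_large)
  moreover have "ln (snoc s a) = sc (cnt s (pr s a))" by (simp only: ln_def cnt_snoc)
  ultimately show ?thesis by (simp only: d ln_def)
qed

lemma ln_zero [simp]: "ln \<zero> = \<zero>" by (simp add: ln_def)

lemma beta_ctx:
  assumes "rep b (\<sigma> # \<Gamma>) \<tau> (\<lambda>xs. F (tl xs) (hd xs))"
  shows "ap \<sigma> \<tau> (Lam \<sigma> \<tau> (F xs)) a = F xs a"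
proof -
  obtain g where g: "\<And>xs. ap \<sigma> \<tau> (apl \<Gamma> (\<sigma> \<leadsto> \<tau>) g (tl xs)) (hd xs) = F (tl xs) (hd xs)"
    using assms unfolding rep_def by auto
  have "ap \<sigma> \<tau> (apl \<Gamma> (\<sigma> \<leadsto> \<tau>) g xs) a = F xs a" for a using g[of "a # xs"] by simp
  then show ?thesis using Lam_eqI[of \<sigma> \<tau> "apl \<Gamma> (\<sigma> \<leadsto> \<tau>) g xs" "F xs"] by simp
qed

end

locale suslin_model = model +
  fixes Su
  assumes Su: "Su \<star> f = \<zero> \<longleftrightarrow> path f"
begin

subsection \<open>Quantifiers and search\<close>

text \<open>The form in which the Suslin functional is used from here on. The flag is lost because
  \<open>Su\<close> is not assumed to be standard.\<close>

lemma decp_path: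
  assumes "decp b (Nt # \<Gamma>) (\<lambda>xs. P (tl xs) (hd xs))"
  shows "decp False \<Gamma> (\<lambda>xs. \<exists>g. \<forall>x. P xs (sg g x))"
proof -
  obtain p where p: "rep b \<Gamma> T1 p" "\<And>xs m. p xs \<bullet> m = (if \<not> P xs m then \<zero> else \<one>)"
    by (rule decp_fun[OF decp_not[OF assms]], rule that)
  have "rep False \<Gamma> T1 p" using p(1) unfolding rep_def by blast
  then have "decp False \<Gamma> (\<lambda>xs. Su \<star> p xs = \<zero>)" by (intro rep_intros rep_const; simp)
  moreover have "p xs \<bullet> m \<noteq> \<zero> \<longleftrightarrow> P xs m" for xs m by (simp add: p(2))
  ultimately show ?thesis unfolding Su path_def by simp
qed

text \<open>A number quantifier is a path quantifier whose condition looks only at the length of the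
  segment, so that the choice of \<open>g\<close> does not matter.\<close>

lemma decp_all [rep_intros]:
  assumes "decp False (Nt # \<Gamma>) (\<lambda>xs. P (tl xs) (hd xs))"
  shows "decp False \<Gamma> (\<lambda>xs. \<forall>n. P xs n)"
proof -
  obtain p where p: "rep False \<Gamma> T1 p" "\<And>xs m. p xs \<bullet> m = (if P xs m then \<zero> else \<one>)"
    by (rule decp_fun[OF assms], rule that)
  have "decp False \<Gamma> (\<lambda>xs. \<exists>g. \<forall>x. p xs \<bullet> ln (sg g x) = \<zero>)"
    by (rule decp_path[of False]) (intro rep_intros rep_tl[OF p(1)] rep_const; simp)
  moreover have "p xs \<bullet> m = \<zero> \<longleftrightarrow> P xs m" for xs m by (simp add: p(2))
  ultimately show ?thesis by simp
qed

lemma decp_ex [rep_intros]: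
  assumes "decp False (Nt # \<Gamma>) (\<lambda>xs. P (tl xs) (hd xs))"
  shows "decp False \<Gamma> (\<lambda>xs. \<exists>n. P xs n)"
  using decp_not[OF decp_all[OF decp_not[OF assms]]] by simp

text \<open>Feferman's search operator, without minimality. Choice of type 1, 0 applies because the
  existential premise has just become decidable.\<close>

lemma search_functional: "\<exists>\<mu>. \<forall>h. (\<exists>y. h \<bullet> y = \<zero>) \<longrightarrow> h \<bullet> (\<mu> \<star> h) = \<zero>"
  by (rule qf_ac_1_0[of "\<lambda>h x. (\<exists>y. h \<bullet> y = \<zero>) \<longrightarrow> h \<bullet> x = \<zero>"])
    ((intro rep_intros rep_const; simp), blast)

definition \<mu> where "\<mu> = (SOME \<mu>. \<forall>h. (\<exists>y. h \<bullet> y = \<zero>) \<longrightarrow> h \<bullet> (\<mu> \<star> h) = \<zero>)"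
lemma \<mu>: "h \<bullet> y = \<zero> \<Longrightarrow> h \<bullet> (\<mu> \<star> h) = \<zero>"
  using someI_ex[OF search_functional] unfolding \<mu>_def by blast

definition Mu where "Mu P = \<mu> \<star> Lam Nt Nt (\<lambda>n. if P n then \<zero> else \<one>)"

lemma rep_Mu [rep_intros]:
  assumes "decp False (Nt # \<Gamma>) (\<lambda>xs. P (tl xs) (hd xs))"
  shows "rep False \<Gamma> Nt (\<lambda>xs. Mu (\<lambda>n. P xs n))"
  unfolding Mu_def using assms[unfolded decp_def] by (intro rep_app rep_Lam rep_const; simp)

lemma Mu: assumes "decp False [Nt] (\<lambda>xs. P (hd xs))" "P x" shows "P (Mu P)"
proof -
  have "Lam Nt Nt (\<lambda>n. if P n then \<zero> else \<one>) \<bullet> m = (if P m then \<zero> else \<one>)" for m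
    by (rule beta[OF assms(1)[unfolded decp_def]])
  then show ?thesis using \<mu>[of "Lam Nt Nt (\<lambda>n. if P n then \<zero> else \<one>)" x] assms(2)
    unfolding Mu_def by (simp split: if_splits)
qed


subsection \<open>Greatest fixed points\<close>

text \<open>The greatest set X such that each y in X is safe and for every a there is b with
  \<open>c y a b\<close> in X.  The witness h codes such a set together with a choice of b.\<close>

definition gcond where
  "gcond safe c y h z \<longleftrightarrow> (let x = fs (fs z); a = sn (fs z); b = sn z in
     h (pr \<zero> y) \<noteq> \<zero> \<and> (h (pr \<zero> x) \<noteq> \<zero> \<longrightarrow> safe x) \<and>
     (h (pr \<zero> x) \<noteq> \<zero> \<and> h (pr (sc x) a) = b \<longrightarrow> h (pr \<zero> (c x a b)) \<noteq> \<zero>))"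

definition gfix where "gfix safe c y \<longleftrightarrow> (\<exists>h. \<forall>z. gcond safe c y ((\<bullet>) h) z)"

text \<open>The condition on h as a condition on its initial segments: the segment of length n is tested at
  the first component of n, provided it is long enough.\<close>

definition gcode where
  "gcode safe c y s \<longleftrightarrow> (let n = ln s; z = fs n; x = fs (fs z); a = sn (fs z); b = sn z in
     pr \<zero> y \<prec> n \<longrightarrow> pr \<zero> x \<prec> n \<longrightarrow> pr (sc x) a \<prec> n \<longrightarrow> pr \<zero> (c x a b) \<prec> n \<longrightarrow>
     gcond safe c y (nth s) z)"

text \<open>Row \<open>\<zero>\<close> of \<open>h\<close> marks the members of the set by nonzero
  values, and row \<open>sc x\<close> stores at \<open>a\<close> the chosen \<open>b\<close>. Since
  \<open>z\<close> also contains \<open>b\<close>, the places at which \<open>h\<close> is inspected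
  depend on \<open>y\<close> and \<open>z\<close> alone, never on values of \<open>h\<close>; this
  is what allows a test on initial segments.\<close>

lemma gcond_cong:
  assumes "h (pr \<zero> y) = h' (pr \<zero> y)" "h (pr \<zero> (fs (fs z))) = h' (pr \<zero> (fs (fs z)))"
    "h (pr (sc (fs (fs z))) (sn (fs z))) = h' (pr (sc (fs (fs z))) (sn (fs z)))"
    "h (pr \<zero> (c (fs (fs z)) (sn (fs z)) (sn z))) = h' (pr \<zero> (c (fs (fs z)) (sn (fs z)) (sn z)))"
  shows "gcond safe c y h z \<longleftrightarrow> gcond safe c y h' z"
  unfolding gcond_def Let_def by (simp only: assms)

lemma gfix_gcode: "gfix safe c y \<longleftrightarrow> (\<exists>h. \<forall>k. gcode safe c y (sg h k))"
proof -
  have 1: "gcode safe c y (sg h k)" if "\<forall>z. gcond safe c y ((\<bullet>) h) z" for h k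
    unfolding gcode_def Let_def ln_sg
    using that[rule_format, of "fs k"] by (intro impI, subst gcond_cong) (simp_all only: nth_sg)
  have 2: "gcond safe c y ((\<bullet>) h) z" if *: "\<forall>k. gcode safe c y (sg h k)" for h z
  proof -
    define x a b where "x = fs (fs z)" and "a = sn (fs z)" and "b = sn z"
    define m where "m = sc (pr \<zero> y) \<oplus> sc (pr \<zero> x) \<oplus> sc (pr (sc x) a) \<oplus> sc (pr \<zero> (c x a b))"
    \<comment> \<open>A length whose first component is \<open>z\<close> and which exceeds all four
      inspected places.\<close>
    define k where "k = pr z m"
    have k: "m \<preceq> k" unfolding k_def by (rule leq_trans[OF leq_padd' leq_pr])
    have "sc (pr \<zero> y) \<preceq> m"
      unfolding m_def by (rule leq_trans[OF leq_trans[OF leq_padd leq_padd] leq_padd])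
    moreover have "sc (pr \<zero> x) \<preceq> m"
      unfolding m_def by (rule leq_trans[OF leq_trans[OF leq_padd' leq_padd] leq_padd])
    moreover have "sc (pr (sc x) a) \<preceq> m"
      unfolding m_def by (rule leq_trans[OF leq_padd' leq_padd])
    moreover have "sc (pr \<zero> (c x a b)) \<preceq> m" unfolding m_def by (rule leq_padd')
    ultimately have p: "pr \<zero> y \<prec> k" "pr \<zero> x \<prec> k" "pr (sc x) a \<prec> k" "pr \<zero> (c x a b) \<prec> k"
      using leq_trans[OF _ k] by simp_all
    have fk: "fs k = z" by (simp add: k_def)
    have "gcond safe c y (nth (sg h k)) z"
      using *[rule_format, of k] p unfolding gcode_def Let_def ln_sg fk x_def a_def b_def by blast
    then show ?thesis using p unfolding x_def a_def b_def
      by (subst (asm) gcond_cong) (simp_all only: nth_sg)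
  qed
  show ?thesis unfolding gfix_def using 1 2 by blast
qed

lemma decp_gfix:
  assumes "decp False (Nt # \<Gamma>) (\<lambda>xs. safe (tl xs) (hd xs))"
    and c: "rep False (Nt # Nt # Nt # \<Gamma>) Nt
      (\<lambda>xs. c (tl (tl (tl xs))) (hd (tl (tl xs))) (hd (tl xs)) (hd xs))"
    and y: "rep False \<Gamma> Nt y"
  shows "decp False \<Gamma> (\<lambda>xs. gfix (safe xs) (c xs) (y xs))"
proof -
  obtain p where p: "rep False \<Gamma> T1 p" "\<And>xs m. p xs \<bullet> m = (if safe xs m then \<zero> else \<one>)"
    by (rule decp_fun[OF assms(1)], rule that)
  have safe: "safe xs m \<longleftrightarrow> p xs \<bullet> m = \<zero>" for xs m by (simp add: p(2))
  \<comment> \<open>The closure rules for \<open>rep\<close> need \<open>c\<close> as iterated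
    application of an object, while it is given as an operation on elements; the object is obtained
    by abstracting one argument after the other.\<close>
  let ?c1 = "\<lambda>xs x a. Lam Nt Nt (\<lambda>b. c xs x a b)"
  let ?c2 = "\<lambda>xs x. Lam Nt T1 (\<lambda>a. ?c1 xs x a)"
  let ?c3 = "\<lambda>xs. Lam Nt (Nt \<leadsto> T1) (\<lambda>x. ?c2 xs x)"
  have c1: "rep False (Nt # Nt # \<Gamma>) T1 (\<lambda>xs. ?c1 (tl (tl xs)) (hd (tl xs)) (hd xs))"
    by (rule rep_Lam, rule c)
  have c2: "rep False (Nt # \<Gamma>) (Nt \<leadsto> T1) (\<lambda>xs. ?c2 (tl xs) (hd xs))"
    by (rule rep_Lam, rule c1)
  have c3: "rep False \<Gamma> (Nt \<leadsto> Nt \<leadsto> T1) ?c3" by (rule rep_Lam, rule c2)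
  have "ap Nt (Nt \<leadsto> T1) (?c3 xs) x = ?c2 xs x" for xs x
    by (rule beta_ctx[OF c2])
  moreover have "ap Nt T1 (?c2 xs x) a = ?c1 xs x a" for xs x a
    using beta_ctx[of False Nt "Nt # \<Gamma>" T1 "\<lambda>ys a. ?c1 (tl ys) (hd ys) a" "x # xs" a] c1 by simp
  moreover have "?c1 xs x a \<bullet> b = c xs x a b" for xs x a b
    using beta_ctx[of False Nt "Nt # Nt # \<Gamma>" Nt "\<lambda>ys b. c (tl (tl ys)) (hd (tl ys)) (hd ys) b" "a # x # xs" b] c
    by simp
  ultimately have cc: "c xs x a b = ap Nt T1 (ap Nt (Nt \<leadsto> T1) (?c3 xs) x) a \<bullet> b" for xs x a b by simp
  obtain C where C: "rep False \<Gamma> (Nt \<leadsto> Nt \<leadsto> T1) C"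
    "\<And>xs x a b. c xs x a b = ap Nt T1 (ap Nt (Nt \<leadsto> T1) (C xs) x) a \<bullet> b"
    using c3 cc by blast
  have "decp False \<Gamma> (\<lambda>xs. \<exists>h. \<forall>k. gcode (safe xs) (c xs) (y xs) (sg h k))"
    unfolding gcode_def gcond_def Let_def safe C(2)
    by (rule decp_path[of False])
      (intro rep_intros rep_tl[OF p(1)] rep_tl[OF C(1)] rep_tl[OF y] rep_const; simp)
  then show ?thesis unfolding gfix_gcode .
qed

text \<open>The same \<open>h\<close> witnesses all chosen successors of \<open>y\<close>, because
  only the first clause of \<open>gcond\<close> mentions the starting point.\<close>

lemma gfix_unfold:
  assumes "gfix safe c y" shows "safe y \<and> (\<forall>a. \<exists>b. gfix safe c (c y a b))"
proof -
  obtain h where h: "\<And>z. gcond safe c y ((\<bullet>) h) z" using assms unfolding gfix_def by blast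
  have g: "h \<bullet> pr \<zero> y \<noteq> \<zero>" "h \<bullet> pr \<zero> x \<noteq> \<zero> \<longrightarrow> safe x"
    "h \<bullet> pr \<zero> x \<noteq> \<zero> \<longrightarrow> h \<bullet> pr \<zero> (c x a (h \<bullet> pr (sc x) a)) \<noteq> \<zero>" for x a
    using h[of "pr (pr x a) (h \<bullet> pr (sc x) a)"] unfolding gcond_def Let_def by simp_all
  have "gfix safe c (c y a (h \<bullet> pr (sc y) a))" for a
    unfolding gfix_def using g h unfolding gcond_def Let_def by (intro exI[of _ h]) simp
  then show ?thesis using g by blast
qed

text \<open>A decidable set that is closed in the required sense becomes a witness once suitable
  \<open>b\<close> are found. The search \<open>Mu\<close> finds them uniformly in \<open>x\<close>
  and \<open>a\<close>, so that they can be stored in one function.\<close>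

lemma gfix_coinduct:
  assumes c: "rep False [Nt, Nt, Nt] Nt (\<lambda>xs. c (hd (tl (tl xs))) (hd (tl xs)) (hd xs))"
    and Y: "decp False [Nt] (\<lambda>xs. Y (hd xs))"
    and step: "\<And>y. Y y \<Longrightarrow> safe y \<and> (\<forall>a. \<exists>b. Y (c y a b))" and "Y y"
  shows "gfix safe c y"
proof -
  obtain p where p: "\<And>n. p \<bullet> n = (if Y n then \<zero> else \<one>)"
    using rep_hdD[of False Nt Nt "\<lambda>n. if Y n then \<zero> else \<one>"] Y unfolding decp_def by auto
  have Yp: "Y n \<longleftrightarrow> p \<bullet> n = \<zero>" for n by (simp add: p)
  obtain C where "\<And>xs. ap Nt T1 (ap Nt (Nt \<leadsto> T1) C (hd (tl (tl xs)))) (hd (tl xs)) \<bullet> hd xs =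
      c (hd (tl (tl xs))) (hd (tl xs)) (hd xs)"
    using c unfolding rep_def by auto
  from this[of "[_, _, _]"] have C: "ap Nt T1 (ap Nt (Nt \<leadsto> T1) C x) a \<bullet> b = c x a b" for x a b by simp
  define B where "B x a = Mu (\<lambda>b. p \<bullet> (ap Nt T1 (ap Nt (Nt \<leadsto> T1) C x) a \<bullet> b) = \<zero>)" for x a
  have B: "Y (c x a (B x a))" if x: "Y x" for x a
  proof -
    obtain b where "Y (c x a b)" using step[OF x] by blast
    then have "p \<bullet> (ap Nt T1 (ap Nt (Nt \<leadsto> T1) C x) a \<bullet> b) = \<zero>" by (simp only: Yp C)
    then have "p \<bullet> (ap Nt T1 (ap Nt (Nt \<leadsto> T1) C x) a \<bullet> B x a) = \<zero>"
      unfolding B_def by (rule Mu[rotated]) (intro rep_intros rep_const; simp)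
    then show ?thesis by (simp add: Yp C)
  qed
  define h where "h = Lam Nt Nt (\<lambda>i. if fs i = \<zero> then if p \<bullet> sn i = \<zero> then \<one> else \<zero>
     else B (pd (fs i)) (sn i))"
  have h: "h \<bullet> i = (if fs i = \<zero> then if p \<bullet> sn i = \<zero> then \<one> else \<zero> else B (pd (fs i)) (sn i))" for i
    unfolding h_def B_def by (rule beta[of False]) (intro rep_intros rep_const; simp)
  have hY: "h \<bullet> pr \<zero> x \<noteq> \<zero> \<longleftrightarrow> Y x" and hB: "h \<bullet> pr (sc x) a = B x a" for x a
    using Yp by (simp_all add: h)
  have "gcond safe c y ((\<bullet>) h) z" for z
    unfolding gcond_def Let_def hY hB
  proof (intro conjI impI)
    assume "Y (fs (fs z)) \<and> B (fs (fs z)) (sn (fs z)) = sn z"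
    then show "Y (c (fs (fs z)) (sn (fs z)) (sn z))" using B[of "fs (fs z)" "sn (fs z)"] by simp
  qed (use step \<open>Y y\<close> in blast)+
  then show ?thesis unfolding gfix_def by blast
qed

text \<open>Coinduction for the fixed point enlarged by \<open>y\<close>; this set is decidable
  because the fixed point itself is.\<close>

lemma gfix_fold:
  assumes c: "rep False [Nt, Nt, Nt] Nt (\<lambda>xs. c (hd (tl (tl xs))) (hd (tl xs)) (hd xs))"
    and safe: "decp False [Nt] (\<lambda>xs. safe (hd xs))"
    and "safe y" "\<forall>a. \<exists>b. gfix safe c (c y a b)"
  shows "gfix safe c y"
proof -
  have "decp False [Nt] (\<lambda>xs. gfix safe c (hd xs))"
  proof (rule decp_gfix)
    obtain p where "\<And>n. p \<bullet> n = (if safe n then \<zero> else \<one>)"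
      using rep_hdD[of False Nt Nt "\<lambda>n. if safe n then \<zero> else \<one>"] safe unfolding decp_def by auto
    then have "safe n \<longleftrightarrow> p \<bullet> n = \<zero>" for n by simp
    then show "decp False [Nt, Nt] (\<lambda>xs. safe (hd xs))" by simp (intro rep_intros rep_const; simp)
    obtain C where "\<And>xs. ap Nt T1 (ap Nt (Nt \<leadsto> T1) C (hd (tl (tl xs)))) (hd (tl xs)) \<bullet> hd xs =
        c (hd (tl (tl xs))) (hd (tl xs)) (hd xs)"
      using c unfolding rep_def by auto
    from this[of "[_, _, _]"] have "c x a b = ap Nt T1 (ap Nt (Nt \<leadsto> T1) C x) a \<bullet> b" for x a b by simp
    then show "rep False [Nt, Nt, Nt, Nt] Nt (\<lambda>xs. c (hd (tl (tl xs))) (hd (tl xs)) (hd xs))"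
      by simp (intro rep_intros rep_const; simp)
  qed (rule rep_hd)
  then have *: "decp False [Nt] (\<lambda>xs. hd xs = y \<or> gfix safe c (hd xs))"
    by (intro decp_disj) (intro rep_intros rep_const; simp)
  show ?thesis
  proof (rule gfix_coinduct[OF c, of "\<lambda>z. z = y \<or> gfix safe c z", OF *])
    fix z assume "z = y \<or> gfix safe c z"
    then have "safe z \<and> (\<forall>a. \<exists>b. gfix safe c (c z a b))" using assms(3,4) gfix_unfold[of safe c z] by auto
    then show "safe z \<and> (\<forall>a. \<exists>b. c z a b = y \<or> gfix safe c (c z a b))" by blast
  qed simp
qed

end

context suslin_model
begin

subsection \<open>Determinacy\<close>

definition move where "move s a b = (if odd (ln s) then snoc s b else snoc s a)"

lemma move [simp]: "odd (ln s) \<Longrightarrow> move s a b = snoc s b" "\<not> odd (ln s) \<Longrightarrow> move s a b = snoc s a"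
  by (simp_all add: move_def)

lemma rep_move [rep_intros]: "rep b \<Gamma> Nt F \<Longrightarrow> rep b \<Gamma> Nt G \<Longrightarrow> rep b \<Gamma> Nt H \<Longrightarrow>
    rep b \<Gamma> Nt (\<lambda>xs. move (F xs) (G xs) (H xs))"
  unfolding move_def by (intro rep_intros; (assumption | (rule rep_const, simp)))

text \<open>\<open>lost f s\<close>: player 1 has a winning strategy from the position s.  The move of the player
  whose turn it is not is ignored by \<open>move\<close>.\<close>

definition lost where "lost f s \<longleftrightarrow> gfix (\<lambda>s. f \<bullet> s \<noteq> \<zero>) move s"

lemma rep_lost [rep_intros]:
  assumes "rep False \<Gamma> T1 F" "rep False \<Gamma> Nt G"
  shows "decp False \<Gamma> (\<lambda>xs. lost (F xs) (G xs))"
  unfolding lost_def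
  by (rule decp_gfix) (intro rep_intros rep_tl[OF assms(1)] assms rep_const; simp)+

lemma lost_unfold: "lost f s \<Longrightarrow> f \<bullet> s \<noteq> \<zero> \<and> (\<forall>a. \<exists>b. lost f (move s a b))"
  unfolding lost_def using gfix_unfold[of "\<lambda>s. f \<bullet> s \<noteq> \<zero>" move s] by blast

lemma lost_fold:
  assumes "f \<bullet> s \<noteq> \<zero>" "\<forall>a. \<exists>b. lost f (move s a b)" shows "lost f s"
  using assms unfolding lost_def by (intro gfix_fold) (intro rep_intros rep_const; simp)+

lemma lost_coinduct:
  assumes "decp False [Nt] (\<lambda>xs. Y (hd xs))" "Y s"
    and "\<And>s. Y s \<Longrightarrow> f \<bullet> s \<noteq> \<zero> \<and> (\<forall>a. \<exists>b. Y (move s a b))"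
  shows "lost f s"
  unfolding lost_def
  by (rule gfix_coinduct[of move Y, OF _ assms(1) assms(3) assms(2)])
    (intro rep_intros rep_const; simp)

text \<open>The complement of a greatest fixed point is inductively generated, so coinduction for
  the complement of \<open>X\<close> is an induction over the positions won by player 0. It takes
  the place of induction on ranks.\<close>

lemma not_lost_induct:
  assumes "decp False [Nt] (\<lambda>xs. X (hd xs))" "\<not> lost f s"
    and "\<And>s. f \<bullet> s = \<zero> \<Longrightarrow> X s"
    and "\<And>s. odd (ln s) \<Longrightarrow> (\<And>a. X (snoc s a)) \<Longrightarrow> X s"
    and "\<And>s a. \<not> odd (ln s) \<Longrightarrow> X (snoc s a) \<Longrightarrow> X s"
  shows "X s"
proof (rule ccontr)
  assume s: "\<not> X s"
  have "lost f s"
  proof (rule lost_coinduct[of "\<lambda>s. \<not> X s"])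
    show "decp False [Nt] (\<lambda>xs. \<not> X (hd xs))" using assms(1) by (rule decp_not)
    fix s assume s: "\<not> X s"
    show "f \<bullet> s \<noteq> \<zero> \<and> (\<forall>a. \<exists>b. \<not> X (move s a b))"
    proof (cases "odd (ln s)")
      case True
      then have "\<exists>b. \<not> X (snoc s b)" using s assms(4) by blast
      then show ?thesis using True s assms(3) by auto
    next
      case False
      then have "\<not> X (snoc s a)" for a using s assms(5) by blast
      then show ?thesis using False s assms(3) by auto
    qed
  qed (rule s)
  then show False using assms(2) by blast
qed

text \<open>\<open>faster f s t\<close> compares the ranks of two positions with the same player to move: player 0,
  starting at s, can win at least as fast as at t.  A round of the comparison consists of one move
  in each position: at odd lengths the move at t answers the one at s, at even lengths the move at s
  answers the one at t.\<close>

definition move2 where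
  "move2 f y a b = (if f \<bullet> fs y = \<zero> then y
     else if odd (ln (fs y)) then pr (snoc (fs y) a) (snoc (sn y) b)
     else pr (snoc (fs y) b) (snoc (sn y) a))"

definition faster where
  "faster f s t \<longleftrightarrow> gfix (\<lambda>y. f \<bullet> fs y = \<zero> \<or> f \<bullet> sn y \<noteq> \<zero>) (move2 f) (pr s t)"

lemma rep_move2 [rep_intros]:
  "rep b \<Gamma> T1 F \<Longrightarrow> rep b \<Gamma> Nt Y \<Longrightarrow> rep b \<Gamma> Nt G \<Longrightarrow> rep b \<Gamma> Nt H \<Longrightarrow>
    rep b \<Gamma> Nt (\<lambda>xs. move2 (F xs) (Y xs) (G xs) (H xs))"
  unfolding move2_def by (intro rep_intros; (assumption | (rule rep_const, simp)))

lemma rep_faster [rep_intros]: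
  assumes "rep False \<Gamma> T1 F" "rep False \<Gamma> Nt G" "rep False \<Gamma> Nt H"
  shows "decp False \<Gamma> (\<lambda>xs. faster (F xs) (G xs) (H xs))"
  unfolding faster_def
  by (rule decp_gfix)
    (intro rep_intros rep_tl[OF assms(1)] rep_tl[OF rep_tl[OF rep_tl[OF assms(1)]]] assms rep_const; simp)+

definition faster_step where
  "faster_step f Y s t \<longleftrightarrow> f \<bullet> s = \<zero> \<or> f \<bullet> t \<noteq> \<zero> \<and>
     (if odd (ln s) then \<forall>a. \<exists>b. Y (snoc s a) (snoc t b) else \<forall>a. \<exists>b. Y (snoc s b) (snoc t a))"

lemma faster_unfold: "faster f s t \<Longrightarrow> faster_step f (faster f) s t"
  unfolding faster_def faster_step_def
  by (drule gfix_unfold) (auto simp: move2_def split: if_splits)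

lemma faster_fold: assumes "faster_step f (faster f) s t" shows "faster f s t"
  unfolding faster_def
proof (rule gfix_fold)
  show "f \<bullet> fs (pr s t) = \<zero> \<or> f \<bullet> sn (pr s t) \<noteq> \<zero>"
    using assms by (auto simp: faster_step_def)
  show "\<forall>a. \<exists>b. gfix (\<lambda>y. f \<bullet> fs y = \<zero> \<or> f \<bullet> sn y \<noteq> \<zero>) (move2 f) (move2 f (pr s t) a b)"
  proof (cases "f \<bullet> s = \<zero>")
    case True
    \<comment> \<open>Pairs whose first position is already won are safe and left unchanged by
      \<open>move2\<close>, so they form a closed set.\<close>
    have "gfix (\<lambda>y. f \<bullet> fs y = \<zero> \<or> f \<bullet> sn y \<noteq> \<zero>) (move2 f) (pr s t)"
      by (rule gfix_coinduct[of _ "\<lambda>y. f \<bullet> fs y = \<zero>"])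
        ((intro rep_intros rep_const; simp), (intro rep_intros rep_const; simp),
          simp_all add: True move2_def)
    then show ?thesis using True by (simp add: move2_def)
  next
    case False
    then show ?thesis using assms
      by (auto simp: faster_step_def faster_def move2_def split: if_splits)
  qed
qed (intro rep_intros rep_const; simp)+

lemma faster_coinduct:
  assumes "decp False [Nt, Nt] (\<lambda>xs. Y (hd (tl xs)) (hd xs))" "Y s t"
    and step: "\<And>s t. Y s t \<Longrightarrow> faster_step f Y s t"
  shows "faster f s t"
proof -
  obtain g where "\<And>xs. ap Nt T1 g (hd (tl xs)) \<bullet> hd xs = (if Y (hd (tl xs)) (hd xs) then \<zero> else \<one>)"
    using assms(1) unfolding decp_def rep_def by auto
  from this[of "[_, _]"] have g: "ap Nt T1 g s \<bullet> t = (if Y s t then \<zero> else \<one>)" for s t by simp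
  then have Y: "Y s t \<longleftrightarrow> ap Nt T1 g s \<bullet> t = \<zero>" for s t by simp
  show ?thesis unfolding faster_def
  proof (rule gfix_coinduct[of _ "\<lambda>y. Y (fs y) (sn y)"])
    show "decp False [Nt] (\<lambda>xs. Y (fs (hd xs)) (sn (hd xs)))"
      unfolding Y by (intro rep_intros rep_const; simp)
    fix y assume y: "Y (fs y) (sn y)"
    from step[OF y] show "(f \<bullet> fs y = \<zero> \<or> f \<bullet> sn y \<noteq> \<zero>) \<and>
        (\<forall>a. \<exists>b. Y (fs (move2 f y a b)) (sn (move2 f y a b)))"
      using y by (auto simp: faster_step_def move2_def split: if_splits)
  qed ((intro rep_intros rep_const; simp), simp add: assms(2))
qed

lemma faster_refl: "faster f s s"
  by (rule faster_coinduct[of "\<lambda>s t. s = t"])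
    ((intro rep_intros rep_const; simp), auto simp: faster_step_def)

text \<open>Coinduction for the composed relation: the answer in one comparison is passed on as a
  challenge to the other. The order of moves in a round depends on the parity of the first position,
  so the intermediate position must have the same parity. Equality of parities is split into two
  implications to fit the closure rules of \<open>decp\<close>.\<close>

lemma faster_trans:
  assumes "faster f s t" "faster f t u" "odd (ln s) = odd (ln t)"
  shows "faster f s u"
proof (rule faster_coinduct[of "\<lambda>s u. \<exists>t. (odd (ln s) \<longrightarrow> odd (ln t)) \<and> (odd (ln t) \<longrightarrow> odd (ln s)) \<and>
    faster f s t \<and> faster f t u"])
  fix s u
  assume "\<exists>t. (odd (ln s) \<longrightarrow> odd (ln t)) \<and> (odd (ln t) \<longrightarrow> odd (ln s)) \<and> faster f s t \<and> faster f t u"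
  then obtain t where t: "odd (ln s) = odd (ln t)" "faster f s t" "faster f t u" by blast
  note 1 = faster_unfold[OF t(2)] and 2 = faster_unfold[OF t(3)]
  let ?Y = "\<lambda>s u. \<exists>t. (odd (ln s) \<longrightarrow> odd (ln t)) \<and> (odd (ln t) \<longrightarrow> odd (ln s)) \<and> faster f s t \<and> faster f t u"
  show "faster_step f ?Y s u"
  proof (cases "f \<bullet> s = \<zero>")
    case True
    then show ?thesis by (simp add: faster_step_def)
  next
    case s: False
    then have tu: "f \<bullet> t \<noteq> \<zero>" "f \<bullet> u \<noteq> \<zero>" using 1 2 by (auto simp: faster_step_def)
    show ?thesis
    proof (cases "odd (ln s)")
      case True
      have "\<exists>b. ?Y (snoc s a) (snoc u b)" for a
      proof -
        obtain b where b: "faster f (snoc s a) (snoc t b)" using 1 s True by (auto simp: faster_step_def)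
        obtain c where "faster f (snoc t b) (snoc u c)" using 2 tu t(1) True by (auto simp: faster_step_def)
        then show ?thesis using b t(1) by (intro exI[of _ c] exI[of _ "snoc t b"]) simp
      qed
      then show ?thesis using tu True unfolding faster_step_def by simp
    next
      case False
      have "\<exists>b. ?Y (snoc s b) (snoc u a)" for a
      proof -
        obtain b where b: "faster f (snoc t b) (snoc u a)" using 2 tu t(1) False by (auto simp: faster_step_def)
        obtain c where "faster f (snoc s c) (snoc t b)" using 1 s False by (auto simp: faster_step_def)
        then show ?thesis using b t(1) by (intro exI[of _ c] exI[of _ "snoc t b"]) simp
      qed
      then show ?thesis using tu False unfolding faster_step_def by simp
    qed
  qed
next
  show "decp False [Nt, Nt] (\<lambda>xs. \<exists>t. (odd (ln (hd (tl xs))) \<longrightarrow> odd (ln t)) \<and>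
     (odd (ln t) \<longrightarrow> odd (ln (hd (tl xs)))) \<and> faster f (hd (tl xs)) t \<and> faster f t (hd xs))"
    by (intro rep_intros rep_const; simp)
qed (use assms in blast)

text \<open>Player 1 defends \<open>t\<close> by imitating a defence of \<open>s\<close>: moves of
  player 0 at \<open>t\<close> are answered at \<open>s\<close> through the comparison, and safe
  moves of player 1 at \<open>s\<close> are carried over to \<open>t\<close>.\<close>

lemma faster_lost:
  assumes "faster f s t" "lost f s" "odd (ln s) = odd (ln t)"
  shows "lost f t"
proof (rule lost_coinduct[of "\<lambda>t. \<exists>s. (odd (ln s) \<longrightarrow> odd (ln t)) \<and> (odd (ln t) \<longrightarrow> odd (ln s)) \<and>
    lost f s \<and> faster f s t"])
  let ?Y = "\<lambda>t. \<exists>s. (odd (ln s) \<longrightarrow> odd (ln t)) \<and> (odd (ln t) \<longrightarrow> odd (ln s)) \<and> lost f s \<and> faster f s t"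
  fix t assume "?Y t"
  then obtain s where s: "odd (ln s) = odd (ln t)" "lost f s" "faster f s t" by blast
  note 1 = lost_unfold[OF s(2)] and 2 = faster_unfold[OF s(3)]
  have t: "f \<bullet> t \<noteq> \<zero>" using 1 2 by (auto simp: faster_step_def)
  show "f \<bullet> t \<noteq> \<zero> \<and> (\<forall>a. \<exists>b. ?Y (move t a b))"
  proof (cases "odd (ln t)")
    case True
    then obtain b where b: "lost f (snoc s b)" using 1 s(1) by auto
    obtain c where "faster f (snoc s b) (snoc t c)"
      using 1 2 s(1) True by (auto simp: faster_step_def)
    then have "?Y (snoc t c)" using b s(1) by (intro exI[of _ "snoc s b"]) simp
    then show ?thesis using t True by auto
  next
    case False
    have "?Y (snoc t a)" for a
    proof -
      obtain b where b: "faster f (snoc s b) (snoc t a)"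
        using 1 2 s(1) False by (auto simp: faster_step_def)
      moreover have "lost f (snoc s b)" using 1 s(1) False by simp
      ultimately show ?thesis using s(1) by (intro exI[of _ "snoc s b"]) simp
    qed
    then show ?thesis using t False by auto
  qed
next
  show "decp False [Nt] (\<lambda>xs. \<exists>s. (odd (ln s) \<longrightarrow> odd (ln (hd xs))) \<and>
     (odd (ln (hd xs)) \<longrightarrow> odd (ln s)) \<and> lost f s \<and> faster f s (hd xs))"
    by (intro rep_intros rep_const; simp)
qed (use assms in blast)

end

section \<open>Well-foundedness of the rank comparison, and the two strategies\<close>

context suslin_model
begin

lemma faster_zero: "f \<bullet> s = \<zero> \<Longrightarrow> faster f s t"
  by (rule faster_fold) (simp add: faster_step_def)

text \<open>Only the last two entries of a segment are tested, which gives the existence of a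
  descending sequence the form decided by \<open>decp_path\<close>. The case
  \<open>ini s = \<zero>\<close> is the segment of length one, whose entry is the start
  \<open>t\<close>.\<close>

definition dcode where
  "dcode f t s \<longleftrightarrow> (s \<noteq> \<zero> \<longrightarrow>
     (odd (ln (lst s)) \<longrightarrow> odd (ln t)) \<and> (odd (ln t) \<longrightarrow> odd (ln (lst s))) \<and>
     (ini s = \<zero> \<longrightarrow> lst s = t) \<and> (ini s \<noteq> \<zero> \<longrightarrow> \<not> faster f (lst (ini s)) (lst s)))"

text \<open>\<open>desc f t\<close>: an infinite sequence of positions of strictly decreasing rank starts at t.\<close>

definition desc where "desc f t \<longleftrightarrow> (\<exists>h. \<forall>k. dcode f t (sg h k))"

lemma desc_iff: "desc f t \<longleftrightarrow> (\<exists>h. h \<bullet> \<zero> = t \<and>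
    (\<forall>n. (odd (ln (h \<bullet> n)) \<longleftrightarrow> odd (ln t)) \<and> \<not> faster f (h \<bullet> n) (h \<bullet> sc n)))"
proof -
  have "(\<forall>k. dcode f t (sg h k)) \<longleftrightarrow> h \<bullet> \<zero> = t \<and>
    (\<forall>n. (odd (ln (h \<bullet> n)) \<longleftrightarrow> odd (ln t)) \<and> \<not> faster f (h \<bullet> n) (h \<bullet> sc n))" (is "?l \<longleftrightarrow> ?r") for h
  proof
    assume l: ?l
    have 1: "odd (ln (h \<bullet> n)) \<longleftrightarrow> odd (ln t)" for n
      using l[rule_format, of "sc n"] by (auto simp: dcode_def)
    have 2: "h \<bullet> \<zero> = t" using l[rule_format, of \<one>] by (simp add: dcode_def)
    have "\<not> faster f (h \<bullet> n) (h \<bullet> sc n)" for n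
      using l[rule_format, of "sc (sc n)"] by (simp add: dcode_def)
    then show ?r using 1 2 by blast
  next
    assume r: ?r
    have "dcode f t (sg h k)" for k
    proof (cases k rule: nat_cases')
      case 1
      then show ?thesis by (simp add: dcode_def)
    next
      case (2 m)
      show ?thesis
      proof (cases m rule: nat_cases')
        case 1
        then show ?thesis using 2 r by (simp add: dcode_def)
      next
        case (2 n)
        then show ?thesis using \<open>k = sc m\<close> r by (simp add: dcode_def)
      qed
    qed
    then show ?l by blast
  qed
  then show ?thesis unfolding desc_def by simp
qed

lemma decp_desc: "decp False [Nt] (\<lambda>xs. desc f (hd xs))"
  unfolding desc_def dcode_def
  by (rule decp_path[of False]) (intro rep_intros rep_const; simp)

text \<open>Well-foundedness of ranks without ordinals: a descending sequence from \<open>t\<close>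
  is turned, by one move at every entry, into a descending sequence from a successor of
  \<open>t\<close> covered by the induction hypothesis.\<close>

lemma no_desc: assumes "\<not> lost f t" shows "\<not> desc f t"
proof (rule not_lost_induct[of "\<lambda>t. \<not> desc f t", OF decp_not[OF decp_desc] assms])
  fix t assume "f \<bullet> t = \<zero>"
  then show "\<not> desc f t" unfolding desc_iff using faster_zero by blast
next
  fix t assume t: "odd (ln t)" and IH: "\<And>a. \<not> desc f (snoc t a)"
  show "\<not> desc f t"
  proof
    assume "desc f t"
    then obtain h where h: "h \<bullet> \<zero> = t" "\<And>n. odd (ln (h \<bullet> n))" "\<And>n. \<not> faster f (h \<bullet> n) (h \<bullet> sc n)"
      unfolding desc_iff using t by auto
    \<comment> \<open>A move of player 1 at entry \<open>n\<close> that no move at the next entry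
      can answer. In particular \<open>B (sc n)\<close> does not answer it, so the extended entries
      descend again.\<close>
    define B where "B n = Mu (\<lambda>b. \<forall>c. \<not> faster f (snoc (h \<bullet> n) b) (snoc (h \<bullet> sc n) c))" for n
    have B: "\<not> faster f (snoc (h \<bullet> n) (B n)) (snoc (h \<bullet> sc n) c)" for n c
    proof -
      have "\<not> faster_step f (faster f) (h \<bullet> n) (h \<bullet> sc n)" using h(3) faster_fold by blast
      \<comment> \<open>A position already won is at least as fast as every other and cannot occur
        in a descending sequence. So the comparison fails because of the moves.\<close>
      moreover have "f \<bullet> (h \<bullet> sc n) \<noteq> \<zero>" using h(3)[of "sc n"] faster_zero by blast
      ultimately obtain b where b: "\<forall>c. \<not> faster f (snoc (h \<bullet> n) b) (snoc (h \<bullet> sc n) c)"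
        using h(2) unfolding faster_step_def by auto
      have "\<forall>c. \<not> faster f (snoc (h \<bullet> n) (B n)) (snoc (h \<bullet> sc n) c)"
        unfolding B_def
        by (rule Mu[of "\<lambda>b. \<forall>c. \<not> faster f (snoc (h \<bullet> n) b) (snoc (h \<bullet> sc n) c)", OF _ b])
          (intro rep_intros rep_const; simp)
      then show ?thesis by blast
    qed
    define g where "g = Lam Nt Nt (\<lambda>n. snoc (h \<bullet> n) (B n))"
    have g: "g \<bullet> n = snoc (h \<bullet> n) (B n)" for n
      unfolding g_def B_def by (rule beta[of False]) (intro rep_intros rep_const; simp)
    have "desc f (snoc t (B \<zero>))"
      unfolding desc_iff by (rule exI[of _ g]) (simp add: g B h t)
    then show False using IH by blast
  qed
next
  fix t d assume t: "\<not> odd (ln t)" and IH: "\<not> desc f (snoc t d)"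
  show "\<not> desc f t"
  proof
    assume "desc f t"
    then obtain h where h: "h \<bullet> \<zero> = t" "\<And>n. \<not> odd (ln (h \<bullet> n))" "\<And>n. \<not> faster f (h \<bullet> n) (h \<bullet> sc n)"
      unfolding desc_iff using t by auto
    define A where "A n = Mu (\<lambda>a. \<forall>b. \<not> faster f (snoc (h \<bullet> n) b) (snoc (h \<bullet> sc n) a))" for n
    have A: "\<not> faster f (snoc (h \<bullet> n) b) (snoc (h \<bullet> sc n) (A n))" for n b
    proof -
      have "\<not> faster_step f (faster f) (h \<bullet> n) (h \<bullet> sc n)" using h(3) faster_fold by blast
      moreover have "f \<bullet> (h \<bullet> sc n) \<noteq> \<zero>" using h(3)[of "sc n"] faster_zero by blast
      ultimately obtain a where a: "\<forall>b. \<not> faster f (snoc (h \<bullet> n) b) (snoc (h \<bullet> sc n) a)"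
        using h(2) unfolding faster_step_def by auto
      have "\<forall>b. \<not> faster f (snoc (h \<bullet> n) b) (snoc (h \<bullet> sc n) (A n))"
        unfolding A_def
        by (rule Mu[of "\<lambda>a. \<forall>b. \<not> faster f (snoc (h \<bullet> n) b) (snoc (h \<bullet> sc n) a)", OF _ a])
          (intro rep_intros rep_const; simp)
      then show ?thesis by blast
    qed
    \<comment> \<open>With player 0 to move, the challenge \<open>A n\<close> belongs to entry
      \<open>n + 1\<close> and defeats every move at entry \<open>n\<close>. Hence the shift by
      \<open>pd\<close>, and the freedom to start with the move \<open>d\<close> of the induction
      hypothesis.\<close>
    define g where "g = Lam Nt Nt (\<lambda>n. snoc (h \<bullet> n) (if n = \<zero> then d else A (pd n)))"
    have g: "g \<bullet> n = snoc (h \<bullet> n) (if n = \<zero> then d else A (pd n))" for n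
      unfolding g_def A_def by (rule beta[of False]) (intro rep_intros rep_const; simp)
    have "desc f (snoc t d)"
      unfolding desc_iff by (rule exI[of _ g]) (simp add: g A h t)
    then show False using IH by blast
  qed
qed

lemma not_lost_cases: "\<not> lost f s \<Longrightarrow> f \<bullet> s = \<zero> \<or> (\<exists>a. \<forall>b. \<not> lost f (move s a b))"
  using lost_fold by blast

text \<open>Without a minimal move, a search finds a strictly better one for each move. Iterating it
  from a move \<open>a\<close> that keeps the win gives a descending sequence, which
  \<open>no_desc\<close> forbids from such a start.\<close>

lemma minimal_move:
  assumes s: "\<not> lost f s" "\<not> odd (ln s)" "f \<bullet> s \<noteq> \<zero>"
  shows "\<exists>c. \<forall>d. faster f (snoc s c) (snoc s d)"
proof (rule ccontr)
  assume "\<not> ?thesis"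
  then have no: "\<exists>d. \<not> faster f (snoc s c) (snoc s d)" for c by blast
  obtain a where a: "\<not> lost f (snoc s a)" using not_lost_cases[OF s(1)] s by auto
  define D where "D c = Mu (\<lambda>d. \<not> faster f (snoc s c) (snoc s d))" for c
  have D: "\<not> faster f (snoc s c) (snoc s (D c))" for c
  proof -
    obtain d where d: "\<not> faster f (snoc s c) (snoc s d)" using no by blast
    show ?thesis unfolding D_def
      by (rule Mu[of "\<lambda>d. \<not> faster f (snoc s c) (snoc s d)", OF _ d])
        (intro rep_intros rep_const; simp)
  qed
  define r where "r n = rcf n a (\<lambda>r m. D r)" for n
  have r: "r \<zero> = a" "r (sc n) = D (r n)" for n
    unfolding r_def D_def by (simp, rule rcf_sc[of False]) (intro rep_intros rep_const; simp)
  define h where "h = Lam Nt Nt (\<lambda>n. snoc s (r n))"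
  have h: "h \<bullet> n = snoc s (r n)" for n
    unfolding h_def r_def D_def by (rule beta[of False]) (intro rep_intros rep_const; simp)
  have "desc f (snoc s a)"
    unfolding desc_iff by (rule exI[of _ h]) (simp add: h r D)
  then show False using no_desc a by blast
qed

definition strategy0 where "strategy0 f s = Mu (\<lambda>c. \<forall>d. faster f (snoc s c) (snoc s d))"
definition strategy1 where "strategy1 f s = Mu (\<lambda>a. lost f (snoc s a))"

lemma rep_strategies [rep_intros]:
  assumes "rep False \<Gamma> T1 F" "rep False \<Gamma> Nt G"
  shows "rep False \<Gamma> Nt (\<lambda>xs. strategy0 (F xs) (G xs))" "rep False \<Gamma> Nt (\<lambda>xs. strategy1 (F xs) (G xs))"
  unfolding strategy0_def strategy1_def
  by (intro rep_intros rep_tl[OF assms(1)] rep_tl[OF assms(2)] rep_tl[OF rep_tl[OF assms(1)]]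
      rep_tl[OF rep_tl[OF assms(2)]] rep_const; simp)+

lemma player1_wins:
  assumes "lost f \<zero>" and T: "\<And>s. T \<bullet> s = strategy1 f s" shows "\<not> wins S T f"
proof -
  have "f \<bullet> sg h k \<noteq> \<zero>" if h: "play S T h" for h k
  proof -
    have "lost f (sg h n)" for n
    proof (rule ind[of "\<lambda>n. lost f (sg h n)"], (intro rep_intros rep_const; simp))
      fix n assume IH: "lost f (sg h n)"
      note 1 = lost_unfold[OF IH]
      show "lost f (sg h (sc n))"
      proof (cases "odd n")
        case True
        then obtain b where b: "lost f (snoc (sg h n) b)" using 1 by auto
        have "lost f (snoc (sg h n) (strategy1 f (sg h n)))"
          unfolding strategy1_def
          by (rule Mu[of "\<lambda>a. lost f (snoc (sg h n) a)", OF _ b])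
            (intro rep_intros rep_const; simp)
        moreover have "h \<bullet> n = T \<bullet> sg h n"
          using h even_odd_cases[of n] True unfolding play_def by (metis (full_types))
        ultimately show ?thesis by (simp add: T)
      next
        case False
        then show ?thesis using 1 by simp
      qed
    qed (simp add: assms(1))
    then show ?thesis using lost_unfold by blast
  qed
  then show ?thesis unfolding wins_def by blast
qed

text \<open>Suppose the play against \<open>T\<close> never reaches a zero of \<open>f\<close>. A
  position of the play that were at least as fast as some \<open>t\<close> would stay so while
  \<open>t\<close> is followed down to a zero of \<open>f\<close>, and there the comparison fails.
  Hence no position of the play is at least as fast as any \<open>t\<close> of equal parity that
  player 0 wins, although the empty position is as fast as itself.\<close>

lemma player0_wins:
  assumes "\<not> lost f \<zero>" and S: "\<And>s. S \<bullet> s = strategy0 f s" shows "wins S T f"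
proof (rule ccontr)
  assume no: "\<not> wins S T f"
  define h where "h = outcome S T"
  have h: "play S T h" unfolding h_def by (rule play_outcome)
  have f: "f \<bullet> sg h k \<noteq> \<zero>" for k using no h unfolding wins_def by blast
  have minimal: "faster f (sg h (sc n)) (snoc (sg h n) d)"
    if n: "\<not> odd n" "\<not> lost f (sg h n)" for n d
  proof -
    obtain c where c: "\<forall>d. faster f (snoc (sg h n) c) (snoc (sg h n) d)"
      using minimal_move[OF n(2)] n(1) f by auto
    have "\<forall>d. faster f (snoc (sg h n) (strategy0 f (sg h n))) (snoc (sg h n) d)"
      unfolding strategy0_def
      by (rule Mu[of "\<lambda>c. \<forall>d. faster f (snoc (sg h n) c) (snoc (sg h n) d)", OF _ c])
        (intro rep_intros rep_const; simp)
    moreover have "h \<bullet> n = S \<bullet> sg h n"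
      using h even_odd_cases[of n] n(1) unfolding play_def by (metis (full_types))
    ultimately show ?thesis by (simp add: S)
  qed
  have not_lost: "\<not> lost f (sg h n)" for n
  proof (rule ind[of "\<lambda>n. \<not> lost f (sg h n)"], (intro rep_intros rep_const; simp))
    fix n assume IH: "\<not> lost f (sg h n)"
    obtain a where a: "\<And>b. \<not> lost f (move (sg h n) a b)" using not_lost_cases[OF IH] f by blast
    show "\<not> lost f (sg h (sc n))"
    proof (cases "odd n")
      case True
      then show ?thesis using a by simp
    next
      case False
      then have "\<not> lost f (snoc (sg h n) a)" using a by simp
      \<comment> \<open>Some move \<open>a\<close> keeps the win, and the minimal move is at least
        as fast as \<open>a\<close>; were it lost, \<open>a\<close> would be lost too.\<close>
      then show ?thesis using faster_lost[OF minimal[OF False IH, of a]] by auto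
    qed
  qed (simp add: assms(1))
  have "\<forall>k. (odd k \<longrightarrow> odd (ln \<zero>)) \<and> (odd (ln \<zero>) \<longrightarrow> odd k) \<longrightarrow> \<not> faster f (sg h k) \<zero>"
  proof (rule not_lost_induct[of "\<lambda>t. \<forall>k. (odd k \<longrightarrow> odd (ln t)) \<and> (odd (ln t) \<longrightarrow> odd k) \<longrightarrow>
      \<not> faster f (sg h k) t", OF _ assms(1)])
    show "decp False [Nt] (\<lambda>xs. \<forall>k. (odd k \<longrightarrow> odd (ln (hd xs))) \<and> (odd (ln (hd xs)) \<longrightarrow> odd k) \<longrightarrow>
      \<not> faster f (sg h k) (hd xs))"
      by (intro rep_intros rep_const; simp)
  next
    fix t assume "f \<bullet> t = \<zero>"
    then show "\<forall>k. (odd k \<longrightarrow> odd (ln t)) \<and> (odd (ln t) \<longrightarrow> odd k) \<longrightarrow> \<not> faster f (sg h k) t"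
      using faster_unfold f unfolding faster_step_def by blast
  next
    fix t assume t: "odd (ln t)" and IH: "\<And>a. \<forall>k. (odd k \<longrightarrow> odd (ln (snoc t a))) \<and>
      (odd (ln (snoc t a)) \<longrightarrow> odd k) \<longrightarrow> \<not> faster f (sg h k) (snoc t a)"
    have "\<not> faster f (sg h k) t" if k: "odd k" for k
    proof
      assume "faster f (sg h k) t"
      then obtain b where "faster f (sg h (sc k)) (snoc t b)"
        using faster_unfold[of f "sg h k" t] f[of k] k by (auto simp: faster_step_def)
      then show False using IH[of b, rule_format, of "sc k"] t k by simp
    qed
    then show "\<forall>k. (odd k \<longrightarrow> odd (ln t)) \<and> (odd (ln t) \<longrightarrow> odd k) \<longrightarrow> \<not> faster f (sg h k) t"
      using t by blast
  next
    fix t a assume t: "\<not> odd (ln t)" and IH: "\<forall>k. (odd k \<longrightarrow> odd (ln (snoc t a))) \<and>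
      (odd (ln (snoc t a)) \<longrightarrow> odd k) \<longrightarrow> \<not> faster f (sg h k) (snoc t a)"
    have "\<not> faster f (sg h k) t" if k: "\<not> odd k" for k
    proof
      assume "faster f (sg h k) t"
      then obtain b where b: "faster f (snoc (sg h k) b) (snoc t a)"
        using faster_unfold[of f "sg h k" t] f[of k] k by (auto simp: faster_step_def)
      \<comment> \<open>The comparison provides some answer \<open>b\<close>, not the move actually
        played. The played move is minimal, hence at least as fast as \<open>b\<close>, and
        transitivity applies.\<close>
      have "faster f (sg h (sc k)) (snoc t a)"
        using faster_trans[OF minimal[OF k not_lost] b] by simp
      then show False using IH[rule_format, of "sc k"] t k by simp
    qed
    then show "\<forall>k. (odd k \<longrightarrow> odd (ln t)) \<and> (odd (ln t) \<longrightarrow> odd k) \<longrightarrow> \<not> faster f (sg h k) t"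
      using t by blast
  qed
  from this[rule_format, of \<zero>] show False using faster_refl[of f \<zero>] by simp
qed

lemma UDET: "sat e USigma01_DET"
proof -
  define \<sigma> where "\<sigma> f i = Lam Nt Nt (\<lambda>s. if i = \<one> then strategy0 f s else strategy1 f s)" for f i
  define \<Phi> where "\<Phi> = Lam T1 (Nt \<leadsto> T1) (\<lambda>f. Lam Nt T1 (\<lambda>i. \<sigma> f i))"
  have 0: "rep False [Nt, Nt, T1] Nt (\<lambda>xs. if hd (tl xs) = \<one> then strategy0 (hd (tl (tl xs))) (hd xs)
      else strategy1 (hd (tl (tl xs))) (hd xs))"
    by (intro rep_intros rep_const; simp)
  have 1: "rep False [Nt, T1] T1 (\<lambda>xs. \<sigma> (hd (tl xs)) (hd xs))"
    unfolding \<sigma>_def by (rule rep_Lam, rule 0)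
  have 2: "rep False [T1] (Nt \<leadsto> T1) (\<lambda>xs. Lam Nt T1 (\<lambda>i. \<sigma> (hd xs) i))"
    by (rule rep_Lam, rule 1)
  have \<Phi>: "strategy \<Phi> f i = \<sigma> f i" for f i
    unfolding \<Phi>_def using beta[OF 2] beta[OF rep_fix_last[OF 1]] by simp
  have \<sigma>: "\<sigma> f i \<bullet> s = (if i = \<one> then strategy0 f s else strategy1 f s)" for f i s
    unfolding \<sigma>_def by (rule beta[of False]) (intro rep_intros rep_const; simp)
  show ?thesis unfolding sat_UDET
  proof (intro exI[of _ \<Phi>] allI)
    fix f
    show "(\<forall>T. wins (strategy \<Phi> f \<one>) T f) \<or> (\<forall>S. \<not> wins S (strategy \<Phi> f (sc \<one>)) f)"
    proof (cases "lost f \<zero>")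
      case True
      then show ?thesis using player1_wins[of f "\<sigma> f (sc \<one>)"] by (simp add: \<Phi> \<sigma>)
    next
      case False
      then show ?thesis using player0_wins[of f "\<sigma> f \<one>"] by (simp add: \<Phi> \<sigma>)
    qed
  qed
qed

end

lemma (in model) S2_imp_UDET: assumes "sat e S2" shows "sat e USigma01_DET"
proof -
  obtain Su where "\<And>f. Su \<star> f = \<zero> \<longleftrightarrow> path f" using assms unfolding sat_S2 by blast
  then interpret suslin_model ap ci std \<D> Su by unfold_locales
  show ?thesis by (rule UDET)
qed

lemma sentence_simps:
  "wff L (Iff Pi11_TRANS Sigma01_DET_star)" "wff L (Iff Sigma01_DET_star USigma01_DET)"
  "wff L (Iff USigma01_DET S2)"
  "gdf (Iff Pi11_TRANS Sigma01_DET_star)" "gdf (Iff Sigma01_DET_star USigma01_DET)"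
  "gdf (Iff USigma01_DET S2)"
  "fv (Iff Pi11_TRANS Sigma01_DET_star) = {}" "fv (Iff Sigma01_DET_star USigma01_DET) = {}"
  "fv (Iff USigma01_DET S2) = {}"
  by (auto simp: Pi11_TRANS_def Sigma01_DET_star_def USigma01_DET_def S2_def suslin_def phi_play_def
      is_play_def phi_def seg_def plus_def Let_def Iff_def And_def Or_def Neg_def Ex_def All_st_def Ex_st_def)

theorem corollary7p9:
  fixes \<D> :: "nat \<times> ty \<rightharpoonup> fm"
  assumes "admissible \<D>"
  shows "prv (dom \<D>) (base_theory \<D>) (Iff Pi11_TRANS Sigma01_DET_star) \<and>
         prv (dom \<D>) (base_theory \<D>) (Iff Sigma01_DET_star USigma01_DET) \<and>
         prv (dom \<D>) (base_theory \<D>) (Iff USigma01_DET S2)"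
proof -
  obtain i where D: "\<D> (i, T2) = Some suslin_spec" using assms by (auto simp: admissible_def)
  have "signature.sat ap ci std e (Iff Pi11_TRANS Sigma01_DET_star) \<and>
    signature.sat ap ci std e (Iff Sigma01_DET_star USigma01_DET) \<and>
    signature.sat ap ci std e (Iff USigma01_DET S2)"
    if "model ap ci std \<D>" for ap ci std and e :: "string \<times> ty \<Rightarrow> nat"
  proof -
    interpret model ap ci std \<D> by (rule that)
    show ?thesis
      using Pi11_imp_S2[OF _ D, of e] S2_imp_UDET[of e] UDET_imp_DET_star[of e]
        DET_star_imp_Pi11[of e] by auto
  qed
  then show ?thesis using sentence_simps by (intro conjI completeness) blast+
qed

end
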